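(* Let $p\ge 1$, let $A\in\mathbb{R}^{p\times p}$, let $\Sigma_{\mathbf w}\succ 0$ and $\Sigma_{\mathbf x_0}\succ 0$ be $p\times p$ covariance matrices, and let $(\mathbf x_t)_{t\ge 0}$ be the time-invariant $\mathbb{R}^p$-valued Gauss-Markov process $\mathbf x_{t+1}=A\mathbf x_t+\mathbf w_t$, where $\mathbf x_0\sim\mathcal N(0,\Sigma_{\mathbf x_0})$ and $(\mathbf w_t)$ is white Gaussian noise, $\mathbf w_t\sim\mathcal N(0,\Sigma_{\mathbf w})$, independent of $\mathbf x_0$. Then for every $D>0$, $$R^{\mathrm{SRD}}(D)=\widehat R^{\mathrm{SRD}}(D),$$ where $R^{\mathrm{SRD}}(D)$ is the limit, as the horizon tends to infinity, of the finite-time sequential rate-distortion functions of $(\mathbf x_t)$ and $\widehat R^{\mathrm{SRD}}(D)$ is the quantity obtained by interchanging the limit and the infimum (both defined in the context).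
   Context: Causal reconstruction: a reconstruction process $(\mathbf y_t)_{t\ge0}$ with values in $\mathbb{R}^p$ is specified by a sequence of conditional distributions (stochastic kernels) $\mathbf P(dy_t\mid y^{t-1},x^t)$, $t=0,1,\dots$, where $x^t=(x_0,\dots,x_t)$, $y^{t-1}=(y_0,\dots,y_{t-1})$, and for $t=0$ the kernel is $\mathbf P(dy_0\mid x_0)$. For a horizon $n$ write $\mathbf P(dy^n\|x^n)=\prod_{t=0}^n\mathbf P(dy_t\mid y^{t-1},x^t)$. The joint law of $(\mathbf x^n,\mathbf y^n)$ is $\mathbf P(dx^n)\otimes\mathbf P(dy^n\|x^n)$, where $\mathbf P(dx^n)$ is the given law of the source. Expectation and the mutual information $I(\mathbf x^n;\mathbf y^n)$ are taken with respect to this joint law; under it, $I(\mathbf x^n;\mathbf y^n)=\sum_{t=0}^n I(\mathbf x^t;\mathbf y_t\mid\mathbf y^{t-1})$. Finite-time sequential rate-distortion (SRD) function: $$R^{\mathrm{SRD}}_{0,n}(D)=\inf_{\mathbf P(dy^n\|x^n)}\frac{1}{n+1}I(\mathbf x^n;\mathbf y^n)\quad\text{subject to}\quad \mathbb{E}\|\mathbf x_t-\mathbf y_t\|^2\le D\ \text{ for all } t=0,\dots,n,$$ with $\|\cdot\|$ the Euclidean norm. Asymptotic SRD function: $R^{\mathrm{SRD}}(D)=\lim_{n\to\infty}R^{\mathrm{SRD}}_{0,n}(D)$, provided the limit exists. Interchanged version: $$\widehat R^{\mathrm{SRD}}(D)=\inf_{\mathbf P(dy^\infty\|x^\infty)}\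 \lim_{n\to\infty}\frac{1}{n+1}I(\mathbf x^n;\mathbf y^n)\quad\text{subject to}\quad \mathbb{E}\|\mathbf x_t-\mathbf y_t\|^2\le D\ \text{ for all } t\ge 0,$$ where $\mathbf P(dy^\infty\|x^\infty)$ denotes the whole sequence of kernels $\mathbf P(dy_t\mid y^{t-1},x^t)$, $t=0,1,\dots$ (those for which the limit exists). *)

theory Defs
  imports "HOL-Probability.Probability"
begin

definition positive_definite :: "real^'n^'n \<Rightarrow> bool" where
  "positive_definite S \<longleftrightarrow> transpose S = S \<and> (\<forall>v. v \<noteq> 0 \<longrightarrow> 0 < v \<bullet> (S *v v))"

text \<open>Density of \<open>N(0, S)\<close> with respect to Lebesgue measure, for positive definite \<open>S\<close>.\<close>

definition gaussian_density :: "real^'n^'n \<Rightarrow> real^'n \<Rightarrow> real" where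
  "gaussian_density S v =
     exp (- (v \<bullet> (matrix_inv S *v v)) / 2) / sqrt ((2 * pi) ^ CARD('n) * det S)"

text \<open>
  Finite trajectories are elements of a product space over an index set \<open>I\<close> of times.
  Here \<open>I = {..t}\<close> for \<open>x\<^sup>t\<close> and \<open>I = {..<t}\<close> for \<open>y\<^bsup>t-1\<^esup>\<close>; for \<open>t = 0\<close> the latter is a
  one-point space, so that a kernel at time 0 depends on \<open>x\<^sub>0\<close> only.
\<close>

abbreviation paths :: "nat set \<Rightarrow> (nat \<Rightarrow> real^'n) measure" where
  "paths I \<equiv> PiM I (\<lambda>_. borel)"

text \<open>\<open>K t x y\<close> is the conditional distribution of \<open>y\<^sub>t\<close> given \<open>x\<^sup>t = x\<close> and \<open>y\<^bsup>t-1\<^esup> = y\<close>.\<close>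

type_synonym 'n kernels = "nat \<Rightarrow> (nat \<Rightarrow> real^'n) \<Rightarrow> (nat \<Rightarrow> real^'n) \<Rightarrow> (real^'n) measure"

definition stochastic_kernel :: "'n::finite kernels \<Rightarrow> nat \<Rightarrow> bool" where
  "stochastic_kernel K t \<longleftrightarrow>
     (\<lambda>(x, y). K t x y) \<in> paths {..t} \<Otimes>\<^sub>M paths {..<t} \<rightarrow>\<^sub>M prob_algebra borel"

text \<open>
  \<open>causal_product K N x\<close> is the law of \<open>(y\<^sub>0, \<dots>, y\<^bsub>N-1\<^esub>)\<close> when the source trajectory is \<open>x\<close>,
  that is, the product of the kernels at times \<open>t < N\<close>.
\<close>

primrec causal_product ::
    "'n::finite kernels \<Rightarrow> nat \<Rightarrow> (nat \<Rightarrow> real^'n) \<Rightarrow> (nat \<Rightarrow> real^'n) measure" where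
  "causal_product K 0 x = return (paths {..<0}) (\<lambda>_. undefined)"
| "causal_product K (Suc t) x =
     causal_product K t x \<bind>
       (\<lambda>y. distr (K t (restrict x {..t}) y) (paths {..<Suc t}) (\<lambda>v. y(t := v)))"

definition source_law :: "'a measure \<Rightarrow> (nat \<Rightarrow> 'a \<Rightarrow> real^'n) \<Rightarrow> nat \<Rightarrow> (nat \<Rightarrow> real^'n) measure" where
  "source_law M x n = distr M (paths {..n}) (\<lambda>\<omega>. \<lambda>t\<in>{..n}. x t \<omega>)"

text \<open>The joint law of \<open>(x\<^sup>n, y\<^sup>n)\<close>.\<close>

definition joint_law ::
    "'a measure \<Rightarrow> (nat \<Rightarrow> 'a \<Rightarrow> real^'n) \<Rightarrow> 'n::finite kernels \<Rightarrow> nat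
      \<Rightarrow> ((nat \<Rightarrow> real^'n) \<times> (nat \<Rightarrow> real^'n)) measure" where
  "joint_law M x K n =
     source_law M x n \<bind>
       (\<lambda>u. distr (causal_product K (Suc n) u) (paths {..n} \<Otimes>\<^sub>M paths {..n}) (\<lambda>y. (u, y)))"

text \<open>
  The library's \<^const>\<open>KL_divergence\<close> and \<open>mutual_information\<close> are real-valued, hence
  meaningless (e.g. 0) where the true value is infinite: when \<open>N\<close> is not absolutely continuous
  with respect to \<open>M\<close>, or when the log-density is not \<open>N\<close>-integrable. (For probability measures
  its negative part is always integrable, so non-integrability means divergence to \<open>\<infinity>\<close>.)
  As in the library, the divergence is that of the second argument from the first.
  Logarithms are natural.
\<close>

definition extended_KL_divergence :: "'a measure \<Rightarrow> 'a measure \<Rightarrow> ereal" where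
  "extended_KL_divergence M N =
     (if absolutely_continuous M N \<and> integrable N (entropy_density (exp 1) M N)
      then ereal (KL_divergence (exp 1) M N) else \<infinity>)"

text \<open>The mutual information of the two components of a law \<open>P\<close> on \<open>S \<Otimes>\<^sub>M T\<close>.\<close>

definition extended_mutual_information ::
    "('a \<times> 'b) measure \<Rightarrow> 'a measure \<Rightarrow> 'b measure \<Rightarrow> ereal" where
  "extended_mutual_information P S T =
     extended_KL_divergence (distr P S fst \<Otimes>\<^sub>M distr P T snd) P"

definition information_rate ::
    "'a measure \<Rightarrow> (nat \<Rightarrow> 'a \<Rightarrow> real^'n) \<Rightarrow> 'n::finite kernels \<Rightarrow> nat \<Rightarrow> ereal" where
  "information_rate M x K n =
     ereal (1 / (real n + 1)) *
       extended_mutual_information (joint_law M x K n) (paths {..n}) (paths {..n})"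

text \<open>
  The expectation of the squared error is a nonnegative integral with values in \<open>[0, \<infinity>]\<close>, so
  that an infinite distortion does violate the constraint.
\<close>

definition meets_distortion ::
    "'a measure \<Rightarrow> (nat \<Rightarrow> 'a \<Rightarrow> real^'n) \<Rightarrow> 'n::finite kernels \<Rightarrow> nat \<Rightarrow> real \<Rightarrow> bool" where
  "meets_distortion M x K n D \<longleftrightarrow>
     (\<forall>t\<le>n. (\<integral>\<^sup>+ (u, y). ennreal ((norm (u t - y t))\<^sup>2) \<partial>joint_law M x K n) \<le> ennreal D)"

definition srd_finite ::
    "'a measure \<Rightarrow> (nat \<Rightarrow> 'a \<Rightarrow> real^'n::finite) \<Rightarrow> nat \<Rightarrow> real \<Rightarrow> ereal" where
  "srd_finite M x n D =
     (INF K \<in> {K. (\<forall>t\<le>n. stochastic_kernel K t) \<and> meets_distortion M x K n D}.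
        information_rate M x K n)"

definition srd ::
    "'a measure \<Rightarrow> (nat \<Rightarrow> 'a \<Rightarrow> real^'n::finite) \<Rightarrow> real \<Rightarrow> ereal" where
  "srd M x D = lim (\<lambda>n. srd_finite M x n D)"

text \<open>
  The joint laws for different horizons are marginals of one another, so the distortion
  constraint at all times is the constraint for all horizons.
\<close>

definition srd_interchanged ::
    "'a measure \<Rightarrow> (nat \<Rightarrow> 'a \<Rightarrow> real^'n::finite) \<Rightarrow> real \<Rightarrow> ereal" where
  "srd_interchanged M x D =
     (INF K \<in> {K. (\<forall>t. stochastic_kernel K t) \<and> (\<forall>n. meets_distortion M x K n D) \<and>
                  convergent (information_rate M x K)}.
        lim (information_rate M x K))"

end

theory Submission
  imports Defs
begin

text \<open>
  Kernels that satisfy the constraint at all times are admissible at every horizon, so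
  \<open>srd_finite\<close> at horizon \<open>n\<close> is at most their information rate up to \<open>n\<close>. Let \<open>L\<close> be the lower
  limit of \<open>srd_finite\<close>. If \<open>L\<close> is infinite, both sides of the theorem are infinite. Otherwise it
  suffices to find one sequence of kernels that satisfies the constraint at all times and whose
  information rate has upper limit at most \<open>L\<close> (\<open>limit_achieving_kernels\<close>): the rate and
  \<open>srd_finite\<close> are then both squeezed to \<open>L\<close>. This gives at once that the limit exists and that it
  is attained by kernels chosen before the horizon.

  The kernels are obtained by running near-optimal finite-horizon kernels one after the other.
  Such a concatenation costs a bounded amount of information per restart, uniformly in the
  lengths, for a reason that applies to unstable \<open>A\<close> as well. Suppose that the restart happens at time
  \<open>m\<close>. The prediction error \<open>e = x\<^sub>m - A y\<^bsub>m-1\<^esub>\<close> has bounded second moment, because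
  \<open>x\<^bsub>m-1\<^esub> - y\<^bsub>m-1\<^esub>\<close> has. The encoder draws \<open>\<xi>\<close> with the law of \<open>x\<^sub>0\<close>, independently of everything
  else, and reveals \<open>c = x\<^sub>m - \<xi>\<close>. The shifted process \<open>x\<^bsub>m+j\<^esub> - A\<^sup>j c\<close> starts at \<open>\<xi>\<close> and obeys
  the same recursion, so it has exactly the law of the source and is independent of the past. Any
  kernels for the source can therefore be run on it, adding \<open>A\<^sup>j c\<close> to their output, with exactly
  the same distortion (\<open>joint_restart\<close>, \<open>distortion_restart\<close>).

  A kernel sees only source and output, so whatever the decoder has to remember must be
  readable from the output. This concerns \<open>c\<close> and the first output of the new block, whereas \<open>y\<^sub>m\<close>
  itself must be within the permitted distance of \<open>x\<^sub>m\<close>. Hence \<open>y\<^sub>m\<close> is \<open>A y\<^bsub>m-1\<^esub>\<close> plus the rounding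
  of \<open>e\<close> to a grid plus a perturbation, smaller than the mesh, that encodes the two vectors
  injectively (\<open>grid_code\<close>).

  The information of the concatenation is at most the sum of the two informations plus a
  constant \<open>overhead\<close> (\<open>information_restart\<close>). Mutual information is bounded by the relative entropy
  with respect to the product of the source law and any law of the output
  (\<open>extended_mutual_information_le\<close>). The latter is taken so that past, new block, grid point
  and \<open>c\<close> are generated in the simplest way. The resulting density is the product of the two
  given densities and a ratio of Gaussian densities, whose logarithm grows quadratically and
  thus has bounded expectation.

  Long blocks make the overhead negligible per unit of time. Inside a block only
  monotonicity of the information in the horizon is available (\<open>information_mono\<close>), so blocks
  must also be short compared with the time already elapsed. A block of each kind is repeated
  until the next kind has become comparatively cheap (\<open>slow_schedule\<close>).
\<close>

section \<open>Pushforwards, relative entropy and mutual information\<close>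

lemma ln_le_self: "0 < x \<Longrightarrow> ln x \<le> (x::real)"
  using ln_le_minus_one[of x] by simp

text \<open>
  Chain rule for relative entropy along a map \<open>T\<close>: the log-density of \<open>P\<close> splits into that of
  the image law and that of \<open>P\<close> with respect to \<open>(h \<circ> T) \<cdot> R\<close>. Both have nonnegative expectation
  because \<open>ln s \<ge> 1 - 1/s\<close>. Integrability is obtained along the way from
  \<open>- 1/h \<le> ln h \<le> ln f + h/f\<close>, where \<open>1/h\<close> and \<open>h/f\<close> have expectation at most 1. With \<open>T\<close> a
  restriction of paths this gives monotonicity in the horizon; with \<open>T = snd\<close> it shows that the
  true output law is the best reference law.
\<close>
lemma relative_entropy_pushforward:
  fixes f :: "'a \<Rightarrow> real"
  assumes "prob_space P" "prob_space R"
    and f [measurable]: "f \<in> borel_measurable R" and f_nonneg: "\<And>x. 0 \<le> f x"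
    and P: "P = density R (\<lambda>x. ennreal (f x))"
    and int_f: "integrable P (\<lambda>x. ln (f x))"
    and T [measurable]: "T \<in> R \<rightarrow>\<^sub>M N"
  obtains h :: "'b \<Rightarrow> real"
  where "h \<in> borel_measurable N" "\<And>y. 0 \<le> h y"
    and "distr P N T = density (distr R N T) (\<lambda>y. ennreal (h y))"
    and "AE x in P. 0 < f x \<and> 0 < h (T x)"
    and "integrable P (\<lambda>x. ln (h (T x)))"
    and "0 \<le> (\<integral>x. ln (h (T x)) \<partial>P)"
    and "(\<integral>x. ln (h (T x)) \<partial>P) \<le> (\<integral>x. ln (f x) \<partial>P)"
proof -
  interpret P: prob_space P by fact
  interpret R: prob_space R by fact
  have sets_P [measurable_cong]: "sets P = sets R" by (simp add: P)
  interpret PT: prob_space "distr P N T" by (rule P.prob_space_distr) simp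
  interpret RT: prob_space "distr R N T" by (rule R.prob_space_distr) simp
  have "absolutely_continuous R P"
    unfolding P by (rule absolutely_continuousI_density) measurable
  then have ac: "absolutely_continuous (distr R N T) (distr P N T)"
    unfolding absolutely_continuous_def
    by (auto simp: null_sets_distr_iff subset_eq sets_eq_imp_space_eq[OF sets_P])
  obtain h where h: "h \<in> borel_measurable (distr R N T)"
      "AE y in distr R N T. RN_deriv (distr R N T) (distr P N T) y = ennreal (h y)"
      "AE y in distr P N T. 0 < h y" "\<And>y. 0 \<le> h y"
    using RT.real_RN_deriv[OF PT.finite_measure_axioms ac] by auto
  have h_meas [measurable]: "h \<in> borel_measurable N" using h(1) by simp
  have dens: "distr P N T = density (distr R N T) (\<lambda>y. ennreal (h y))"
    using RT.density_RN_deriv[OF ac] h(2)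
    by (subst density_cong[of _ _ "RN_deriv (distr R N T) (distr P N T)"]) auto
  have f_pos: "AE x in P. 0 < f x"
    unfolding P by (subst AE_density) auto
  have h_pos: "AE x in P. 0 < h (T x)"
    using h(3) by (subst (asm) AE_distr_iff) auto
  have "(\<integral>\<^sup>+x. ennreal (h (T x) / f x) \<partial>P) \<le> (\<integral>\<^sup>+x. ennreal (h (T x)) \<partial>R)"
    unfolding P by (subst nn_integral_density)
      (auto intro!: nn_integral_mono simp: f_nonneg h(4) simp flip: ennreal_mult)
  also have "\<dots> = (\<integral>\<^sup>+y. ennreal (h y) \<partial>distr R N T)"
    by (subst nn_integral_distr) auto
  also have "\<dots> = emeasure (distr P N T) (space N)"
    unfolding dens by (subst emeasure_density) (auto intro!: nn_integral_cong)
  also have "\<dots> = 1" using PT.emeasure_space_1 by simp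
  finally have le1: "(\<integral>\<^sup>+x. ennreal (h (T x) / f x) \<partial>P) \<le> 1" .
  have "(\<integral>\<^sup>+x. ennreal (1 / h (T x)) \<partial>P) = (\<integral>\<^sup>+y. ennreal (1 / h y) \<partial>distr P N T)"
    by (subst nn_integral_distr) auto
  also have "\<dots> \<le> (\<integral>\<^sup>+y. 1 \<partial>distr R N T)"
    unfolding dens by (subst nn_integral_density)
      (auto intro!: nn_integral_mono simp: h(4) simp del: nn_integral_const simp flip: ennreal_mult)
  also have "\<dots> = 1" using RT.emeasure_space_1 by simp
  finally have le2: "(\<integral>\<^sup>+x. ennreal (1 / h (T x)) \<partial>P) \<le> 1" .
  have i1: "integrable P (\<lambda>x. h (T x) / f x)"
    using le1 by (intro integrableI_nonneg) (auto simp: f_nonneg h(4) intro: le_less_trans)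
  have i2: "integrable P (\<lambda>x. 1 / h (T x))"
    using le2 by (intro integrableI_nonneg) (auto simp: h(4) intro: le_less_trans)
  have e1: "(\<integral>x. h (T x) / f x \<partial>P) \<le> 1"
    using le1 by (subst integral_eq_nn_integral)
      (auto simp: f_nonneg h(4) enn2real_leI)
  have e2: "(\<integral>x. 1 / h (T x) \<partial>P) \<le> 1"
    using le2 by (subst integral_eq_nn_integral)
      (auto simp: h(4) enn2real_leI)
  have bnd: "AE x in P. norm (ln (h (T x))) \<le> norm (\<bar>ln (f x)\<bar> + h (T x) / f x + 1 / h (T x))"
    using f_pos h_pos
  proof eventually_elim
    case (elim x)
    have "ln (h (T x)) - ln (f x) \<le> h (T x) / f x"
      using ln_le_self[of "h (T x) / f x"] elim by (simp add: ln_div)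
    moreover have "- ln (h (T x)) \<le> 1 / h (T x)"
      using ln_le_self[of "1 / h (T x)"] elim by (simp add: ln_div)
    moreover have "0 < h (T x) / f x" "0 < 1 / h (T x)" using elim by auto
    ultimately show ?case unfolding real_norm_def by linarith
  qed
  have int_h: "integrable P (\<lambda>x. ln (h (T x)))"
    by (rule Bochner_Integration.integrable_bound[OF _ _ bnd]) (use int_f i1 i2 in auto)
  have nn: "0 \<le> (\<integral>x. ln (h (T x)) \<partial>P)"
  proof -
    have "0 \<le> (\<integral>x. 1 - 1 / h (T x) \<partial>P)"
      using i2 e2 by (simp add: P.prob_space)
    also have "\<dots> \<le> (\<integral>x. ln (h (T x)) \<partial>P)"
    proof (rule integral_mono_AE)
      show "AE x in P. 1 - 1 / h (T x) \<le> ln (h (T x))"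
        using h_pos
      proof eventually_elim
        case (elim x)
        then show ?case using ln_le_minus_one[of "1 / h (T x)"] by (simp add: ln_div)
      qed
    qed (use i2 int_h in auto)
    finally show ?thesis .
  qed
  have le: "(\<integral>x. ln (h (T x)) \<partial>P) \<le> (\<integral>x. ln (f x) \<partial>P)"
  proof -
    have "0 \<le> (\<integral>x. 1 - h (T x) / f x \<partial>P)"
      using i1 e1 by (simp add: P.prob_space)
    also have "\<dots> \<le> (\<integral>x. ln (f x) - ln (h (T x)) \<partial>P)"
    proof (rule integral_mono_AE)
      show "AE x in P. 1 - h (T x) / f x \<le> ln (f x) - ln (h (T x))"
        using h_pos f_pos
      proof eventually_elim
        case (elim x)
        then show ?case using ln_le_minus_one[of "h (T x) / f x"] by (simp add: ln_div)
      qed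
    qed (use i1 int_h int_f in auto)
    finally show ?thesis using int_f int_h by simp
  qed
  show thesis
    by (rule that[of h, OF h_meas h(4) dens _ int_h nn le]) (use f_pos h_pos in auto)
qed

lemma extended_KL_divergence_density:
  fixes f :: "'a \<Rightarrow> real"
  assumes "prob_space R"
    and f [measurable]: "f \<in> borel_measurable R" and f_nonneg: "\<And>x. 0 \<le> f x"
    and P: "P = density R (\<lambda>x. ennreal (f x))"
    and int_f: "integrable P (\<lambda>x. ln (f x))"
  shows "extended_KL_divergence R P = ereal (\<integral>x. ln (f x) \<partial>P)"
proof -
  interpret R: prob_space R by fact
  have sets_P [measurable_cong]: "sets P = sets R" by (simp add: P)
  have ac: "absolutely_continuous R P"
    unfolding P by (rule absolutely_continuousI_density) measurable
  have "AE x in R. ennreal (f x) = RN_deriv R P x"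
    by (rule R.RN_deriv_unique) (use P in simp_all)
  then have "AE x in R. RN_deriv R P x = ennreal (f x)"
    by eventually_elim simp
  then have "AE x in P. RN_deriv R P x = ennreal (f x)"
    by (rule absolutely_continuous_AE[OF sets_P ac])
  then have eq: "AE x in P. entropy_density (exp 1) R P x = ln (f x)"
    by eventually_elim (simp add: entropy_density_def log_def f_nonneg)
  have m: "entropy_density (exp 1) R P \<in> borel_measurable P"
    using measurable_cong_sets[OF sets_P refl] measurable_entropy_density by blast
  have m2: "(\<lambda>x. ln (f x)) \<in> borel_measurable P" by measurable
  have "integrable P (entropy_density (exp 1) R P)"
    using int_f integrable_cong_AE[OF m m2 eq] by simp
  moreover have "KL_divergence (exp 1) R P = (\<integral>x. ln (f x) \<partial>P)"
    unfolding KL_divergence_def by (rule integral_cong_AE[OF m m2 eq])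
  ultimately show ?thesis using ac by (simp add: extended_KL_divergence_def)
qed

lemma extended_KL_divergence_finiteE:
  assumes "prob_space R" "prob_space P" "sets P = sets R" "extended_KL_divergence R P < \<infinity>"
  obtains f :: "'a \<Rightarrow> real"
  where "f \<in> borel_measurable R" "\<And>x. 0 \<le> f x" "P = density R (\<lambda>x. ennreal (f x))"
    "integrable P (\<lambda>x. ln (f x))" "extended_KL_divergence R P = ereal (\<integral>x. ln (f x) \<partial>P)"
proof -
  interpret R: prob_space R by fact
  interpret P: prob_space P by fact
  note sets_P [measurable_cong] = assms(3)
  have ac: "absolutely_continuous R P" and i: "integrable P (entropy_density (exp 1) R P)"
    using assms(4) by (auto simp: extended_KL_divergence_def split: if_splits)
  obtain f where f: "f \<in> borel_measurable R"
      "AE y in R. RN_deriv R P y = ennreal (f y)" "\<And>y. 0 \<le> f y"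
    using R.real_RN_deriv[OF P.finite_measure_axioms ac assms(3)] by metis
  note [measurable] = f(1)
  have dens: "P = density R (\<lambda>y. ennreal (f y))"
    using R.density_RN_deriv[OF ac assms(3)] f(2)
    by (subst density_cong[of _ _ "RN_deriv R P"]) auto
  have "AE x in P. RN_deriv R P x = ennreal (f x)"
    by (rule absolutely_continuous_AE[OF assms(3) ac f(2)])
  then have eq: "AE x in P. entropy_density (exp 1) R P x = ln (f x)"
    by eventually_elim (simp add: entropy_density_def log_def f(3))
  have m: "entropy_density (exp 1) R P \<in> borel_measurable P"
    using measurable_cong_sets[OF sets_P refl] measurable_entropy_density by blast
  have m2: "(\<lambda>x. ln (f x)) \<in> borel_measurable P" by measurable
  have i': "integrable P (\<lambda>x. ln (f x))"
    using i integrable_cong_AE[OF m m2 eq] by simp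
  show thesis
    by (rule that[OF f(1,3) dens i' extended_KL_divergence_density[OF assms(1) f(1,3) dens i']])
qed

lemma distr_pair_snd:
  assumes "prob_space R" "prob_space Q"
  shows "distr (R \<Otimes>\<^sub>M Q) Q snd = Q"
proof (rule measure_eqI)
  interpret R: prob_space R by fact
  interpret Q: prob_space Q by fact
  fix X assume "X \<in> sets (distr (R \<Otimes>\<^sub>M Q) Q snd)"
  then have X: "X \<in> sets Q" by simp
  have "snd -` X \<inter> space (R \<Otimes>\<^sub>M Q) = space R \<times> X"
    using sets.sets_into_space[OF X] by (auto simp: space_pair_measure)
  then show "emeasure (distr (R \<Otimes>\<^sub>M Q) Q snd) X = emeasure Q X"
    using X Q.emeasure_pair_measure_Times[OF sets.top[of R] X]
    by (subst emeasure_distr) (auto simp: R.emeasure_space_1)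
qed simp

text \<open>
  Replacing the marginal law of the second component by any reference law \<open>Q\<close> increases the
  relative entropy, by the divergence of the marginal from \<open>Q\<close>. So an upper bound on mutual
  information only requires an explicit density with respect to a convenient product measure.
\<close>
lemma extended_mutual_information_le:
  fixes f :: "'a \<times> 'b \<Rightarrow> real"
  assumes "prob_space P" "prob_space Q" "prob_space R"
    and sets_R: "sets R = sets S" and sets_Q: "sets Q = sets T"
    and f: "f \<in> borel_measurable (S \<Otimes>\<^sub>M T)" and f_nonneg: "\<And>x. 0 \<le> f x"
    and P: "P = density (R \<Otimes>\<^sub>M Q) (\<lambda>x. ennreal (f x))"
    and int_f: "integrable P (\<lambda>x. ln (f x))"
    and R: "distr P S fst = R"
  shows "extended_mutual_information P S T \<le> ereal (\<integral>x. ln (f x) \<partial>P)"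
proof -
  interpret P: prob_space P by fact
  interpret Q: prob_space Q by fact
  interpret R: prob_space R by fact
  interpret RQ: pair_prob_space R Q ..
  note sets_R [measurable_cong] sets_Q [measurable_cong]
  have sets_RQ: "sets (R \<Otimes>\<^sub>M Q) = sets (S \<Otimes>\<^sub>M T)"
    using sets_R sets_Q by (rule sets_pair_measure_cong)
  have f_meas [measurable]: "f \<in> borel_measurable (R \<Otimes>\<^sub>M Q)"
    using f measurable_cong_sets[OF sets_RQ refl] by blast
  have [measurable_cong]: "sets P = sets (R \<Otimes>\<^sub>M Q)" by (simp add: P)
  have "snd \<in> R \<Otimes>\<^sub>M Q \<rightarrow>\<^sub>M T" by measurable
  then obtain h where h: "h \<in> borel_measurable T" "\<And>y. 0 \<le> h y"
    "distr P T snd = density (distr (R \<Otimes>\<^sub>M Q) T snd) (\<lambda>y. ennreal (h y))"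
    "AE x in P. 0 < f x \<and> 0 < h (snd x)"
    "integrable P (\<lambda>x. ln (h (snd x)))"
    "0 \<le> (\<integral>x. ln (h (snd x)) \<partial>P)"
    by (rule relative_entropy_pushforward
        [OF assms(1) RQ.prob_space_axioms f_meas f_nonneg P int_f]) (rule that)
  have [measurable]: "h \<in> borel_measurable Q"
    using h(1) measurable_cong_sets[OF sets_Q refl] by blast
  have "distr (R \<Otimes>\<^sub>M Q) T snd = distr (R \<Otimes>\<^sub>M Q) Q snd"
    by (rule distr_cong) (simp_all add: sets_Q)
  also have "\<dots> = Q" by (rule distr_pair_snd) unfold_locales
  finally have "distr (R \<Otimes>\<^sub>M Q) T snd = Q" .
  with h(3) have PT: "distr P T snd = density Q (\<lambda>y. ennreal (h y))" by simp
  have prod: "distr P S fst \<Otimes>\<^sub>M distr P T snd = density (R \<Otimes>\<^sub>M Q) (\<lambda>x. ennreal (h (snd x)))"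
  proof -
    have "prob_space (density Q (\<lambda>y. ennreal (h y)))"
      unfolding PT[symmetric] by (rule P.prob_space_distr) measurable
    then have sf: "sigma_finite_measure (density Q (\<lambda>y. ennreal (h y)))"
      by (simp add: prob_space_imp_sigma_finite)
    have "R \<Otimes>\<^sub>M density Q (\<lambda>y. ennreal (h y)) = density R (\<lambda>_. 1) \<Otimes>\<^sub>M density Q (\<lambda>y. ennreal (h y))"
      by (simp add: density_1)
    also have "\<dots> = density (R \<Otimes>\<^sub>M Q) (\<lambda>(x,y). 1 * ennreal (h y))"
      by (rule pair_measure_density) (use sf in \<open>auto simp: Q.sigma_finite_measure_axioms\<close>)
    finally show ?thesis unfolding R PT by (simp add: case_prod_beta')
  qed
  let ?R' = "density (R \<Otimes>\<^sub>M Q) (\<lambda>x. ennreal (h (snd x)))"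
  define f' where "f' x = f x / h (snd x)" for x
  have [measurable]: "f' \<in> borel_measurable (R \<Otimes>\<^sub>M Q)" unfolding f'_def by measurable
  have ae: "AE x in R \<Otimes>\<^sub>M Q. 0 < f x \<longrightarrow> 0 < h (snd x)"
    using h(4) unfolding P by (subst (asm) AE_density) auto
  have dens': "P = density ?R' (\<lambda>x. ennreal (f' x))"
    unfolding P
  proof (subst density_density_eq)
    have "AE x in R \<Otimes>\<^sub>M Q. ennreal (f x) = ennreal (h (snd x)) * ennreal (f' x)"
      using ae
    proof eventually_elim
      case (elim x)
      show ?case
      proof (cases "f x = 0")
        case False
        then have "0 < h (snd x)" using elim f_nonneg[of x] by linarith
        then show ?thesis by (simp add: f'_def f_nonneg flip: ennreal_mult)
      qed (simp add: f'_def)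
    qed
    then show "density (R \<Otimes>\<^sub>M Q) (\<lambda>x. ennreal (f x)) =
        density (R \<Otimes>\<^sub>M Q) (\<lambda>x. ennreal (h (snd x)) * ennreal (f' x))"
      by (intro density_cong) auto
  qed measurable
  have prob': "prob_space ?R'"
    unfolding prod[symmetric]
    by (rule prob_space_pair) (auto intro!: P.prob_space_distr)
  have ln': "AE x in P. ln (f' x) = ln (f x) - ln (h (snd x))"
    using h(4) by eventually_elim (simp add: f'_def ln_div)
  have m1: "(\<lambda>x. ln (f' x)) \<in> borel_measurable P" by measurable
  have m2: "(\<lambda>x. ln (f x) - ln (h (snd x))) \<in> borel_measurable P" by measurable
  have i': "integrable P (\<lambda>x. ln (f' x))"
    using integrable_cong_AE[OF m1 m2 ln'] int_f h(5) by simp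
  have "extended_KL_divergence ?R' P = ereal (\<integral>x. ln (f' x) \<partial>P)"
    by (rule extended_KL_divergence_density[OF prob' _ _ dens' i'])
       (auto simp: f'_def f_nonneg h(2))
  also have "(\<integral>x. ln (f' x) \<partial>P) = (\<integral>x. ln (f x) \<partial>P) - (\<integral>x. ln (h (snd x)) \<partial>P)"
    using integral_cong_AE[OF m1 m2 ln'] int_f h(5) by simp
  finally show ?thesis
    using h(6) by (simp add: extended_mutual_information_def prod)
qed

lemma nn_integral_swap:
  assumes "prob_space M1" "prob_space M2"
    and [measurable]: "(\<lambda>z. f (fst z) (snd z)) \<in> borel_measurable (M1 \<Otimes>\<^sub>M M2)"
  shows "(\<integral>\<^sup>+x. \<integral>\<^sup>+y. f x y \<partial>M2 \<partial>M1) = (\<integral>\<^sup>+y. \<integral>\<^sup>+x. f x y \<partial>M1 \<partial>M2)"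
proof -
  interpret pair_sigma_finite M1 M2
    by (intro pair_sigma_finite.intro prob_space_imp_sigma_finite assms)
  show ?thesis
    by (rule Fubini'[symmetric]) (simp add: case_prod_beta')
qed

lemma integral_pair_fst:
  fixes \<phi> :: "'a \<Rightarrow> real"
  assumes "prob_space N1" "prob_space N2" "integrable N1 \<phi>"
  shows "integrable (N1 \<Otimes>\<^sub>M N2) (\<lambda>z. \<phi> (fst z))" "(\<integral>z. \<phi> (fst z) \<partial>(N1 \<Otimes>\<^sub>M N2)) = (\<integral>z. \<phi> z \<partial>N1)"
proof -
  have d: "distr (N1 \<Otimes>\<^sub>M N2) N1 fst = N1" by (rule prob_space.distr_pair_fst) fact
  have m: "\<phi> \<in> borel_measurable N1" using assms(3) by auto
  show "integrable (N1 \<Otimes>\<^sub>M N2) (\<lambda>z. \<phi> (fst z))"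
    using assms(3) m by (subst (asm) d[symmetric], subst (asm) integrable_distr_eq) auto
  show "(\<integral>z. \<phi> (fst z) \<partial>(N1 \<Otimes>\<^sub>M N2)) = (\<integral>z. \<phi> z \<partial>N1)"
    using m by (subst (2) d[symmetric], subst integral_distr) auto
qed

lemma integral_pair_snd:
  fixes \<phi> :: "'b \<Rightarrow> real"
  assumes "prob_space N1" "prob_space N2" "integrable N2 \<phi>"
  shows "integrable (N1 \<Otimes>\<^sub>M N2) (\<lambda>z. \<phi> (snd z))" "(\<integral>z. \<phi> (snd z) \<partial>(N1 \<Otimes>\<^sub>M N2)) = (\<integral>z. \<phi> z \<partial>N2)"
proof -
  have d: "distr (N1 \<Otimes>\<^sub>M N2) N2 snd = N2" by (rule distr_pair_snd) fact+
  have m: "\<phi> \<in> borel_measurable N2" using assms(3) by auto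
  show "integrable (N1 \<Otimes>\<^sub>M N2) (\<lambda>z. \<phi> (snd z))"
    using assms(3) m by (subst (asm) d[symmetric], subst (asm) integrable_distr_eq) auto
  show "(\<integral>z. \<phi> (snd z) \<partial>(N1 \<Otimes>\<^sub>M N2)) = (\<integral>z. \<phi> z \<partial>N2)"
    using m by (subst (2) d[symmetric], subst integral_distr) auto
qed

lemma AE_pair_fst:
  assumes "prob_space N2" "AE z in N1. P z"
  shows "AE z in N1 \<Otimes>\<^sub>M N2. P (fst z)"
proof (rule AE_distrD[OF measurable_fst])
  show "AE z in distr (N1 \<Otimes>\<^sub>M N2) N1 fst. P z"
    unfolding prob_space.distr_pair_fst[OF assms(1)] by (rule assms(2))
qed

lemma AE_pair_snd:
  assumes "prob_space N1" "prob_space N2" "AE z in N2. P z"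
  shows "AE z in N1 \<Otimes>\<^sub>M N2. P (snd z)"
proof (rule AE_distrD[OF measurable_snd])
  show "AE z in distr (N1 \<Otimes>\<^sub>M N2) N2 snd. P z"
    unfolding distr_pair_snd[OF assms(1,2)] by (rule assms(3))
qed

lemma integral_le_of_nn_integral_le:
  fixes \<phi> :: "'a \<Rightarrow> real"
  assumes "\<phi> \<in> borel_measurable N" "\<And>z. 0 \<le> \<phi> z" "(\<integral>\<^sup>+z. ennreal (\<phi> z) \<partial>N) \<le> ennreal c" "0 \<le> c"
  shows "integrable N \<phi>" "(\<integral>z. \<phi> z \<partial>N) \<le> c"
proof -
  show "integrable N \<phi>"
    using assms by (intro integrableI_nonneg) (auto intro: le_less_trans)
  show "(\<integral>z. \<phi> z \<partial>N) \<le> c"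
    using assms by (subst integral_eq_nn_integral) (auto intro: enn2real_leI)
qed

section \<open>Hiding two vectors in a small perturbation of a grid point\<close>

lemma borel_measurable_vec_lambda [measurable (raw)]:
  fixes f :: "'n::finite \<Rightarrow> 'a \<Rightarrow> real"
  assumes "\<And>i. f i \<in> borel_measurable N"
  shows "(\<lambda>x. \<chi> i. f i x) \<in> borel_measurable N"
  unfolding borel_measurable_euclidean_space[of "\<lambda>x. \<chi> i. f i x"]
  using assms by (auto simp: Basis_vec_def inner_axis)

lemma borel_measurable_vec_nth [measurable]:
  "(\<lambda>v::real^'n. v $ i) \<in> borel_measurable borel"
  by (intro borel_measurable_continuous_onI continuous_intros)

text \<open>
  Ternary expansions with digits 0 and 1, that is, a scaled Cantor set: digits can be recovered
  by thresholding, without the ambiguity of binary expansions.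
\<close>
definition bits_to_real :: "(nat \<Rightarrow> bool) \<Rightarrow> real" where
  "bits_to_real b = (\<Sum>k. of_bool (b k) * (1/3) ^ Suc k)"

lemma summable_bits: "summable (\<lambda>k. of_bool (b k) * (1/3::real) ^ Suc k)"
  by (rule summable_comparison_test'[of "\<lambda>k. (1/3::real) ^ Suc k" 0])
     (auto simp: summable_mult summable_geometric)

lemma bits_to_real_nonneg: "0 \<le> bits_to_real b"
  unfolding bits_to_real_def by (intro suminf_nonneg summable_bits) auto

lemma bits_to_real_le: "bits_to_real b \<le> 1/2"
proof -
  have s: "(\<lambda>k. (1/3::real) ^ Suc k) sums (1/2)"
    using sums_mult[OF geometric_sums[of "1/3::real"], of "1/3"] by simp
  have "bits_to_real b \<le> (\<Sum>k. (1/3::real) ^ Suc k)"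
    unfolding bits_to_real_def
    by (intro suminf_le summable_bits sums_summable[OF s]) auto
  also have "\<dots> = 1/2" using s by (rule sums_unique[symmetric])
  finally show ?thesis .
qed

lemma bits_to_real_step:
  "3 * bits_to_real b = of_bool (b 0) + bits_to_real (\<lambda>k. b (Suc k))"
proof -
  have "bits_to_real b = of_bool (b 0) * (1/3) ^ Suc 0 + (\<Sum>k. of_bool (b (Suc k)) * (1/3) ^ Suc (Suc k))"
    unfolding bits_to_real_def by (subst suminf_split_head[OF summable_bits]) simp
  also have "(\<Sum>k. of_bool (b (Suc k)) * (1/3::real) ^ Suc (Suc k)) =
      (\<Sum>k. 1/3 * (of_bool (b (Suc k)) * (1/3) ^ Suc k))"
    by (simp add: mult_ac)
  also have "\<dots> = 1/3 * bits_to_real (\<lambda>k. b (Suc k))"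
    unfolding bits_to_real_def by (rule suminf_mult[OF summable_bits])
  finally show ?thesis by simp
qed

lemma bits_to_real_ge_iff: "1/3 \<le> bits_to_real b \<longleftrightarrow> b 0"
  using bits_to_real_step[of b] bits_to_real_nonneg[of "\<lambda>k. b (Suc k)"]
    bits_to_real_le[of "\<lambda>k. b (Suc k)"]
  by (cases "b 0") auto

text \<open>
  The shift map on these expansions, so that thresholding its iterates reads off the digits.
\<close>
primrec ternary_tail :: "nat \<Rightarrow> real \<Rightarrow> real" where
  "ternary_tail 0 t = t"
| "ternary_tail (Suc k) t = 3 * ternary_tail k t - of_bool (1/3 \<le> ternary_tail k t)"

lemma ternary_tail_bits: "ternary_tail k (bits_to_real b) = bits_to_real (\<lambda>j. b (j + k))"
proof (induction k)
  case (Suc k)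
  then show ?case
    using bits_to_real_step[of "\<lambda>j. b (j + k)"]
    unfolding ternary_tail.simps Suc.IH bits_to_real_ge_iff by simp
qed simp

lemma ternary_tail_measurable [measurable]: "ternary_tail k \<in> borel_measurable borel"
  by (induction k) (simp_all add: of_bool_def)

lemma ereal_Sup_rationals_below:
  "(SUP k. if real_of_rat (from_nat k) < a then ereal (real_of_rat (from_nat k)) else -\<infinity>) = ereal a"
proof (rule antisym)
  show "(SUP k. if real_of_rat (from_nat k) < a then ereal (real_of_rat (from_nat k)) else -\<infinity>) \<le> ereal a"
    by (rule SUP_least) auto
  show "ereal a \<le> (SUP k. if real_of_rat (from_nat k) < a then ereal (real_of_rat (from_nat k)) else -\<infinity>)"
  proof (rule dense_le)
    fix y assume y: "y < ereal a"
    then obtain z where z: "y < ereal z" "ereal z < ereal a"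
      using ereal_dense2 by blast
    then obtain r where r: "z < real_of_rat r" "real_of_rat r < a"
      using of_rat_dense[of z a] by auto
    have "ereal (real_of_rat r) \<le> (SUP k. if real_of_rat (from_nat k) < a then ereal (real_of_rat (from_nat k)) else -\<infinity>)"
      by (rule SUP_upper2[of "to_nat r"]) (use r in auto)
    with z(1) r(1) show "y \<le> (SUP k. if real_of_rat (from_nat k) < a then ereal (real_of_rat (from_nat k)) else -\<infinity>)"
      by (meson ereal_less_eq(3) less_eq_real_def order_less_imp_le order_trans)
  qed
qed

text \<open>
  A pair of reals is encoded by the bits that tell which rationals lie below its components,
  interleaved in one Cantor expansion. Decoding is measurable since it consists of thresholds
  and a countable supremum.
\<close>
lemma real_pair_embedding:
  obtains \<phi> :: "real \<times> real \<Rightarrow> real" and \<psi> :: "real \<Rightarrow> real \<times> real"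
  where "\<phi> \<in> borel_measurable borel" "\<psi> \<in> borel_measurable borel"
    "\<And>p. 0 \<le> \<phi> p" "\<And>p. \<phi> p < 1" "\<And>p. \<psi> (\<phi> p) = p"
proof -
  define bit where "bit p k \<longleftrightarrow> real_of_rat (from_nat (k div 2)) < (if even k then fst p else snd p)"
    for p :: "real \<times> real" and k
  define \<phi> where "\<phi> p = bits_to_real (bit p)" for p
  define dig where "dig j t = real_of_ereal (SUP k. if 1/3 \<le> ternary_tail (2 * k + j) t
    then ereal (real_of_rat (from_nat k)) else -\<infinity>)" for j t
  define \<psi> where "\<psi> t = (dig 0 t, dig 1 t)" for t
  have "\<phi> \<in> borel_measurable (borel \<Otimes>\<^sub>M borel)"
    unfolding \<phi>_def bits_to_real_def bit_def of_bool_def if_distrib[of "\<lambda>x. _ < x"] by measurable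
  then have 1: "\<phi> \<in> borel_measurable borel" by (simp add: borel_prod)
  have "\<psi> \<in> borel \<rightarrow>\<^sub>M borel \<Otimes>\<^sub>M borel"
    unfolding \<psi>_def dig_def by measurable
  then have 2: "\<psi> \<in> borel_measurable borel" by (simp add: borel_prod)
  have dec: "1/3 \<le> ternary_tail k (\<phi> p) \<longleftrightarrow> bit p k" for k p
    unfolding \<phi>_def ternary_tail_bits bits_to_real_ge_iff by simp
  have bit0: "bit p (2 * k + 0) \<longleftrightarrow> real_of_rat (from_nat k) < fst p"
    and bit1: "bit p (2 * k + 1) \<longleftrightarrow> real_of_rat (from_nat k) < snd p" for p k
    by (simp_all add: bit_def)
  have "dig 0 (\<phi> p) = fst p" "dig 1 (\<phi> p) = snd p" for p
    unfolding dig_def dec bit0 bit1 ereal_Sup_rationals_below by simp_all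
  then have 3: "\<psi> (\<phi> p) = p" for p by (simp add: \<psi>_def)
  have 4: "\<phi> p < 1" for p using bits_to_real_le[of "bit p"] by (simp add: \<phi>_def)
  show thesis
    by (rule that[OF 1 2 _ 4 3]) (simp add: \<phi>_def bits_to_real_nonneg)
qed

lemma norm_vec_sq_le:
  fixes v :: "real^'n" and d :: real
  assumes "\<And>i. \<bar>v $ i\<bar> \<le> d"
  shows "(norm v)\<^sup>2 \<le> CARD('n) * d\<^sup>2"
proof -
  have "(norm v)\<^sup>2 = (\<Sum>i\<in>UNIV. (v $ i)\<^sup>2)"
    by (simp add: norm_vec_def L2_set_def sum_nonneg)
  also have "\<dots> \<le> (\<Sum>i\<in>(UNIV::'n set). d\<^sup>2)"
    using assms by (intro sum_mono) (metis abs_ge_zero power2_abs power_mono)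
  finally show ?thesis by simp
qed

lemma emeasure_lborel_cube:
  fixes a :: "real^'n"
  assumes "0 < d"
  shows "emeasure lborel (box a (\<chi> i. a $ i + d)) = ennreal (d ^ CARD('n))"
proof -
  have "emeasure lborel (box a (\<chi> i. a $ i + d)) =
      (\<Prod>b\<in>Basis. ((\<chi> i. a $ i + d) - a) \<bullet> b)"
    using assms by (intro emeasure_lborel_box) (auto simp: Basis_vec_def inner_axis)
  also have "(\<Prod>b\<in>Basis. ((\<chi> i. a $ i + d) - a) \<bullet> b) = (\<Prod>b\<in>(Basis::(real^'n) set). d)"
    by (intro prod.cong) (auto simp: Basis_vec_def inner_axis)
  finally show ?thesis by simp
qed

text \<open>
  \<open>q\<close> rounds down to a cubic grid, coordinate by coordinate, and \<open>emb\<close> takes values inside a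
  grid cell based at the origin, so that \<open>q e + emb p\<close> stays in the cell of \<open>e\<close> and reveals both
  the cell and \<open>p\<close>. The volume bound is used later to bound below the Gaussian mass of a cell.
\<close>
lemma grid_code:
  fixes D :: real
  assumes "0 < D"
  obtains q :: "real^'n \<Rightarrow> real^'n" and emb :: "(real^'n) \<times> (real^'n) \<Rightarrow> real^'n"
    and dec :: "real^'n \<Rightarrow> (real^'n) \<times> (real^'n) \<times> (real^'n)" and vol :: real
  where "q \<in> borel_measurable borel"
    and "emb \<in> borel \<Otimes>\<^sub>M borel \<rightarrow>\<^sub>M borel"
    and "dec \<in> borel \<rightarrow>\<^sub>M borel \<Otimes>\<^sub>M borel \<Otimes>\<^sub>M borel"
    and "\<And>e p. dec (q e + emb p) = (q e, p)"
    and "\<And>e p. (norm (e - (q e + emb p)))\<^sup>2 \<le> D"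
    and "\<And>e. (norm (e - q e))\<^sup>2 \<le> D"
    and "0 < vol" "\<And>e. ennreal vol \<le> emeasure lborel {z. q z = q e}"
proof -
  obtain \<phi> :: "real \<times> real \<Rightarrow> real" and \<psi> :: "real \<Rightarrow> real \<times> real"
    where \<phi>: "\<phi> \<in> borel_measurable borel" and \<psi>: "\<psi> \<in> borel_measurable borel"
    and \<phi>0: "\<And>p. 0 \<le> \<phi> p" and \<phi>1: "\<And>p. \<phi> p < 1" and inv: "\<And>p. \<psi> (\<phi> p) = p"
    by (rule real_pair_embedding) (rule that)
  have [measurable]: "\<phi> \<in> borel_measurable (borel \<Otimes>\<^sub>M borel)" "\<psi> \<in> borel \<rightarrow>\<^sub>M borel \<Otimes>\<^sub>M borel"
    using \<phi> \<psi> by (simp_all add: borel_prod)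
  \<comment> \<open>the mesh, chosen so that the diagonal of a cell has squared length \<open>D\<close>\<close>
  define d where "d = sqrt (D / CARD('n))"
  have d: "0 < d" "CARD('n) * d\<^sup>2 = D" using assms by (simp_all add: d_def)
  define q :: "real^'n \<Rightarrow> real^'n" where "q e = (\<chi> i. d * of_int \<lfloor>e $ i / d\<rfloor>)" for e
  define emb :: "(real^'n) \<times> (real^'n) \<Rightarrow> real^'n"
    where "emb p = (\<chi> i. d * \<phi> (fst p $ i, snd p $ i))" for p
  define dec :: "real^'n \<Rightarrow> (real^'n) \<times> (real^'n) \<times> (real^'n)"
    where "dec y = (q y, (\<chi> i. fst (\<psi> (y $ i / d - of_int \<lfloor>y $ i / d\<rfloor>))),
        (\<chi> i. snd (\<psi> (y $ i / d - of_int \<lfloor>y $ i / d\<rfloor>))))" for y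
  have q [measurable]: "q \<in> borel_measurable borel"
    unfolding q_def by measurable
  have emb: "emb \<in> borel \<Otimes>\<^sub>M borel \<rightarrow>\<^sub>M borel" unfolding emb_def by measurable
  have dec: "dec \<in> borel \<rightarrow>\<^sub>M borel \<Otimes>\<^sub>M borel \<Otimes>\<^sub>M borel" unfolding dec_def by measurable
  have scaled: "(q e + emb p) $ i / d = of_int \<lfloor>e $ i / d\<rfloor> + \<phi> (fst p $ i, snd p $ i)" for e p i
    using d(1) by (simp add: q_def emb_def field_simps)
  have fl: "\<lfloor>(q e + emb p) $ i / d\<rfloor> = \<lfloor>e $ i / d\<rfloor>" for e p i
    unfolding scaled using \<phi>0 \<phi>1 by (auto intro!: floor_unique)
  have qq: "q (q e + emb p) = q e" for e p
  proof -
    have "q (q e + emb p) = (\<chi> i. d * of_int \<lfloor>(q e + emb p) $ i / d\<rfloor>)" by (rule q_def)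
    then show ?thesis unfolding fl q_def[of e, symmetric] .
  qed
  have inverse: "dec (q e + emb p) = (q e, p)" for e p
  proof -
    have "(q e + emb p) $ i / d - of_int \<lfloor>(q e + emb p) $ i / d\<rfloor> = \<phi> (fst p $ i, snd p $ i)" for i
      unfolding fl unfolding scaled by simp
    then show ?thesis unfolding dec_def qq by (simp add: inv)
  qed
  have frac: "0 \<le> e $ i / d - of_int \<lfloor>e $ i / d\<rfloor>" "e $ i / d - of_int \<lfloor>e $ i / d\<rfloor> < 1" for e :: "real^'n" and i
    by linarith+
  have comp: "(e - (q e + emb p)) $ i = d * ((e $ i / d - of_int \<lfloor>e $ i / d\<rfloor>) - \<phi> (fst p $ i, snd p $ i))" for e p i
    using d(1) by (simp add: q_def emb_def field_simps)
  have comp': "(e - q e) $ i = d * (e $ i / d - of_int \<lfloor>e $ i / d\<rfloor>)" for e i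
    using d(1) by (simp add: q_def field_simps)
  have dist1: "(norm (e - (q e + emb p)))\<^sup>2 \<le> D" for e p
  proof -
    have "\<bar>(e - (q e + emb p)) $ i\<bar> \<le> d" for i
    proof -
      have "\<bar>(e $ i / d - of_int \<lfloor>e $ i / d\<rfloor>) - \<phi> (fst p $ i, snd p $ i)\<bar> \<le> 1"
        using frac[of e i] \<phi>0[of "(fst p $ i, snd p $ i)"] \<phi>1[of "(fst p $ i, snd p $ i)"] by linarith
      then show ?thesis unfolding comp abs_mult using d(1) by (simp add: mult_left_le)
    qed
    from norm_vec_sq_le[OF this] show ?thesis by (simp add: d)
  qed
  have dist2: "(norm (e - q e))\<^sup>2 \<le> D" for e
  proof -
    have "\<bar>(e - q e) $ i\<bar> \<le> d" for i
    proof -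
      have "\<bar>e $ i / d - of_int \<lfloor>e $ i / d\<rfloor>\<bar> \<le> 1" using frac[of e i] by linarith
      then show ?thesis unfolding comp' abs_mult using d(1) by (simp add: mult_left_le)
    qed
    from norm_vec_sq_le[OF this] show ?thesis by (simp add: d)
  qed
  have vol: "ennreal (d ^ CARD('n)) \<le> emeasure lborel {z. q z = q e}" for e
  proof -
    have "z \<in> {z. q z = q e}" if "z \<in> box (q e) (\<chi> i. q e $ i + d)" for z
    proof -
      have "\<lfloor>z $ i / d\<rfloor> = \<lfloor>e $ i / d\<rfloor>" for i
      proof (rule floor_unique)
        have "q e $ i < z $ i" "z $ i < q e $ i + d"
          using that by (auto simp: box_def Basis_vec_def inner_axis)
        then show "of_int \<lfloor>e $ i / d\<rfloor> \<le> z $ i / d" "z $ i / d < of_int \<lfloor>e $ i / d\<rfloor> + 1"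
          using d(1) by (auto simp: q_def field_simps)
      qed
      then show ?thesis by (simp add: q_def)
    qed
    then have sub: "box (q e) (\<chi> i. q e $ i + d) \<subseteq> {z. q z = q e}" by blast
    have "{z. q z = q e} \<in> sets borel" by measurable
    then show ?thesis
      using emeasure_mono[OF sub, of lborel] emeasure_lborel_cube[OF d(1), of "q e"] by simp
  qed
  show thesis
    by (rule that[OF q emb dec inverse dist1 dist2 _ vol]) (use d in simp)
qed

section \<open>Gaussian densities\<close>

lemma positive_definite_invertible:
  fixes S :: "real^'n^'n"
  assumes "positive_definite S"
  shows "invertible S"
proof -
  have "v = 0" if "S *v v = 0" for v
    using assms that unfolding positive_definite_def by (metis inner_zero_right less_irrefl)
  then show ?thesis
    by (simp add: invertible_left_inverse matrix_left_invertible_ker)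
qed

lemma matrix_mult_matrix_inv:
  fixes S :: "real^'n^'n"
  assumes "invertible S"
  shows "S ** matrix_inv S = mat 1"
  using someI_ex[OF assms[unfolded invertible_def]] unfolding matrix_inv_def by blast

lemma positive_definite_inverse_pos:
  fixes S :: "real^'n^'n"
  assumes S: "positive_definite S" and "v \<noteq> 0"
  shows "0 < v \<bullet> (matrix_inv S *v v)"
proof -
  define u where "u = matrix_inv S *v v"
  have v: "v = S *v u"
    unfolding u_def by (simp add: matrix_vector_mul_assoc matrix_mult_matrix_inv positive_definite_invertible[OF S])
  then have "u \<noteq> 0" using assms(2) by auto
  then have "0 < u \<bullet> (S *v u)" using S by (simp add: positive_definite_def)
  then show ?thesis unfolding v[symmetric] by (simp add: u_def inner_commute)
qed

lemma quadratic_form_coercive: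
  fixes P :: "real^'n^'n"
  assumes pos: "\<And>v. v \<noteq> 0 \<Longrightarrow> 0 < v \<bullet> (P *v v)"
  obtains l where "0 < l" "\<And>v. l * (norm v)\<^sup>2 \<le> v \<bullet> (P *v v)"
proof -
  have "continuous_on (sphere 0 1) (\<lambda>v. v \<bullet> (P *v v))"
    by (intro continuous_on_inner continuous_on_id matrix_vector_mult_linear_continuous_on)
  moreover have "sphere (0::real^'n) 1 \<noteq> {}" by simp
  ultimately obtain v\<^sub>0 where v0: "v\<^sub>0 \<in> sphere 0 1"
      "\<And>v. v \<in> sphere 0 1 \<Longrightarrow> v\<^sub>0 \<bullet> (P *v v\<^sub>0) \<le> v \<bullet> (P *v v)"
    using continuous_attains_inf[OF compact_sphere] by blast
  show thesis
  proof (rule that)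
    show "0 < v\<^sub>0 \<bullet> (P *v v\<^sub>0)" using v0(1) by (intro pos) auto
    fix v :: "real^'n"
    show "v\<^sub>0 \<bullet> (P *v v\<^sub>0) * (norm v)\<^sup>2 \<le> v \<bullet> (P *v v)"
    proof (cases "v = 0")
      case False
      define e where "e = (1 / norm v) *\<^sub>R v"
      have e: "e \<in> sphere 0 1" "v = norm v *\<^sub>R e" using False by (simp_all add: e_def)
      have "v \<bullet> (P *v v) = (norm v)\<^sup>2 * (e \<bullet> (P *v e))"
        by (subst e(2), subst (2) e(2)) (simp add: matrix_vector_mult_scaleR power2_eq_square)
      then show ?thesis
        using mult_right_mono[OF v0(2)[OF e(1)], of "(norm v)\<^sup>2"] by (simp add: mult.commute)
    qed simp
  qed
qed

lemma bilinear_form_bounded: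
  fixes P :: "real^'n^'n"
  obtains B where "0 \<le> B" "\<And>v w. \<bar>v \<bullet> (P *v w)\<bar> \<le> B * norm v * norm w"
proof -
  obtain B where B: "0 < B" "\<And>w. norm (P *v w) \<le> norm w * B"
    using bounded_linear.pos_bounded[OF matrix_vector_mul_bounded_linear[of P]] by auto
  show thesis
  proof (rule that[of B])
    fix v w
    have "\<bar>v \<bullet> (P *v w)\<bar> \<le> norm v * norm (P *v w)" by (rule Cauchy_Schwarz_ineq2)
    also have "\<dots> \<le> norm v * (norm w * B)" by (intro mult_left_mono B) simp
    finally show "\<bar>v \<bullet> (P *v w)\<bar> \<le> B * norm v * norm w" by (simp add: mult_ac)
  qed (use B in simp)
qed

lemma gaussian_density_measurable [measurable]: "gaussian_density S \<in> borel_measurable borel"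
  unfolding gaussian_density_def
  by (intro borel_measurable_divide borel_measurable_const borel_measurable_continuous_onI
      continuous_on_exp continuous_on_minus continuous_on_inner continuous_on_id
      matrix_vector_mult_linear_continuous_on continuous_on_divide continuous_on_const) simp

lemma nn_integral_lborel_scale:
  fixes h :: "'a::euclidean_space \<Rightarrow> ennreal"
  assumes [measurable]: "h \<in> borel_measurable borel" and "c \<noteq> 0"
  shows "(\<integral>\<^sup>+v. h v \<partial>lborel) = (\<integral>\<^sup>+v. ennreal (\<bar>c\<bar> ^ DIM('a)) * h (c *\<^sub>R v) \<partial>lborel)"
proof -
  have "(\<integral>\<^sup>+v. h v \<partial>lborel) =
      (\<integral>\<^sup>+v. h v \<partial>density (distr lborel borel (\<lambda>x. 0 + c *\<^sub>R x)) (\<lambda>_. ennreal (\<bar>c\<bar> ^ DIM('a))))"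
    by (subst lborel_affine[OF assms(2), of 0]) rule
  also have "\<dots> = (\<integral>\<^sup>+v. ennreal (\<bar>c\<bar> ^ DIM('a)) * h (0 + c *\<^sub>R v) \<partial>lborel)"
    by (subst nn_integral_density) (simp_all add: nn_integral_distr)
  finally show ?thesis by simp
qed

text \<open>
  The normalising constant \<open>k\<close> must be positive because the density integrates to 1. This
  replaces an argument that the determinant is positive: a negative determinant would make the
  density negative. The second moment is finite since \<open>(norm v)\<^sup>2\<close> times the density is dominated by
  a Gaussian whose covariance is twice as large.
\<close>
lemma gaussian_density_facts:
  fixes S :: "real^'n^'n"
  assumes S: "positive_definite S"
    and prob: "prob_space (density lborel (\<lambda>v. ennreal (gaussian_density S v)))"
  obtains C where "\<And>v. 0 < gaussian_density S v"
    and "\<And>v. \<bar>ln (gaussian_density S v)\<bar> \<le> C * (1 + (norm v)\<^sup>2)"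
    and "integrable (density lborel (\<lambda>v. ennreal (gaussian_density S v))) (\<lambda>v. (norm v)\<^sup>2)"
proof -
  interpret prob_space "density lborel (\<lambda>v. ennreal (gaussian_density S v))" by (rule prob)
  define P where "P = matrix_inv S"
  define k where "k = 1 / sqrt ((2 * pi) ^ CARD('n) * det S)"
  have g: "gaussian_density S v = k * exp (- (v \<bullet> (P *v v)) / 2)" for v
    by (simp add: gaussian_density_def P_def k_def)
  have total: "(\<integral>\<^sup>+v. ennreal (gaussian_density S v) \<partial>lborel) = 1"
    using emeasure_space_1 by (simp add: emeasure_density)
  have k: "0 < k"
  proof (rule ccontr)
    assume "\<not> 0 < k"
    then have "gaussian_density S v \<le> 0" for v by (simp add: g mult_nonpos_nonneg)
    then have "(\<integral>\<^sup>+v. ennreal (gaussian_density S v) \<partial>lborel) = 0"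
      by (simp add: ennreal_neg)
    with total show False by simp
  qed
  obtain l where l: "0 < l" "\<And>v. l * (norm v)\<^sup>2 \<le> v \<bullet> (P *v v)"
    using quadratic_form_coercive[OF positive_definite_inverse_pos[OF S]] unfolding P_def by metis
  obtain B where B: "0 \<le> B" "\<And>v w. \<bar>v \<bullet> (P *v w)\<bar> \<le> B * norm v * norm w"
    using bilinear_form_bounded by metis
  have Pm [measurable]: "(\<lambda>v. exp (- (v \<bullet> (P *v v)) / 4)) \<in> borel_measurable borel"
    by (intro borel_measurable_continuous_onI continuous_on_exp continuous_on_minus
      continuous_on_inner continuous_on_id matrix_vector_mult_linear_continuous_on
      continuous_on_divide continuous_on_const) simp
  define c :: real where "c = sqrt 2"
  have c: "c \<noteq> 0" "c * c = 2" by (simp_all add: c_def)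
  have "(\<integral>\<^sup>+v. ennreal (exp (- (v \<bullet> (P *v v)) / 4)) \<partial>lborel)
      = (\<integral>\<^sup>+v. ennreal (\<bar>c\<bar> ^ DIM(real^'n)) * ennreal (exp (- ((c *\<^sub>R v) \<bullet> (P *v (c *\<^sub>R v))) / 4)) \<partial>lborel)"
    by (rule nn_integral_lborel_scale[OF _ c(1)]) (use Pm in simp)
  also have "\<dots> = (\<integral>\<^sup>+v. ennreal (\<bar>c\<bar> ^ DIM(real^'n) / k) * ennreal (gaussian_density S v) \<partial>lborel)"
  proof (rule nn_integral_cong)
    fix v :: "real^'n"
    have "(c *\<^sub>R v) \<bullet> (P *v (c *\<^sub>R v)) / 4 = (c * c) * (v \<bullet> (P *v v)) / 4"
      by (simp add: matrix_vector_mult_scaleR mult.assoc)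
    then have e: "- ((c *\<^sub>R v) \<bullet> (P *v (c *\<^sub>R v))) / 4 = - (v \<bullet> (P *v v)) / 2"
      by (simp add: c(2))
    show "ennreal (\<bar>c\<bar> ^ DIM(real^'n)) * ennreal (exp (- ((c *\<^sub>R v) \<bullet> (P *v (c *\<^sub>R v))) / 4))
       = ennreal (\<bar>c\<bar> ^ DIM(real^'n) / k) * ennreal (gaussian_density S v)"
      unfolding e g using k by (simp flip: ennreal_mult)
  qed
  also have "\<dots> = ennreal (\<bar>c\<bar> ^ DIM(real^'n) / k)"
    by (subst nn_integral_cmult) (auto simp: total)
  finally have wide: "(\<integral>\<^sup>+v. ennreal (exp (- (v \<bullet> (P *v v)) / 4)) \<partial>lborel)
      = ennreal (\<bar>c\<bar> ^ DIM(real^'n) / k)" .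
  have bound: "gaussian_density S v * (norm v)\<^sup>2 \<le> (4 * k / l) * exp (- (v \<bullet> (P *v v)) / 4)" for v
  proof -
    have "l * (norm v)\<^sup>2 / 4 \<le> v \<bullet> (P *v v) / 4" using l(2)[of v] by simp
    also have "\<dots> \<le> exp (v \<bullet> (P *v v) / 4)" using exp_ge_add_one_self[of "v \<bullet> (P *v v) / 4"] by linarith
    finally have n: "(norm v)\<^sup>2 \<le> 4 / l * exp (v \<bullet> (P *v v) / 4)" using l(1) by (simp add: field_simps)
    have "gaussian_density S v * (norm v)\<^sup>2 \<le> gaussian_density S v * (4 / l * exp (v \<bullet> (P *v v) / 4))"
      by (rule mult_left_mono[OF n]) (use k in \<open>simp add: g\<close>)
    also have "\<dots> = (4 * k / l) * (exp (- (v \<bullet> (P *v v)) / 2) * exp (v \<bullet> (P *v v) / 4))"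
      by (simp add: g)
    also have "exp (- (v \<bullet> (P *v v)) / 2) * exp (v \<bullet> (P *v v) / 4) = exp (- (v \<bullet> (P *v v)) / 4)"
      by (subst exp_add[symmetric]) simp
    finally show ?thesis .
  qed
  have "(\<integral>\<^sup>+v. ennreal ((norm v)\<^sup>2) \<partial>density lborel (\<lambda>v. ennreal (gaussian_density S v)))
      = (\<integral>\<^sup>+v. ennreal (gaussian_density S v * (norm v)\<^sup>2) \<partial>lborel)"
    by (subst nn_integral_density) (auto simp: ennreal_mult'' )
  also have "\<dots> \<le> (\<integral>\<^sup>+v. ennreal (4 * k / l) * ennreal (exp (- (v \<bullet> (P *v v)) / 4)) \<partial>lborel)"
  proof (rule nn_integral_mono)
    fix v :: "real^'n"
    show "ennreal (gaussian_density S v * (norm v)\<^sup>2) \<le> ennreal (4 * k / l) * ennreal (exp (- (v \<bullet> (P *v v)) / 4))"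
      using ennreal_leI[OF bound[of v]] k l(1) by (subst ennreal_mult[symmetric]) auto
  qed
  also have "\<dots> = ennreal (4 * k / l) * ennreal (\<bar>c\<bar> ^ DIM(real^'n) / k)"
    unfolding wide[symmetric]
    by (rule nn_integral_cmult) (use measurable_compose[OF Pm measurable_ennreal] in simp)
  also have "\<dots> < \<infinity>" by (simp add: ennreal_mult_less_top)
  finally have int: "integrable (density lborel (\<lambda>v. ennreal (gaussian_density S v))) (\<lambda>v. (norm v)\<^sup>2)"
    by (intro integrableI_nonneg) auto
  have pos: "0 < gaussian_density S v" for v using k by (simp add: g)
  have lng: "\<bar>ln (gaussian_density S v)\<bar> \<le> (\<bar>ln k\<bar> + B) * (1 + (norm v)\<^sup>2)" for v
  proof -
    have "ln (gaussian_density S v) = ln k - (v \<bullet> (P *v v)) / 2"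
      using k by (simp add: g ln_mult)
    moreover have "\<bar>v \<bullet> (P *v v)\<bar> \<le> B * (norm v)\<^sup>2"
      using B(2)[of v v] by (simp add: power2_eq_square mult.assoc)
    moreover have "(\<bar>ln k\<bar> + B) * (1 + (norm v)\<^sup>2) = \<bar>ln k\<bar> + \<bar>ln k\<bar> * (norm v)\<^sup>2 + B + B * (norm v)\<^sup>2"
      by (simp add: algebra_simps)
    moreover have "0 \<le> \<bar>ln k\<bar> * (norm v)\<^sup>2" "0 \<le> B * (norm v)\<^sup>2" using B(1) by auto
    ultimately show ?thesis using B(1) unfolding abs_le_iff by linarith
  qed
  show thesis by (rule that[OF pos lng int])
qed

section \<open>The joint law as a recursion in time\<close>

text \<open>
  Index sets are kept in the form in which they occur in the definitions of the joint law, so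
  that statements for a general time specialise to time 0. Kernel products are not unfolded by
  the simplifier because the integral formula below is the form in which they are used.
\<close>
declare atMost_0 [simp del] causal_product.simps(2) [simp del]

lemma stochastic_kernel_measurable:
  assumes "stochastic_kernel K t"
    and [measurable]: "f \<in> N \<rightarrow>\<^sub>M paths {..t}" "g \<in> N \<rightarrow>\<^sub>M paths {..<t}"
  shows "(\<lambda>z. K t (f z) (g z)) \<in> N \<rightarrow>\<^sub>M prob_algebra borel"
proof -
  have "(\<lambda>z. (f z, g z)) \<in> N \<rightarrow>\<^sub>M paths {..t} \<Otimes>\<^sub>M paths {..<t}" by measurable
  from measurable_compose[OF this assms(1)[unfolded stochastic_kernel_def]] show ?thesis by simp
qed

lemma measurable_path_update [measurable (raw)]:
  assumes "f \<in> N \<rightarrow>\<^sub>M paths {..<t}" "g \<in> N \<rightarrow>\<^sub>M borel"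
  shows "(\<lambda>z. (f z)(t := g z)) \<in> N \<rightarrow>\<^sub>M paths {..<Suc t}"
  by (rule measurable_fun_upd[of _ "{..<t}"]) (use assms in auto)

lemma measurable_path_update' [measurable (raw)]:
  assumes "f \<in> N \<rightarrow>\<^sub>M paths {..t}" "g \<in> N \<rightarrow>\<^sub>M borel"
  shows "(\<lambda>z. (f z)(Suc t := g z)) \<in> N \<rightarrow>\<^sub>M paths {..Suc t}"
  by (rule measurable_fun_upd[of _ "{..t}"]) (use assms in auto)

lemma measurable_path_restrict [measurable (raw)]:
  assumes "f \<in> N \<rightarrow>\<^sub>M paths I" "J \<subseteq> I"
  shows "(\<lambda>z. restrict (f z) J) \<in> N \<rightarrow>\<^sub>M paths J"
  using measurable_compose[OF assms(1) measurable_restrict_subset[OF assms(2)]] .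

lemma causal_product_step_measurable:
  assumes K: "stochastic_kernel K t" and I: "{..t} \<subseteq> I"
  shows "(\<lambda>(x, y). distr (K t (restrict x {..t}) y) (paths {..<Suc t}) (\<lambda>v. y(t := v)))
    \<in> paths I \<Otimes>\<^sub>M paths {..<t} \<rightarrow>\<^sub>M prob_algebra (paths {..<Suc t})"
proof -
  have "(\<lambda>z. K t (restrict (fst z) {..t}) (snd z)) \<in> paths I \<Otimes>\<^sub>M paths {..<t} \<rightarrow>\<^sub>M prob_algebra borel"
    by (rule stochastic_kernel_measurable[OF K]) (use I in measurable)
  then have "(\<lambda>z. distr (K t (restrict (fst z) {..t}) (snd z)) (paths {..<Suc t}) (\<lambda>v. (snd z)(t := v)))
    \<in> paths I \<Otimes>\<^sub>M paths {..<t} \<rightarrow>\<^sub>M prob_algebra (paths {..<Suc t})"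
    by (rule measurable_distr_prob_space2) measurable
  then show ?thesis by (simp add: case_prod_beta')
qed

lemma causal_product_measurable:
  assumes "\<And>s. s < t \<Longrightarrow> stochastic_kernel K s" "{..<t} \<subseteq> I"
  shows "causal_product K t \<in> paths I \<rightarrow>\<^sub>M prob_algebra (paths {..<t})"
  using assms
proof (induction t)
  case 0
  have "return (paths {..<0}) (\<lambda>_. undefined) \<in> space (prob_algebra (paths {..<0}))"
    by (auto simp: space_prob_algebra space_PiM lessThan_0 intro!: prob_space_return)
  then have "(\<lambda>_. return (paths {..<0}) (\<lambda>_. undefined)) \<in> paths I \<rightarrow>\<^sub>M prob_algebra (paths {..<0})"
    by (rule measurable_const)
  then show ?case by simp
next
  case (Suc t)
  have "causal_product K t \<in> paths I \<rightarrow>\<^sub>M prob_algebra (paths {..<t})"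
    by (rule Suc.IH) (use Suc.prems in auto)
  then show ?case
    unfolding causal_product.simps
    by (rule measurable_bind_prob_space2)
       (rule causal_product_step_measurable, use Suc.prems in auto)
qed

lemma causal_product_cong:
  assumes "\<And>s. s < t \<Longrightarrow> K s = K' s" "\<And>s. s < t \<Longrightarrow> x s = x' s"
  shows "causal_product K t x = causal_product K' t x'"
  using assms
proof (induction t)
  case (Suc t)
  have "restrict x {..t} = restrict x' {..t}" using Suc.prems(2) by (auto simp: restrict_def fun_eq_iff)
  with Suc show ?case by (simp add: causal_product.simps(2))
qed simp

lemma nn_integral_causal_product_Suc:
  assumes K: "\<And>s. s \<le> t \<Longrightarrow> stochastic_kernel K s" and I: "{..t} \<subseteq> I" and x: "x \<in> space (paths I)"
    and h [measurable]: "h \<in> borel_measurable (paths {..<Suc t})"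
  shows "(\<integral>\<^sup>+y. h y \<partial>causal_product K (Suc t) x) =
    (\<integral>\<^sup>+y. \<integral>\<^sup>+v. h (y(t := v)) \<partial>K t (restrict x {..t}) y \<partial>causal_product K t x)"
proof -
  have cp: "causal_product K t \<in> paths I \<rightarrow>\<^sub>M prob_algebra (paths {..<t})"
    by (rule causal_product_measurable) (use K I in auto)
  from measurable_space[OF this x]
  have [measurable_cong]: "sets (causal_product K t x) = sets (paths {..<t})"
    by (simp add: space_prob_algebra)
  have sp: "space (causal_product K t x) = space (paths {..<t})"
    by (rule sets_eq_imp_space_eq) fact
  have Kt: "K t (restrict x {..t}) y \<in> space (prob_algebra borel)" if "y \<in> space (paths {..<t})" for y
  proof -
    have "restrict x {..t} \<in> space (paths {..t})" using x I by (auto simp: space_PiM)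
    with that K[of t] show ?thesis
      unfolding stochastic_kernel_def
      by (auto simp: space_pair_measure dest!: measurable_space[of _ _ _ "(restrict x {..t}, y)"])
  qed
  have "Pair x \<in> paths {..<t} \<rightarrow>\<^sub>M paths I \<Otimes>\<^sub>M paths {..<t}" using x by simp
  from measurable_compose[OF this causal_product_step_measurable[OF K[OF order_refl] I]]
  have "(\<lambda>y. distr (K t (restrict x {..t}) y) (paths {..<Suc t}) (\<lambda>v. y(t := v)))
    \<in> paths {..<t} \<rightarrow>\<^sub>M prob_algebra (paths {..<Suc t})" by simp
  then have kern: "(\<lambda>y. distr (K t (restrict x {..t}) y) (paths {..<Suc t}) (\<lambda>v. y(t := v)))
    \<in> causal_product K t x \<rightarrow>\<^sub>M subprob_algebra (paths {..<Suc t})"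
    by (simp add: measurable_prob_algebraD cong: measurable_cong_sets)
  show ?thesis
    unfolding causal_product.simps
    apply (subst nn_integral_bind[OF h kern])
    apply (rule nn_integral_cong)
    apply (subst nn_integral_distr)
    using Kt by (auto simp: sp space_prob_algebra cong: measurable_cong_sets)
qed

text \<open>
  The construction of the kernels rests on the path laws alone, which are generated by one
  initial law and one noise law through the linear recursion.
\<close>
locale linear_source =
  fixes M :: "'a measure" and x :: "nat \<Rightarrow> 'a \<Rightarrow> real^'n::finite" and A :: "real^'n^'n"
    and \<mu>\<^sub>0 \<mu>\<^sub>w :: "(real^'n) measure"
  assumes prob_init: "prob_space \<mu>\<^sub>0" and sets_init [measurable_cong]: "sets \<mu>\<^sub>0 = sets borel"
    and prob_noise: "prob_space \<mu>\<^sub>w" and sets_noise [measurable_cong]: "sets \<mu>\<^sub>w = sets borel"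
    and source_law_0: "source_law M x 0 = distr \<mu>\<^sub>0 (paths {..0}) (\<lambda>\<xi>. \<lambda>_\<in>{..0}. \<xi>)"
    and source_law_Suc: "source_law M x (Suc n) =
      distr (source_law M x n \<Otimes>\<^sub>M \<mu>\<^sub>w) (paths {..Suc n}) (\<lambda>(u, w). u(Suc n := A *v u n + w))"
begin

abbreviation "S \<equiv> source_law M x"
abbreviation "J \<equiv> joint_law M x"

sublocale init: prob_space \<mu>\<^sub>0 by (rule prob_init)
sublocale noise: prob_space \<mu>\<^sub>w by (rule prob_noise)

lemma sets_source [measurable_cong, simp]: "sets (S n) = sets (paths {..n})"
  by (simp add: source_law_def)

lemma space_source [simp]: "space (S n) = space (paths {..n})"
  by (simp add: source_law_def)

lemma component_measurable:
  "f \<in> N \<rightarrow>\<^sub>M paths I \<Longrightarrow> t \<in> I \<Longrightarrow> (\<lambda>z. f z t) \<in> borel_measurable N"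
  using measurable_compose[OF _ measurable_component_singleton[of t I "\<lambda>_. borel"]] by auto

lemma fst_component_measurable:
  "t \<in> I \<Longrightarrow> (\<lambda>z. fst z t) \<in> borel_measurable (paths I \<Otimes>\<^sub>M N)"
  by (rule component_measurable[OF measurable_fst])

lemma snd_component_measurable:
  "t \<in> I \<Longrightarrow> (\<lambda>z. snd z t) \<in> borel_measurable (N \<Otimes>\<^sub>M paths I)"
  by (rule component_measurable[OF measurable_snd])

lemma mat_vec_measurable [measurable (raw)]:
  "f \<in> borel_measurable N \<Longrightarrow> (\<lambda>z. A *v f z) \<in> borel_measurable N"
  by (rule borel_measurable_continuous_on[OF matrix_vector_mult_linear_continuous_on])

lemma source_step_measurable [measurable (raw)]:
  assumes [measurable]: "f \<in> N \<rightarrow>\<^sub>M paths {..n}" "g \<in> N \<rightarrow>\<^sub>M borel"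
  shows "(\<lambda>z. (f z)(Suc n := A *v f z n + g z)) \<in> N \<rightarrow>\<^sub>M paths {..Suc n}"
proof -
  have [measurable]: "(\<lambda>z. f z n) \<in> borel_measurable N"
    by (rule component_measurable[where I = "{..n}"]) auto
  show ?thesis by measurable
qed

lemma prob_source: "prob_space (S n)"
proof (induction n)
  case 0
  show ?case unfolding source_law_0 by (rule init.prob_space_distr) measurable
next
  case (Suc n)
  interpret pair_prob_space "S n" \<mu>\<^sub>w by (intro pair_prob_space.intro pair_sigma_finite.intro)
     (simp_all add: Suc prob_noise prob_space_imp_sigma_finite)
  show ?case unfolding source_law_Suc by (rule prob_space_distr) measurable
qed

lemma nn_integral_source_0:
  "h \<in> borel_measurable (paths {..0}) \<Longrightarrow> (\<integral>\<^sup>+u. h u \<partial>S 0) = (\<integral>\<^sup>+\<xi>. h (\<lambda>_\<in>{..0}. \<xi>) \<partial>\<mu>\<^sub>0)"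
  unfolding source_law_0 by (subst nn_integral_distr) auto

lemma nn_integral_source_Suc:
  assumes [measurable]: "h \<in> borel_measurable (paths {..Suc n})"
  shows "(\<integral>\<^sup>+u. h u \<partial>S (Suc n)) = (\<integral>\<^sup>+u. \<integral>\<^sup>+w. h (u(Suc n := A *v u n + w)) \<partial>\<mu>\<^sub>w \<partial>S n)"
  unfolding source_law_Suc
  by (subst nn_integral_distr) (auto simp: noise.nn_integral_fst[symmetric] case_prod_beta')

lemma joint_kernel_measurable:
  assumes "\<And>t. t \<le> n \<Longrightarrow> stochastic_kernel K t"
  shows "(\<lambda>u. distr (causal_product K (Suc n) u) (paths {..n} \<Otimes>\<^sub>M paths {..n}) (\<lambda>y. (u, y)))
    \<in> paths {..n} \<rightarrow>\<^sub>M prob_algebra (paths {..n} \<Otimes>\<^sub>M paths {..n})"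
proof -
  have "causal_product K (Suc n) \<in> paths {..n} \<rightarrow>\<^sub>M prob_algebra (paths {..<Suc n})"
    by (rule causal_product_measurable) (use assms in auto)
  then have "causal_product K (Suc n) \<in> paths {..n} \<rightarrow>\<^sub>M prob_algebra (paths {..n})"
    by (simp add: lessThan_Suc_atMost)
  then show ?thesis by (rule measurable_distr_prob_space2) measurable
qed

lemma source_in_prob_algebra: "S n \<in> space (prob_algebra (paths {..n}))"
  by (simp add: space_prob_algebra prob_source)

lemma prob_joint:
  "(\<And>t. t \<le> n \<Longrightarrow> stochastic_kernel K t) \<Longrightarrow> prob_space (J K n)"
  unfolding joint_law_def
  by (rule prob_space_bind'[OF source_in_prob_algebra joint_kernel_measurable])

lemma sets_joint:
  "(\<And>t. t \<le> n \<Longrightarrow> stochastic_kernel K t) \<Longrightarrow> sets (J K n) = sets (paths {..n} \<Otimes>\<^sub>M paths {..n})"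
  unfolding joint_law_def
  by (rule sets_bind'[OF source_in_prob_algebra joint_kernel_measurable])

lemma nn_integral_joint:
  assumes K: "\<And>t. t \<le> n \<Longrightarrow> stochastic_kernel K t"
    and h [measurable]: "h \<in> borel_measurable (paths {..n} \<Otimes>\<^sub>M paths {..n})"
  shows "(\<integral>\<^sup>+z. h z \<partial>J K n) = (\<integral>\<^sup>+u. \<integral>\<^sup>+y. h (u, y) \<partial>causal_product K (Suc n) u \<partial>S n)"
proof -
  have cp: "causal_product K (Suc n) \<in> paths {..n} \<rightarrow>\<^sub>M prob_algebra (paths {..n})"
    using causal_product_measurable[of "Suc n" K "{..n}"] K by (simp add: lessThan_Suc_atMost)
  have kern: "(\<lambda>u. distr (causal_product K (Suc n) u) (paths {..n} \<Otimes>\<^sub>M paths {..n}) (\<lambda>y. (u, y)))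
    \<in> S n \<rightarrow>\<^sub>M subprob_algebra (paths {..n} \<Otimes>\<^sub>M paths {..n})"
    using measurable_prob_algebraD[OF joint_kernel_measurable[OF K]]
    by (simp cong: measurable_cong_sets)
  show ?thesis
    unfolding joint_law_def
  proof (subst nn_integral_bind[OF h kern], rule nn_integral_cong)
    fix u assume "u \<in> space (S n)"
    then have u: "u \<in> space (paths {..n})" by simp
    have [measurable_cong]: "sets (causal_product K (Suc n) u) = sets (paths {..n})"
      using measurable_space[OF cp u] by (simp add: space_prob_algebra)
    show "(\<integral>\<^sup>+z. h z \<partial>distr (causal_product K (Suc n) u) (paths {..n} \<Otimes>\<^sub>M paths {..n}) (\<lambda>y. (u, y)))
      = (\<integral>\<^sup>+y. h (u, y) \<partial>causal_product K (Suc n) u)"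
      using u by (subst nn_integral_distr) auto
  qed
qed

lemma joint_cong:
  assumes "\<And>t. t \<le> n \<Longrightarrow> K t = K' t"
  shows "J K n = J K' n"
proof -
  have "causal_product K (Suc n) = causal_product K' (Suc n)"
    by (intro ext causal_product_cong) (use assms in auto)
  then show ?thesis by (simp only: joint_law_def)
qed

lemma joint_step_measurable:
  assumes K: "stochastic_kernel K (Suc n)"
    and h [measurable]: "h \<in> borel_measurable (paths {..Suc n} \<Otimes>\<^sub>M paths {..Suc n})"
    and [measurable]: "f \<in> N \<rightarrow>\<^sub>M paths {..Suc n}" "g \<in> N \<rightarrow>\<^sub>M paths {..n}"
  shows "(\<lambda>z. \<integral>\<^sup>+v. h (f z, (g z)(Suc n := v)) \<partial>K (Suc n) (f z) (g z)) \<in> borel_measurable N"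
proof (rule nn_integral_measurable_subprob_algebra2[of _ _ borel])
  show "(\<lambda>z. K (Suc n) (f z) (g z)) \<in> N \<rightarrow>\<^sub>M subprob_algebra borel"
    by (intro measurable_prob_algebraD stochastic_kernel_measurable[OF K])
       (auto simp: lessThan_Suc_atMost)
qed measurable

text \<open>
  Since \<open>joint_law\<close> first draws the whole source path and then the outputs, advancing time by one
  requires moving the new source noise past the earlier outputs. This is possible because the
  kernels up to time \<open>n\<close> do not look at the source after \<open>n\<close>. The inductions on time below
  all proceed by this formula.
\<close>
lemma nn_integral_joint_Suc:
  assumes K: "\<And>t. t \<le> Suc n \<Longrightarrow> stochastic_kernel K t"
    and h [measurable]: "h \<in> borel_measurable (paths {..Suc n} \<Otimes>\<^sub>M paths {..Suc n})"
  shows "(\<integral>\<^sup>+z. h z \<partial>J K (Suc n)) =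
    (\<integral>\<^sup>+z. \<integral>\<^sup>+w. \<integral>\<^sup>+v. h ((fst z)(Suc n := A *v fst z n + w), (snd z)(Suc n := v))
       \<partial>K (Suc n) ((fst z)(Suc n := A *v fst z n + w)) (snd z) \<partial>\<mu>\<^sub>w \<partial>J K n)"
proof -
  define G where "G u' y = (\<integral>\<^sup>+v. h (u', y(Suc n := v)) \<partial>K (Suc n) u' y)" for u' y
  have G [measurable (raw)]: "(\<lambda>z. G (f z) (g z)) \<in> borel_measurable N"
    if "f \<in> N \<rightarrow>\<^sub>M paths {..Suc n}" "g \<in> N \<rightarrow>\<^sub>M paths {..n}" for f g and N :: "'c measure"
    unfolding G_def by (rule joint_step_measurable[OF K h that]) simp
  have cp: "causal_product K (Suc n) \<in> paths {..n} \<rightarrow>\<^sub>M prob_algebra (paths {..n})"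
    using causal_product_measurable[of "Suc n" K "{..n}"] K by (simp add: lessThan_Suc_atMost)
  have "(\<integral>\<^sup>+z. h z \<partial>J K (Suc n)) =
      (\<integral>\<^sup>+u'. \<integral>\<^sup>+y. h (u', y) \<partial>causal_product K (Suc (Suc n)) u' \<partial>S (Suc n))"
    by (rule nn_integral_joint[OF K h])
  also have "\<dots> = (\<integral>\<^sup>+u'. \<integral>\<^sup>+y. G u' y \<partial>causal_product K (Suc n) u' \<partial>S (Suc n))"
  proof (rule nn_integral_cong)
    fix u assume "u \<in> space (S (Suc n))"
    then have u: "u \<in> space (paths {..Suc n})" by simp
    have r: "restrict u {..Suc n} = u" using u by (simp add: space_PiM PiE_restrict)
    have uy: "(\<lambda>y. h (u, y)) \<in> borel_measurable (paths {..<Suc (Suc n)})"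
      using u by (simp add: lessThan_Suc_atMost)
    show "(\<integral>\<^sup>+y. h (u, y) \<partial>causal_product K (Suc (Suc n)) u) =
      (\<integral>\<^sup>+y. G u y \<partial>causal_product K (Suc n) u)"
      using nn_integral_causal_product_Suc[OF K subset_refl u uy] by (simp add: r G_def)
  qed
  also have "\<dots> = (\<integral>\<^sup>+u. \<integral>\<^sup>+w. \<integral>\<^sup>+y. G (u(Suc n := A *v u n + w)) y
      \<partial>causal_product K (Suc n) (u(Suc n := A *v u n + w)) \<partial>\<mu>\<^sub>w \<partial>S n)"
  proof (rule nn_integral_source_Suc)
    have "causal_product K (Suc n) \<in> paths {..Suc n} \<rightarrow>\<^sub>M prob_algebra (paths {..n})"
      using causal_product_measurable[of "Suc n" K "{..Suc n}"] K
      by (auto simp: lessThan_Suc_atMost)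
    then show "(\<lambda>u'. \<integral>\<^sup>+y. G u' y \<partial>causal_product K (Suc n) u') \<in> borel_measurable (paths {..Suc n})"
      by (intro nn_integral_measurable_subprob_algebra2[of _ _ "paths {..n}"])
         (auto intro: measurable_prob_algebraD simp: case_prod_beta')
  qed
  also have "\<dots> = (\<integral>\<^sup>+u. \<integral>\<^sup>+y. \<integral>\<^sup>+w. G (u(Suc n := A *v u n + w)) y
      \<partial>\<mu>\<^sub>w \<partial>causal_product K (Suc n) u \<partial>S n)"
  proof (rule nn_integral_cong)
    fix u assume "u \<in> space (S n)"
    then have u [measurable]: "u \<in> space (paths {..n})" by simp
    have cpu: "causal_product K (Suc n) (u(Suc n := A *v u n + w)) = causal_product K (Suc n) u" for w
      by (rule causal_product_cong) auto
    have [measurable_cong]: "sets (causal_product K (Suc n) u) = sets (paths {..n})"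
      and p: "prob_space (causal_product K (Suc n) u)"
      using measurable_space[OF cp u] by (simp_all add: space_prob_algebra)
    interpret pair_sigma_finite \<mu>\<^sub>w "causal_product K (Suc n) u"
      by (intro pair_sigma_finite.intro noise.sigma_finite_measure_axioms)
         (simp add: p prob_space_imp_sigma_finite)
    have [measurable]: "(\<lambda>z. u(Suc n := A *v u n + fst z)) \<in> \<mu>\<^sub>w \<Otimes>\<^sub>M causal_product K (Suc n) u \<rightarrow>\<^sub>M paths {..Suc n}"
      using u by measurable
    show "(\<integral>\<^sup>+w. \<integral>\<^sup>+y. G (u(Suc n := A *v u n + w)) y
        \<partial>causal_product K (Suc n) (u(Suc n := A *v u n + w)) \<partial>\<mu>\<^sub>w) =
      (\<integral>\<^sup>+y. \<integral>\<^sup>+w. G (u(Suc n := A *v u n + w)) y \<partial>\<mu>\<^sub>w \<partial>causal_product K (Suc n) u)"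
      unfolding cpu by (rule Fubini'[symmetric]) (simp add: case_prod_beta')
  qed
  also have "\<dots> = (\<integral>\<^sup>+z. \<integral>\<^sup>+w. G ((fst z)(Suc n := A *v fst z n + w)) (snd z) \<partial>\<mu>\<^sub>w \<partial>J K n)"
    by (subst nn_integral_joint) (use K in auto)
  finally show ?thesis unfolding G_def .
qed

lemma nn_integral_joint_restrict:
  assumes "n \<le> n'" and K: "\<And>t. t \<le> n' \<Longrightarrow> stochastic_kernel K t"
    and h [measurable]: "h \<in> borel_measurable (paths {..n} \<Otimes>\<^sub>M paths {..n})"
  shows "(\<integral>\<^sup>+z. h (restrict (fst z) {..n}, restrict (snd z) {..n}) \<partial>J K n') = (\<integral>\<^sup>+z. h z \<partial>J K n)"
  using assms(1) K
proof (induction rule: dec_induct)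
  case base
  then have sp: "space (J K n) = space (paths {..n} \<Otimes>\<^sub>M paths {..n})"
    by (intro sets_eq_imp_space_eq sets_joint)
  show ?case
  proof (rule nn_integral_cong)
    fix z assume "z \<in> space (J K n)"
    then have "restrict (fst z) {..n} = fst z" "restrict (snd z) {..n} = snd z"
      by (auto simp: sp space_pair_measure space_PiM intro!: PiE_restrict)
    then show "h (restrict (fst z) {..n}, restrict (snd z) {..n}) = h z" by simp
  qed
next
  case (step k)
  have [measurable]: "(\<lambda>z. h (restrict (fst z) {..n}, restrict (snd z) {..n})) \<in>
      borel_measurable (paths {..Suc k} \<Otimes>\<^sub>M paths {..Suc k})"
    by (rule measurable_compose[OF _ h], intro measurable_Pair measurable_path_restrict)
       (use step in auto)
  have sp: "space (J K k) = space (paths {..k} \<Otimes>\<^sub>M paths {..k})"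
    using step.prems by (intro sets_eq_imp_space_eq sets_joint) auto
  have "(\<integral>\<^sup>+z. h (restrict (fst z) {..n}, restrict (snd z) {..n}) \<partial>J K (Suc k)) =
    (\<integral>\<^sup>+z. \<integral>\<^sup>+w. \<integral>\<^sup>+v. h (restrict (fst z) {..n}, restrict (snd z) {..n})
       \<partial>K (Suc k) ((fst z)(Suc k := A *v fst z k + w)) (snd z) \<partial>\<mu>\<^sub>w \<partial>J K k)"
  proof -
    have "restrict (f(Suc k := v)) {..n} = restrict f {..n}" for f and v :: "real^'n"
      using step by (auto simp: fun_eq_iff)
    then show ?thesis using step.prems by (subst nn_integral_joint_Suc) simp_all
  qed
  also have "\<dots> = (\<integral>\<^sup>+z. h (restrict (fst z) {..n}, restrict (snd z) {..n}) \<partial>J K k)"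
  proof (rule nn_integral_cong)
    fix z assume "z \<in> space (J K k)"
    then have z: "fst z \<in> space (paths {..k})" "snd z \<in> space (paths {..<Suc k})"
      by (auto simp: sp space_pair_measure lessThan_Suc_atMost)
    have "prob_space (K (Suc k) ((fst z)(Suc k := A *v fst z k + w)) (snd z))" for w
    proof -
      have "(fst z)(Suc k := A *v fst z k + w) \<in> space (paths {..Suc k})"
        using z by (auto simp: space_PiM PiE_def extensional_def)
      with z step.prems[of "Suc k"] show ?thesis
        unfolding stochastic_kernel_def
        by (auto simp: space_pair_measure space_prob_algebra
            dest!: measurable_space[of _ _ _ "((fst z)(Suc k := A *v fst z k + w), snd z)"])
    qed
    then show "(\<integral>\<^sup>+w. \<integral>\<^sup>+v. h (restrict (fst z) {..n}, restrict (snd z) {..n})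
       \<partial>K (Suc k) ((fst z)(Suc k := A *v fst z k + w)) (snd z) \<partial>\<mu>\<^sub>w) =
      h (restrict (fst z) {..n}, restrict (snd z) {..n})"
      by (simp add: prob_space.emeasure_space_1 noise.emeasure_space_1)
  qed
  also have "\<dots> = (\<integral>\<^sup>+z. h z \<partial>J K n)"
    by (rule step.IH) (use step.prems in auto)
  finally show ?case .
qed

lemma joint_restrict:
  assumes "n \<le> n'" and K: "\<And>t. t \<le> n' \<Longrightarrow> stochastic_kernel K t"
  shows "J K n = distr (J K n') (paths {..n} \<Otimes>\<^sub>M paths {..n})
    (\<lambda>z. (restrict (fst z) {..n}, restrict (snd z) {..n}))" (is "_ = distr _ ?N ?r")
proof (rule measure_eqI)
  have sJ: "sets (J K n) = sets ?N" by (rule sets_joint) (use assms in auto)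
  then show "sets (J K n) = sets (distr (J K n') ?N ?r)" by simp
  have [measurable_cong]: "sets (J K n') = sets (paths {..n'} \<Otimes>\<^sub>M paths {..n'})"
    by (rule sets_joint) (use assms in auto)
  have r [measurable]: "?r \<in> J K n' \<rightarrow>\<^sub>M ?N"
    by (intro measurable_Pair measurable_path_restrict[where I = "{..n'}"]) (use assms(1) in auto)
  fix X assume "X \<in> sets (J K n)"
  then have X [measurable]: "X \<in> sets ?N" using sJ by simp
  have "emeasure (distr (J K n') ?N ?r) X = (\<integral>\<^sup>+z. indicator X z \<partial>distr (J K n') ?N ?r)" by simp
  also have "\<dots> = (\<integral>\<^sup>+z. indicator X (?r z) \<partial>J K n')"
    by (rule nn_integral_distr) simp_all
  also have "\<dots> = (\<integral>\<^sup>+z. indicator X z \<partial>J K n)"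
    by (rule nn_integral_joint_restrict[OF assms]) auto
  also have "\<dots> = emeasure (J K n) X" using X sJ by simp
  finally show "emeasure (J K n) X = emeasure (distr (J K n') ?N ?r) X" ..
qed

lemma joint_source_marginal:
  assumes K: "\<And>t. t \<le> n \<Longrightarrow> stochastic_kernel K t"
  shows "distr (J K n) (paths {..n}) fst = S n"
proof (rule measure_eqI)
  have [measurable_cong]: "sets (J K n) = sets (paths {..n} \<Otimes>\<^sub>M paths {..n})"
    by (rule sets_joint[OF K])
  have cp: "causal_product K (Suc n) \<in> paths {..n} \<rightarrow>\<^sub>M prob_algebra (paths {..n})"
    using causal_product_measurable[of "Suc n" K "{..n}"] K by (simp add: lessThan_Suc_atMost)
  fix X assume "X \<in> sets (distr (J K n) (paths {..n}) fst)"
  then have X [measurable]: "X \<in> sets (paths {..n})" by simp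
  have "emeasure (distr (J K n) (paths {..n}) fst) X = (\<integral>\<^sup>+z. indicator X z \<partial>distr (J K n) (paths {..n}) fst)" by simp
  also have "\<dots> = (\<integral>\<^sup>+z. indicator X (fst z) \<partial>J K n)"
    by (rule nn_integral_distr) simp_all
  also have "\<dots> = (\<integral>\<^sup>+u. \<integral>\<^sup>+y. indicator X u \<partial>causal_product K (Suc n) u \<partial>S n)"
    by (subst nn_integral_joint[OF K]) auto
  also have "\<dots> = (\<integral>\<^sup>+u. indicator X u \<partial>S n)"
  proof (rule nn_integral_cong)
    fix u assume "u \<in> space (S n)"
    then have "prob_space (causal_product K (Suc n) u)"
      using measurable_space[OF cp, of u] by (simp add: space_prob_algebra)
    then show "(\<integral>\<^sup>+y. indicator X u \<partial>causal_product K (Suc n) u) = indicator X u"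
      by (simp add: prob_space.emeasure_space_1)
  qed
  finally show "emeasure (distr (J K n) (paths {..n}) fst) X = emeasure (S n) X" by simp
qed simp

definition distortion :: "'n kernels \<Rightarrow> nat \<Rightarrow> nat \<Rightarrow> ennreal" where
  "distortion K n t = (\<integral>\<^sup>+z. ennreal ((norm (fst z t - snd z t))\<^sup>2) \<partial>J K n)"

lemma meets_distortion_iff:
  "meets_distortion M x K n d \<longleftrightarrow> (\<forall>t\<le>n. distortion K n t \<le> ennreal d)"
  by (simp add: meets_distortion_def distortion_def case_prod_beta')

lemma distortion_restrict:
  assumes "t \<le> n" "n \<le> n'" and K: "\<And>t. t \<le> n' \<Longrightarrow> stochastic_kernel K t"
  shows "distortion K n' t = distortion K n t"
proof -
  have "distortion K n' t = (\<integral>\<^sup>+z. ennreal ((norm (restrict (fst z) {..n} t - restrict (snd z) {..n} t))\<^sup>2) \<partial>J K n')"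
    using assms by (simp add: distortion_def)
  also have "\<dots> = distortion K n t"
    unfolding distortion_def
    using nn_integral_joint_restrict[OF assms(2) K, of "\<lambda>z. ennreal ((norm (fst z t - snd z t))\<^sup>2)"]
      fst_component_measurable[of t "{..n}" "paths {..n}"] snd_component_measurable[of t "{..n}" "paths {..n}"] assms(1)
    by simp
  finally show ?thesis .
qed

lemma distortion_cong:
  assumes "\<And>t. t \<le> n \<Longrightarrow> K t = K' t"
  shows "distortion K n t = distortion K' n t"
  unfolding distortion_def using joint_cong[of n K K'] assms by simp

lemma meets_distortion_mono:
  assumes "n \<le> n'" "\<And>t. t \<le> n' \<Longrightarrow> stochastic_kernel K t" "meets_distortion M x K n' d"
  shows "meets_distortion M x K n d"
  unfolding meets_distortion_iff
proof (intro allI impI)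
  fix t assume t: "t \<le> n"
  have "distortion K n t = distortion K n' t"
    by (rule distortion_restrict[symmetric]) (use t assms in auto)
  also have "\<dots> \<le> ennreal d" using assms(1,3) t by (auto simp: meets_distortion_iff)
  finally show "distortion K n t \<le> ennreal d" .
qed

end

section \<open>Restarting a reconstruction on an independent copy of the source\<close>

text \<open>
  The properties of the grid code that concern the construction of the kernels and their
  distortion; those that concern information are added later.
\<close>
locale restart_coding = linear_source M x A \<mu>\<^sub>0 \<mu>\<^sub>w
  for M :: "'a measure" and x :: "nat \<Rightarrow> 'a \<Rightarrow> real^'n::finite" and A :: "real^'n^'n"
    and \<mu>\<^sub>0 \<mu>\<^sub>w :: "(real^'n) measure" +
  fixes D :: real and q :: "real^'n \<Rightarrow> real^'n" and emb :: "(real^'n) \<times> (real^'n) \<Rightarrow> real^'n"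
    and dec :: "real^'n \<Rightarrow> (real^'n) \<times> (real^'n) \<times> (real^'n)"
  assumes q_measurable [measurable]: "q \<in> borel_measurable borel"
    and emb_measurable [measurable]: "emb \<in> borel \<Otimes>\<^sub>M borel \<rightarrow>\<^sub>M borel"
    and dec_measurable [measurable]: "dec \<in> borel \<rightarrow>\<^sub>M borel \<Otimes>\<^sub>M borel \<Otimes>\<^sub>M borel"
    and dec_code: "dec (q e + emb p) = (q e, p)"
    and code_close: "(norm (e - (q e + emb p)))\<^sup>2 \<le> D"
    and grid_close: "(norm (e - q e))\<^sup>2 \<le> D"
begin

definition drift :: "nat \<Rightarrow> real^'n \<Rightarrow> real^'n" where
  "drift j = ((\<lambda>v. A *v v) ^^ j)"

lemma drift_0 [simp]: "drift 0 v = v" by (simp add: drift_def)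
lemma drift_Suc: "drift (Suc j) v = A *v drift j v" by (simp add: drift_def)

lemma drift_measurable [measurable]: "drift j \<in> borel_measurable borel"
proof (induction j)
  case (Suc j)
  have "(\<lambda>v. A *v drift j v) \<in> borel_measurable borel" using Suc by measurable
  then show ?case by (simp add: drift_Suc[abs_def])
qed (simp add: drift_def)

text \<open>
  With \<open>w\<close> the noise at the restart and \<open>x'\<close> an independent copy of the source, \<open>c\<close> is
  \<open>A u\<^sub>a + w - x'\<^sub>0\<close>. At time \<open>Suc a\<close> the two occurrences of \<open>x'\<^sub>0\<close> cancel and the value is
  the true successor \<open>A u\<^sub>a + w\<close>, so the copy starts without disturbing the source path.
\<close>
definition join_source ::
    "nat \<Rightarrow> nat \<Rightarrow> (nat \<Rightarrow> real^'n) \<Rightarrow> real^'n \<Rightarrow> (nat \<Rightarrow> real^'n) \<Rightarrow> nat \<Rightarrow> real^'n" where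
  "join_source a j u w x' = (\<lambda>t\<in>{..Suc (a + j)}.
     if t \<le> a then u t else drift (t - Suc a) (A *v u a + w - x' 0) + x' (t - Suc a))"

text \<open>
  The output of the concatenation in terms of the grid point \<open>\<kappa>\<close> and of \<open>c - A y\<^sub>a\<close>. Given the
  outputs of the two blocks, the source enters only through these two, which is why a reference
  law can generate the output without the source.
\<close>
definition assemble :: "nat \<Rightarrow> nat \<Rightarrow> (nat \<Rightarrow> real^'n) \<Rightarrow> (nat \<Rightarrow> real^'n) \<Rightarrow> real^'n \<Rightarrow> real^'n \<Rightarrow> nat \<Rightarrow> real^'n" where
  "assemble a b y y' \<kappa> c = (\<lambda>t\<in>{..Suc (a + b)}.
     if t \<le> a then y t
     else if t = Suc a then A *v y a + (\<kappa> + emb (c, y' 0))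
     else drift (t - Suc a) (A *v y a + c) + y' (t - Suc a))"

definition join_output ::
    "nat \<Rightarrow> nat \<Rightarrow> (nat \<Rightarrow> real^'n) \<Rightarrow> (nat \<Rightarrow> real^'n) \<Rightarrow> real^'n \<Rightarrow> (nat \<Rightarrow> real^'n) \<Rightarrow>
      (nat \<Rightarrow> real^'n) \<Rightarrow> nat \<Rightarrow> real^'n" where
  "join_output a j u y w x' y' =
    assemble a j y y' (q (A *v u a + w - A *v y a)) (A *v u a + w - A *v y a - x' 0)"

lemma join_output_eq:
  "join_output a j u y w x' y' = (\<lambda>t\<in>{..Suc (a + j)}.
     if t \<le> a then y t
     else if t = Suc a then
       A *v y a + (q (A *v u a + w - A *v y a) + emb (A *v u a + w - A *v y a - x' 0, y' 0))
     else drift (t - Suc a) (A *v u a + w - x' 0) + y' (t - Suc a))"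
proof -
  have eq: "A *v y a + (A *v u a + w - A *v y a - x' 0) = A *v u a + w - x' 0" by simp
  show ?thesis unfolding join_output_def assemble_def eq ..
qed

text \<open>
  At the restart, a source value \<open>x'\<^sub>0\<close> and an output \<open>y'\<^sub>0\<close> for the new block are drawn jointly,
  and \<open>e - x'\<^sub>0\<close> and \<open>y'\<^sub>0\<close> are hidden in the output. Afterwards the kernel decodes \<open>c\<close> and \<open>y'\<^sub>0\<close>, reconstructs the shifted
  paths from them, and runs \<open>K'\<close> on these. The first shifted output has to be taken from the
  code, since the actual output at that time is the code itself.
\<close>
definition restart_kernel :: "nat \<Rightarrow> 'n kernels \<Rightarrow> 'n kernels \<Rightarrow> 'n kernels" where
  "restart_kernel a K K' t s y =
    (if t \<le> a then K t s y
     else if t = Suc a then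
       distr (J K' 0) borel (\<lambda>z.
         A *v y a + (q (s (Suc a) - A *v y a) + emb (s (Suc a) - A *v y a - fst z 0, snd z 0)))
     else
       let code = dec (y (Suc a) - A *v y a); c = A *v y a + fst (snd code) in
       distr (K' (t - Suc a) (\<lambda>i\<in>{..t - Suc a}. s (Suc a + i) - drift i c)
           (\<lambda>i\<in>{..<t - Suc a}. if i = 0 then snd (snd code) else y (Suc a + i) - drift i c))
         borel (\<lambda>v. drift (t - Suc a) c + v))"

lemma join_source_measurable [measurable (raw)]:
  assumes [measurable]: "f \<in> N \<rightarrow>\<^sub>M paths {..a}" "g \<in> N \<rightarrow>\<^sub>M borel" "k \<in> N \<rightarrow>\<^sub>M paths {..j}"
  shows "(\<lambda>z. join_source a j (f z) (g z) (k z)) \<in> N \<rightarrow>\<^sub>M paths {..Suc (a + j)}"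
  unfolding join_source_def
proof (rule measurable_restrict)
  fix t assume t: "t \<in> {..Suc (a + j)}"
  note [measurable] = component_measurable[OF assms(1), of a, simplified]
    component_measurable[OF assms(3), of 0, simplified]
  show "(\<lambda>z. if t \<le> a then f z t else drift (t - Suc a) (A *v f z a + g z - k z 0) + k z (t - Suc a))
    \<in> borel_measurable N"
  proof (cases "t \<le> a")
    case True
    then show ?thesis using component_measurable[OF assms(1), of t] by simp
  next
    case False
    then have [measurable]: "(\<lambda>z. k z (t - Suc a)) \<in> borel_measurable N"
      using t by (intro component_measurable[OF assms(3)]) auto
    show ?thesis using False by simp
  qed
qed

lemma assemble_measurable [measurable (raw)]:
  assumes [measurable]: "h \<in> N \<rightarrow>\<^sub>M paths {..a}" "l \<in> N \<rightarrow>\<^sub>M paths {..b}"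
    "k \<in> borel_measurable N" "c \<in> borel_measurable N"
  shows "(\<lambda>z. assemble a b (h z) (l z) (k z) (c z)) \<in> N \<rightarrow>\<^sub>M paths {..Suc (a + b)}"
  unfolding assemble_def
proof (rule measurable_restrict)
  fix t assume t: "t \<in> {..Suc (a + b)}"
  note [measurable] = component_measurable[OF assms(1), of a, simplified]
    component_measurable[OF assms(2), of 0, simplified]
  consider "t \<le> a" | "t = Suc a" | "Suc a < t" by linarith
  then show "(\<lambda>z. if t \<le> a then h z t else if t = Suc a then A *v h z a + (k z + emb (c z, l z 0))
      else drift (t - Suc a) (A *v h z a + c z) + l z (t - Suc a)) \<in> borel_measurable N"
  proof cases
    case 1
    then show ?thesis using component_measurable[OF assms(1), of t] by simp
  next
    case 2
    then show ?thesis by simp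
  next
    case 3
    then have [measurable]: "(\<lambda>z. l z (t - Suc a)) \<in> borel_measurable N"
      using t by (intro component_measurable[OF assms(2)]) auto
    show ?thesis using 3 by simp
  qed
qed

lemma join_output_measurable [measurable (raw)]:
  assumes [measurable]: "f \<in> N \<rightarrow>\<^sub>M paths {..a}" "h \<in> N \<rightarrow>\<^sub>M paths {..a}" "g \<in> N \<rightarrow>\<^sub>M borel"
    "k \<in> N \<rightarrow>\<^sub>M paths {..j}" "l \<in> N \<rightarrow>\<^sub>M paths {..j}"
  shows "(\<lambda>z. join_output a j (f z) (h z) (g z) (k z) (l z)) \<in> N \<rightarrow>\<^sub>M paths {..Suc (a + j)}"
proof -
  note [measurable] = component_measurable[OF assms(1), of a, simplified]
    component_measurable[OF assms(2), of a, simplified]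
    component_measurable[OF assms(4), of 0, simplified]
  show ?thesis unfolding join_output_def by measurable
qed

lemma stochastic_restart_kernel:
  assumes K: "\<And>t. t \<le> a \<Longrightarrow> stochastic_kernel K t" and K': "\<And>t. t \<le> b \<Longrightarrow> stochastic_kernel K' t"
    and t: "t \<le> Suc (a + b)"
  shows "stochastic_kernel (restart_kernel a K K') t"
proof -
  let ?N = "paths {..t} \<Otimes>\<^sub>M paths {..<t} :: ((nat \<Rightarrow> real^'n) \<times> (nat \<Rightarrow> real^'n)) measure"
  have X: "(\<lambda>z. fst z i) \<in> borel_measurable ?N" if "i \<le> t" for i
    by (rule component_measurable[where I = "{..t}"]) (use that in auto)
  have Y: "(\<lambda>z. snd z i) \<in> borel_measurable ?N" if "i < t" for i
    by (rule component_measurable[where I = "{..<t}"]) (use that in auto)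
  consider "t \<le> a" | "t = Suc a" | "Suc a < t" by linarith
  then have "(\<lambda>z. restart_kernel a K K' t (fst z) (snd z)) \<in> ?N \<rightarrow>\<^sub>M prob_algebra borel"
  proof cases
    case 1
    then show ?thesis
      using stochastic_kernel_measurable[OF K[OF 1], of fst ?N snd] by (simp add: restart_kernel_def)
  next
    case 2
    note [measurable] = X[of "Suc a"] Y[of a]
    have J0: "J K' 0 \<in> space (prob_algebra (paths {..0} \<Otimes>\<^sub>M paths {..0}))"
      using K' by (simp add: space_prob_algebra prob_joint sets_joint)
    let ?N' = "?N \<Otimes>\<^sub>M (paths {..0} \<Otimes>\<^sub>M paths {..0})"
    have [measurable]: "(\<lambda>z. fst (fst z) (Suc a)) \<in> borel_measurable ?N'"
      "(\<lambda>z. snd (fst z) a) \<in> borel_measurable ?N'"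
      using measurable_compose[OF measurable_fst X[of "Suc a"]]
        measurable_compose[OF measurable_fst Y[of a]] 2 by auto
    have [measurable]: "(\<lambda>z. fst (snd z) 0) \<in> borel_measurable ?N'"
      "(\<lambda>z. snd (snd z) 0) \<in> borel_measurable ?N'"
      by (rule measurable_compose[OF measurable_snd fst_component_measurable], simp)
         (rule measurable_compose[OF measurable_snd snd_component_measurable], simp)
    have "(\<lambda>z. distr (J K' 0) borel (\<lambda>z'. A *v snd z a + (q (fst z (Suc a) - A *v snd z a) +
        emb (fst z (Suc a) - A *v snd z a - fst z' 0, snd z' 0)))) \<in> ?N \<rightarrow>\<^sub>M prob_algebra borel"
      by (rule measurable_distr_prob_space2[OF measurable_const[OF J0]])
         (unfold case_prod_beta', measurable)
    then show ?thesis using 2 by (simp add: restart_kernel_def)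
  next
    case 3
    define j where "j = t - Suc a"
    have j: "t = Suc a + j" "0 < j" "j \<le> b" using 3 t by (auto simp: j_def)
    have [measurable]: "(\<lambda>z. snd z a) \<in> borel_measurable ?N" "(\<lambda>z. snd z (Suc a)) \<in> borel_measurable ?N"
      using 3 by (auto intro: Y)
    let ?code = "\<lambda>z. dec (snd z (Suc a) - A *v snd z a)"
    let ?c = "\<lambda>z. A *v snd z a + fst (snd (?code z))"
    have c [measurable]: "?c \<in> borel_measurable ?N" "(\<lambda>z. snd (snd (?code z))) \<in> borel_measurable ?N"
      by measurable
    have 1: "(\<lambda>z. \<lambda>i\<in>{..j}. fst z (Suc a + i) - drift i (?c z)) \<in> ?N \<rightarrow>\<^sub>M paths {..j}"
      by (intro measurable_restrict borel_measurable_diff X measurable_compose[OF c(1)] drift_measurable)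
         (use j in auto)
    have 2: "(\<lambda>z. \<lambda>i\<in>{..<j}. if i = 0 then snd (snd (?code z)) else snd z (Suc a + i) - drift i (?c z))
      \<in> ?N \<rightarrow>\<^sub>M paths {..<j}"
    proof (rule measurable_restrict)
      fix i assume "i \<in> {..<j}"
      then have [measurable]: "(\<lambda>z. snd z (Suc a + i)) \<in> borel_measurable ?N"
        using j by (intro Y) auto
      show "(\<lambda>z. if i = 0 then snd (snd (?code z)) else snd z (Suc a + i) - drift i (?c z)) \<in> borel_measurable ?N"
        by (cases "i = 0") (simp_all del: add_Suc)
    qed
    have 3: "(\<lambda>z. K' j (\<lambda>i\<in>{..j}. fst z (Suc a + i) - drift i (?c z))
        (\<lambda>i\<in>{..<j}. if i = 0 then snd (snd (?code z)) else snd z (Suc a + i) - drift i (?c z)))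
      \<in> ?N \<rightarrow>\<^sub>M prob_algebra borel"
      by (rule stochastic_kernel_measurable[OF K'[OF j(3)] 1 2])
    have [measurable]: "(\<lambda>z. ?c (fst z)) \<in> borel_measurable (?N \<Otimes>\<^sub>M (borel :: (real^'n) measure))"
      by (rule measurable_compose[OF measurable_fst c(1)])
    have "(\<lambda>z. distr (K' j (\<lambda>i\<in>{..j}. fst z (Suc a + i) - drift i (?c z))
        (\<lambda>i\<in>{..<j}. if i = 0 then snd (snd (?code z)) else snd z (Suc a + i) - drift i (?c z)))
        borel (\<lambda>v. drift j (?c z) + v)) \<in> ?N \<rightarrow>\<^sub>M prob_algebra borel"
      by (rule measurable_distr_prob_space2[OF 3]) (unfold case_prod_beta', measurable)
    then show ?thesis using j by (simp add: restart_kernel_def Let_def)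
  qed
  then show ?thesis by (simp add: stochastic_kernel_def case_prod_beta')
qed

text \<open>
  The concatenated reconstruction is a deterministic function of three independent objects: the
  first reconstruction, the noise at the restart, and the second reconstruction run on its own
  copy of the source. This is what makes distortion and information of the parts add up.
\<close>
lemma joint_restart:
  assumes K: "\<And>t. t \<le> a \<Longrightarrow> stochastic_kernel K t" and K': "\<And>t. t \<le> b \<Longrightarrow> stochastic_kernel K' t"
    and "j \<le> b" and h: "h \<in> borel_measurable (paths {..Suc (a + j)} \<Otimes>\<^sub>M paths {..Suc (a + j)})"
  shows "(\<integral>\<^sup>+z. h z \<partial>J (restart_kernel a K K') (Suc (a + j))) =
    (\<integral>\<^sup>+z. \<integral>\<^sup>+w. \<integral>\<^sup>+z'. h (join_source a j (fst z) w (fst z'), join_output a j (fst z) (snd z) w (fst z') (snd z'))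
      \<partial>J K' j \<partial>\<mu>\<^sub>w \<partial>J K a)"
  using assms(3) h
proof (induction j arbitrary: h)
  case 0
  note h [measurable] = \<open>h \<in> borel_measurable (paths {..Suc (a + 0)} \<Otimes>\<^sub>M paths {..Suc (a + 0)})\<close>
  have h' [measurable]: "h \<in> borel_measurable (paths {..Suc a} \<Otimes>\<^sub>M paths {..Suc a})" using h by simp
  let ?K = "restart_kernel a K K'"
  have "(\<integral>\<^sup>+z. h z \<partial>J ?K (Suc a)) =
    (\<integral>\<^sup>+z. \<integral>\<^sup>+w. \<integral>\<^sup>+v. h ((fst z)(Suc a := A *v fst z a + w), (snd z)(Suc a := v))
       \<partial>?K (Suc a) ((fst z)(Suc a := A *v fst z a + w)) (snd z) \<partial>\<mu>\<^sub>w \<partial>J ?K a)"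
    by (rule nn_integral_joint_Suc[OF _ h'])
       (rule stochastic_restart_kernel[where b = b], use K K' in auto)
  also have "J ?K a = J K a"
    by (rule joint_cong) (simp add: restart_kernel_def fun_eq_iff)
  also have "(\<integral>\<^sup>+z. \<integral>\<^sup>+w. \<integral>\<^sup>+v. h ((fst z)(Suc a := A *v fst z a + w), (snd z)(Suc a := v))
       \<partial>?K (Suc a) ((fst z)(Suc a := A *v fst z a + w)) (snd z) \<partial>\<mu>\<^sub>w \<partial>J K a) =
    (\<integral>\<^sup>+z. \<integral>\<^sup>+w. \<integral>\<^sup>+z'. h (join_source a 0 (fst z) w (fst z'), join_output a 0 (fst z) (snd z) w (fst z') (snd z'))
      \<partial>J K' 0 \<partial>\<mu>\<^sub>w \<partial>J K a)"
  proof (rule nn_integral_cong)+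
    fix z w
    assume "z \<in> space (J K a)"
    then have z: "fst z \<in> space (paths {..a})" "snd z \<in> space (paths {..a})"
      using sets_eq_imp_space_eq[OF sets_joint[OF K]] by (auto simp: space_pair_measure)
    let ?u = "(fst z)(Suc a := A *v fst z a + w)"
    have [measurable_cong]: "sets (J K' 0) = sets (paths {..0} \<Otimes>\<^sub>M paths {..0})"
      by (rule sets_joint) (use K' in auto)
    have [measurable]: "(\<lambda>z'. fst z' 0) \<in> borel_measurable (J K' 0)" "(\<lambda>z'. snd z' 0) \<in> borel_measurable (J K' 0)"
      using fst_component_measurable[of 0 "{..0}" "paths {..0}"] snd_component_measurable[of 0 "{..0}" "paths {..0}"]
      by (simp_all cong: measurable_cong_sets)
    have u: "?u \<in> space (paths {..Suc a})" using z by (auto simp: space_PiM PiE_def extensional_def)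
    have "(\<lambda>v. (?u, (snd z)(Suc a := v))) \<in> borel \<rightarrow>\<^sub>M paths {..Suc a} \<Otimes>\<^sub>M paths {..Suc a}"
      using u z by measurable
    from measurable_compose[OF this h']
    have [measurable]: "(\<lambda>v. h (?u, (snd z)(Suc a := v))) \<in> borel_measurable borel" .
    have "(\<integral>\<^sup>+v. h (?u, (snd z)(Suc a := v)) \<partial>?K (Suc a) ?u (snd z)) =
      (\<integral>\<^sup>+z'. h (?u, (snd z)(Suc a := A *v snd z a + (q (?u (Suc a) - A *v snd z a) +
        emb (?u (Suc a) - A *v snd z a - fst z' 0, snd z' 0)))) \<partial>J K' 0)"
    proof -
      have "?K (Suc a) ?u (snd z) = distr (J K' 0) borel (\<lambda>z'. A *v snd z a + (q (?u (Suc a) - A *v snd z a) +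
        emb (?u (Suc a) - A *v snd z a - fst z' 0, snd z' 0)))"
        by (simp add: restart_kernel_def)
      then show ?thesis
        by (simp only:) (subst nn_integral_distr, measurable)
    qed
    also have "\<dots> = (\<integral>\<^sup>+z'. h (join_source a 0 (fst z) w (fst z'), join_output a 0 (fst z) (snd z) w (fst z') (snd z')) \<partial>J K' 0)"
    proof (rule nn_integral_cong)
      fix z' :: "(nat \<Rightarrow> real^'n) \<times> (nat \<Rightarrow> real^'n)"
      have "join_source a 0 (fst z) w (fst z') = ?u"
        using z by (auto simp: join_source_def space_PiM PiE_def extensional_def fun_eq_iff le_Suc_eq)
      moreover have "join_output a 0 (fst z) (snd z) w (fst z') (snd z') =
        (snd z)(Suc a := A *v snd z a + (q (?u (Suc a) - A *v snd z a) +
        emb (?u (Suc a) - A *v snd z a - fst z' 0, snd z' 0)))"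
        using z by (auto simp: join_output_eq space_PiM PiE_def extensional_def fun_eq_iff le_Suc_eq)
      ultimately show "h (?u, (snd z)(Suc a := A *v snd z a + (q (?u (Suc a) - A *v snd z a) +
        emb (?u (Suc a) - A *v snd z a - fst z' 0, snd z' 0)))) =
        h (join_source a 0 (fst z) w (fst z'), join_output a 0 (fst z) (snd z) w (fst z') (snd z'))"
        by simp
    qed
    finally show "(\<integral>\<^sup>+v. h (?u, (snd z)(Suc a := v)) \<partial>?K (Suc a) ?u (snd z)) =
      (\<integral>\<^sup>+z'. h (join_source a 0 (fst z) w (fst z'), join_output a 0 (fst z) (snd z) w (fst z') (snd z')) \<partial>J K' 0)" .
  qed
  finally show ?case by simp
next
  case (Suc j)
  let ?n = "Suc (a + j)"
  have h [measurable]: "h \<in> borel_measurable (paths {..Suc ?n} \<Otimes>\<^sub>M paths {..Suc ?n})"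
    using Suc.prems(2) by simp
  let ?K = "restart_kernel a K K'"
  have SK: "stochastic_kernel ?K t" if "t \<le> Suc ?n" for t
    by (rule stochastic_restart_kernel[where b = b]) (use K K' that Suc.prems in auto)
  define H where "H z = (\<integral>\<^sup>+w. \<integral>\<^sup>+v. h ((fst z)(Suc ?n := A *v fst z ?n + w), (snd z)(Suc ?n := v))
       \<partial>?K (Suc ?n) ((fst z)(Suc ?n := A *v fst z ?n + w)) (snd z) \<partial>\<mu>\<^sub>w)" for z
  have H: "H \<in> borel_measurable (paths {..?n} \<Otimes>\<^sub>M paths {..?n})"
  proof -
    have "(\<lambda>z. \<integral>\<^sup>+v. h ((fst (fst z))(Suc ?n := A *v fst (fst z) ?n + snd z), (snd (fst z))(Suc ?n := v))
       \<partial>?K (Suc ?n) ((fst (fst z))(Suc ?n := A *v fst (fst z) ?n + snd z)) (snd (fst z)))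
       \<in> borel_measurable ((paths {..?n} \<Otimes>\<^sub>M paths {..?n}) \<Otimes>\<^sub>M \<mu>\<^sub>w)"
      by (rule joint_step_measurable[OF SK h]) simp_all
    then show ?thesis unfolding H_def
      by (intro noise.borel_measurable_nn_integral) (simp add: case_prod_beta')
  qed
  have "(\<integral>\<^sup>+z. h z \<partial>J ?K (Suc ?n)) = (\<integral>\<^sup>+z. H z \<partial>J ?K ?n)"
    unfolding H_def by (rule nn_integral_joint_Suc[OF SK h])
  also have "\<dots> = (\<integral>\<^sup>+z. \<integral>\<^sup>+w. \<integral>\<^sup>+z'. H (join_source a j (fst z) w (fst z'), join_output a j (fst z) (snd z) w (fst z') (snd z'))
      \<partial>J K' j \<partial>\<mu>\<^sub>w \<partial>J K a)"
    using Suc.IH[OF _ H] Suc.prems by simp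
  also have "\<dots> = (\<integral>\<^sup>+z. \<integral>\<^sup>+w. \<integral>\<^sup>+z'. h (join_source a (Suc j) (fst z) w (fst z'), join_output a (Suc j) (fst z) (snd z) w (fst z') (snd z'))
      \<partial>J K' (Suc j) \<partial>\<mu>\<^sub>w \<partial>J K a)"
  proof (rule nn_integral_cong)+
    fix z w
    assume "z \<in> space (J K a)"
    then have z: "fst z \<in> space (paths {..a})" "snd z \<in> space (paths {..a})"
      using sets_eq_imp_space_eq[OF sets_joint[OF K]] by (auto simp: space_pair_measure)
    let ?h = "\<lambda>z'. h (join_source a (Suc j) (fst z) w (fst z'), join_output a (Suc j) (fst z) (snd z) w (fst z') (snd z'))"
    have "(\<lambda>x'. join_source a (Suc j) (fst z) w x') \<in> paths {..Suc j} \<rightarrow>\<^sub>M paths {..Suc (a + Suc j)}"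
      by (intro join_source_measurable measurable_const z measurable_ident_sets refl) simp
    then have js: "(\<lambda>x'. join_source a (Suc j) (fst z) w x') \<in> paths {..Suc j} \<rightarrow>\<^sub>M paths {..Suc ?n}"
      by (simp only: add_Suc_right)
    have "(\<lambda>z'. (join_source a (Suc j) (fst z) w (fst z'), join_output a (Suc j) (fst z) (snd z) w (fst z') (snd z')))
      \<in> paths {..Suc j} \<Otimes>\<^sub>M paths {..Suc j} \<rightarrow>\<^sub>M paths {..Suc (a + Suc j)} \<Otimes>\<^sub>M paths {..Suc (a + Suc j)}"
      by (intro measurable_Pair join_source_measurable join_output_measurable) (use z in auto)
    from measurable_compose[OF this Suc.prems(2)]
    have h2: "?h \<in> borel_measurable (paths {..Suc j} \<Otimes>\<^sub>M paths {..Suc j})" .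
    have "(\<integral>\<^sup>+z'. ?h z' \<partial>J K' (Suc j)) =
      (\<integral>\<^sup>+z'. \<integral>\<^sup>+w'. \<integral>\<^sup>+v. ?h ((fst z')(Suc j := A *v fst z' j + w'), (snd z')(Suc j := v))
         \<partial>K' (Suc j) ((fst z')(Suc j := A *v fst z' j + w')) (snd z') \<partial>\<mu>\<^sub>w \<partial>J K' j)"
      by (rule nn_integral_joint_Suc[OF _ h2]) (use K' Suc.prems in auto)
    also have "\<dots> = (\<integral>\<^sup>+z'. H (join_source a j (fst z) w (fst z'), join_output a j (fst z) (snd z) w (fst z') (snd z')) \<partial>J K' j)"
      unfolding H_def fst_conv snd_conv
    proof (rule nn_integral_cong)+
      fix z' w'
      assume "z' \<in> space (J K' j)"
      then have z': "fst z' \<in> space (paths {..j})" "snd z' \<in> space (paths {..j})"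
        using sets_eq_imp_space_eq[OF sets_joint[of j K']] K' Suc.prems by (auto simp: space_pair_measure)
      let ?u = "join_source a j (fst z) w (fst z')"
      let ?y = "join_output a j (fst z) (snd z) w (fst z') (snd z')"
      let ?x = "(fst z')(Suc j := A *v fst z' j + w')"
      define e where "e = A *v fst z a + w - A *v snd z a"
      define c where "c = A *v fst z a + w - fst z' 0"
      have u_eq: "?u(Suc ?n := A *v ?u ?n + w') = join_source a (Suc j) (fst z) w ?x"
        by (auto simp: join_source_def fun_eq_iff drift_Suc matrix_vector_right_distrib le_Suc_eq
            Suc_diff_le)
      have y_eq: "?y(Suc ?n := drift (Suc j) c + v) =
          join_output a (Suc j) (fst z) (snd z) w ?x ((snd z')(Suc j := v))" for v
        by (auto simp: join_output_eq fun_eq_iff c_def le_Suc_eq Suc_diff_le)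
      have code: "dec (?y (Suc a) - A *v ?y a) = (q e, e - fst z' 0, snd z' 0)"
        by (simp add: join_output_eq e_def dec_code)
      have c_eq: "A *v ?y a + (e - fst z' 0) = c"
        by (simp add: join_output_eq e_def c_def)
      have x_eq: "(\<lambda>i\<in>{..Suc j}. (?u(Suc ?n := A *v ?u ?n + w')) (Suc a + i) - drift i c) = ?x"
        unfolding u_eq using z'
        by (auto simp: join_source_def fun_eq_iff c_def space_PiM PiE_def extensional_def le_Suc_eq)
      have y'_eq: "(\<lambda>i\<in>{..<Suc j}. if i = 0 then snd z' 0 else ?y (Suc a + i) - drift i c) = snd z'"
        using z' by (auto simp: join_output_eq fun_eq_iff c_def space_PiM PiE_def extensional_def)
      have kern: "?K (Suc ?n) (?u(Suc ?n := A *v ?u ?n + w')) ?y =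
          distr (K' (Suc j) ?x (snd z')) borel (\<lambda>v. drift (Suc j) c + v)"
      proof -
        have sub: "Suc ?n - Suc a = Suc j" "(Suc ?n \<le> a) = False" "(Suc ?n = Suc a) = False" by auto
        show ?thesis
          unfolding restart_kernel_def sub if_False Let_def code fst_conv snd_conv c_eq x_eq y'_eq ..
      qed
      have xs: "?x \<in> space (paths {..Suc j})" using z' by (auto simp: space_PiM PiE_def extensional_def)
      have ys: "snd z' \<in> space (paths {..<Suc j})" using z' by (simp add: lessThan_Suc_atMost)
      have "stochastic_kernel K' (Suc j)" using K' Suc.prems by auto
      from measurable_space[OF this[unfolded stochastic_kernel_def], of "(?x, snd z')"]
      have [measurable_cong]: "sets (K' (Suc j) ?x (snd z')) = sets borel"
        using xs ys by (simp add: space_pair_measure space_prob_algebra)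
      have "?u(Suc ?n := A *v ?u ?n + w') \<in> space (paths {..Suc ?n})"
        unfolding u_eq using measurable_space[OF js xs] .
      moreover have "?y \<in> space (paths {..?n})"
        by (auto simp: join_output_eq space_PiM)
      ultimately have "(\<lambda>v. (?u(Suc ?n := A *v ?u ?n + w'), ?y(Suc ?n := v))) \<in> borel \<rightarrow>\<^sub>M paths {..Suc ?n} \<Otimes>\<^sub>M paths {..Suc ?n}"
        by measurable
      from measurable_compose[OF this h]
      have [measurable]: "(\<lambda>v. h (?u(Suc ?n := A *v ?u ?n + w'), ?y(Suc ?n := v))) \<in> borel_measurable borel" .
      show "(\<integral>\<^sup>+v. h (join_source a (Suc j) (fst z) w ?x, join_output a (Suc j) (fst z) (snd z) w ?x ((snd z')(Suc j := v)))
         \<partial>K' (Suc j) ?x (snd z')) =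
        (\<integral>\<^sup>+v. h (?u(Suc ?n := A *v ?u ?n + w'), ?y(Suc ?n := v))
           \<partial>?K (Suc ?n) (?u(Suc ?n := A *v ?u ?n + w')) ?y)"
      proof -
        have "(\<integral>\<^sup>+v. h (?u(Suc ?n := A *v ?u ?n + w'), ?y(Suc ?n := v))
           \<partial>distr (K' (Suc j) ?x (snd z')) borel (\<lambda>v. drift (Suc j) c + v)) =
          (\<integral>\<^sup>+v. h (?u(Suc ?n := A *v ?u ?n + w'), ?y(Suc ?n := drift (Suc j) c + v)) \<partial>K' (Suc j) ?x (snd z'))"
          by (rule nn_integral_distr) measurable
        then show ?thesis unfolding kern y_eq unfolding u_eq by (rule sym)
      qed
    qed
    finally show "(\<integral>\<^sup>+z'. H (join_source a j (fst z) w (fst z'), join_output a j (fst z) (snd z) w (fst z') (snd z')) \<partial>J K' j)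
      = (\<integral>\<^sup>+z'. ?h z' \<partial>J K' (Suc j))" ..
  qed
  finally show ?case by simp
qed

lemma nn_integral_const_prob:
  "prob_space N \<Longrightarrow> (\<integral>\<^sup>+z. c \<partial>N) = (c::ennreal)"
  by (simp add: prob_space.emeasure_space_1)

text \<open>
  Before the restart nothing changes; at the restart the error is within a grid cell; afterwards
  the common shift \<open>A\<^sup>j c\<close> cancels and the error is that of \<open>K'\<close>.
\<close>
lemma distortion_restart:
  assumes K: "\<And>t. t \<le> a \<Longrightarrow> stochastic_kernel K t" and K': "\<And>t. t \<le> b \<Longrightarrow> stochastic_kernel K' t"
    and D: "meets_distortion M x K a D" and D': "meets_distortion M x K' b D"
  shows "meets_distortion M x (restart_kernel a K K') (Suc (a + b)) D"
  unfolding meets_distortion_iff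
proof (intro allI impI)
  let ?K = "restart_kernel a K K'"
  let ?n = "Suc (a + b)"
  have SK: "stochastic_kernel ?K t" if "t \<le> ?n" for t
    by (rule stochastic_restart_kernel[where b = b]) (use K K' that in auto)
  fix t assume t: "t \<le> ?n"
  have m: "(\<lambda>z. ennreal ((norm (fst z t - snd z t))\<^sup>2)) \<in> borel_measurable (paths {..?n} \<Otimes>\<^sub>M paths {..?n})"
    using fst_component_measurable[of t "{..?n}" "paths {..?n}"]
      snd_component_measurable[of t "{..?n}" "paths {..?n}"] t by simp
  have pJ: "prob_space (J K a)" "prob_space (J K' b)" using prob_joint K K' by auto
  have eq: "distortion ?K ?n t = (\<integral>\<^sup>+z. \<integral>\<^sup>+w. \<integral>\<^sup>+z'. ennreal ((norm (join_source a b (fst z) w (fst z') t -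
      join_output a b (fst z) (snd z) w (fst z') (snd z') t))\<^sup>2) \<partial>J K' b \<partial>\<mu>\<^sub>w \<partial>J K a)"
    using joint_restart[OF K K' order_refl m] by (simp add: distortion_def)
  consider "t \<le> a" | "t = Suc a" | "Suc a < t" by linarith
  then show "distortion ?K ?n t \<le> ennreal D"
  proof cases
    case 1
    have "distortion ?K ?n t = distortion ?K a t"
      by (rule distortion_restrict) (use 1 SK in auto)
    also have "\<dots> = distortion K a t"
      by (rule distortion_cong) (simp add: restart_kernel_def fun_eq_iff)
    finally show ?thesis using D 1 by (simp add: meets_distortion_iff)
  next
    case 2
    have "distortion ?K ?n t \<le> (\<integral>\<^sup>+z. \<integral>\<^sup>+w. \<integral>\<^sup>+z'. ennreal D \<partial>J K' b \<partial>\<mu>\<^sub>w \<partial>J K a)"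
      unfolding eq
    proof (intro nn_integral_mono ennreal_leI)
      fix z w z'
      show "(norm (join_source a b (fst z) w (fst z') t - join_output a b (fst z) (snd z) w (fst z') (snd z') t))\<^sup>2 \<le> D"
      proof -
        define e where "e = A *v fst z a + w - A *v snd z a"
        have "join_source a b (fst z) w (fst z') t - join_output a b (fst z) (snd z) w (fst z') (snd z') t
            = e - (q e + emb (e - fst z' 0, snd z' 0))"
          using 2 by (simp add: join_source_def join_output_eq e_def)
        then show ?thesis using code_close by simp
      qed
    qed
    also have "\<dots> = ennreal D"
      using pJ prob_noise by (simp only: nn_integral_const_prob)
    finally show ?thesis .
  next
    case 3
    have "distortion ?K ?n t = (\<integral>\<^sup>+z. \<integral>\<^sup>+w. distortion K' b (t - Suc a) \<partial>\<mu>\<^sub>w \<partial>J K a)"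
      unfolding eq distortion_def[of K']
      by (intro nn_integral_cong) (use 3 t in \<open>simp add: join_source_def join_output_eq\<close>)
    also have "\<dots> = distortion K' b (t - Suc a)"
      using pJ prob_noise by (simp only: nn_integral_const_prob)
    also have "\<dots> \<le> ennreal D" using D' 3 t by (auto simp: meets_distortion_iff)
    finally show ?thesis .
  qed
qed

text \<open>
  The change of variables behind the dither: if source, restart noise and the copy are
  independent, then the joined path is again a source path, and it is independent of the
  starting value of the copy. The density computation uses it in this direction, from three
  independent inputs to the path and \<open>\<xi>\<close>.
\<close>
lemma nn_integral_source_join:
  assumes h: "h \<in> borel_measurable (paths {..Suc (a + j)} \<Otimes>\<^sub>M borel)"
  shows "(\<integral>\<^sup>+u. \<integral>\<^sup>+w. \<integral>\<^sup>+x'. h (join_source a j u w x', x' 0) \<partial>S j \<partial>\<mu>\<^sub>w \<partial>S a) =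
    (\<integral>\<^sup>+u. \<integral>\<^sup>+\<xi>. h (u, \<xi>) \<partial>\<mu>\<^sub>0 \<partial>S (Suc (a + j)))"
  using h
proof (induction j arbitrary: h)
  case 0
  then have h [measurable]: "h \<in> borel_measurable (paths {..Suc a} \<Otimes>\<^sub>M borel)" by simp
  have "(\<integral>\<^sup>+u. \<integral>\<^sup>+w. \<integral>\<^sup>+x'. h (join_source a 0 u w x', x' 0) \<partial>S 0 \<partial>\<mu>\<^sub>w \<partial>S a) =
      (\<integral>\<^sup>+u. \<integral>\<^sup>+w. \<integral>\<^sup>+\<xi>. h (u(Suc a := A *v u a + w), \<xi>) \<partial>\<mu>\<^sub>0 \<partial>\<mu>\<^sub>w \<partial>S a)"
  proof (rule nn_integral_cong)+
    fix u w assume "u \<in> space (S a)"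
    then have u: "u \<in> space (paths {..a})" by simp
    have [measurable]: "(\<lambda>x'. x' 0) \<in> borel_measurable (paths {..0})" by measurable
    have "(\<lambda>x'. h (join_source a 0 u w x', x' 0)) \<in> borel_measurable (paths {..0})"
      by (rule measurable_compose[OF _ 0(1)], intro measurable_Pair join_source_measurable) (use u in auto)
    from nn_integral_source_0[OF this]
    show "(\<integral>\<^sup>+x'. h (join_source a 0 u w x', x' 0) \<partial>S 0) = (\<integral>\<^sup>+\<xi>. h (u(Suc a := A *v u a + w), \<xi>) \<partial>\<mu>\<^sub>0)"
    proof -
      have "join_source a 0 u w x' = u(Suc a := A *v u a + w)" for x'
        using u by (auto simp: join_source_def space_PiM PiE_def extensional_def fun_eq_iff le_Suc_eq)
      then show ?thesis
        using \<open>(\<integral>\<^sup>+x'. h (join_source a 0 u w x', x' 0) \<partial>S 0) = _\<close> by simp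
    qed
  qed
  also have "\<dots> = (\<integral>\<^sup>+u. \<integral>\<^sup>+\<xi>. h (u, \<xi>) \<partial>\<mu>\<^sub>0 \<partial>S (Suc a))"
    by (rule nn_integral_source_Suc[symmetric]) measurable
  finally show ?case by simp
next
  case (Suc j)
  let ?n = "Suc (a + j)"
  have h [measurable]: "h \<in> borel_measurable (paths {..Suc ?n} \<Otimes>\<^sub>M borel)" using Suc.prems by simp
  define H where "H z = (\<integral>\<^sup>+w. h ((fst z)(Suc ?n := A *v fst z ?n + w), snd z) \<partial>\<mu>\<^sub>w)" for z
  have H [measurable]: "H \<in> borel_measurable (paths {..?n} \<Otimes>\<^sub>M borel)"
    unfolding H_def by measurable
  have "(\<integral>\<^sup>+u. \<integral>\<^sup>+w. \<integral>\<^sup>+x'. h (join_source a (Suc j) u w x', x' 0) \<partial>S (Suc j) \<partial>\<mu>\<^sub>w \<partial>S a) =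
     (\<integral>\<^sup>+u. \<integral>\<^sup>+w. \<integral>\<^sup>+x'. H (join_source a j u w x', x' 0) \<partial>S j \<partial>\<mu>\<^sub>w \<partial>S a)"
  proof (rule nn_integral_cong)+
    fix u w assume "u \<in> space (S a)"
    then have u: "u \<in> space (paths {..a})" by simp
    have c: "(\<lambda>x'. x' 0) \<in> borel_measurable (paths {..Suc j})" by measurable
    have "(\<lambda>x'. h (join_source a (Suc j) u w x', x' 0)) \<in> borel_measurable (paths {..Suc j})"
      by (rule measurable_compose[OF _ Suc.prems], intro measurable_Pair join_source_measurable c) (use u in auto)
    from nn_integral_source_Suc[OF this]
    have "(\<integral>\<^sup>+x'. h (join_source a (Suc j) u w x', x' 0) \<partial>S (Suc j)) =
      (\<integral>\<^sup>+x'. \<integral>\<^sup>+w'. h (join_source a (Suc j) u w (x'(Suc j := A *v x' j + w')), x' 0) \<partial>\<mu>\<^sub>w \<partial>S j)"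
      by simp
    also have "\<dots> = (\<integral>\<^sup>+x'. H (join_source a j u w x', x' 0) \<partial>S j)"
      unfolding H_def fst_conv snd_conv
    proof (rule nn_integral_cong)+
      fix x' w'
      have "join_source a (Suc j) u w (x'(Suc j := A *v x' j + w')) =
        (join_source a j u w x')(Suc ?n := A *v join_source a j u w x' ?n + w')"
        by (auto simp: join_source_def fun_eq_iff drift_Suc matrix_vector_right_distrib le_Suc_eq Suc_diff_le)
      then show "h (join_source a (Suc j) u w (x'(Suc j := A *v x' j + w')), x' 0) =
         h ((join_source a j u w x')(Suc ?n := A *v join_source a j u w x' ?n + w'), x' 0)"
        by simp
    qed
    finally show "(\<integral>\<^sup>+x'. h (join_source a (Suc j) u w x', x' 0) \<partial>S (Suc j)) =
      (\<integral>\<^sup>+x'. H (join_source a j u w x', x' 0) \<partial>S j)" .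
  qed
  also have "\<dots> = (\<integral>\<^sup>+u. \<integral>\<^sup>+\<xi>. H (u, \<xi>) \<partial>\<mu>\<^sub>0 \<partial>S ?n)" by (rule Suc.IH[OF H])
  also have "\<dots> = (\<integral>\<^sup>+u. \<integral>\<^sup>+w. \<integral>\<^sup>+\<xi>. h (u(Suc ?n := A *v u ?n + w), \<xi>) \<partial>\<mu>\<^sub>0 \<partial>\<mu>\<^sub>w \<partial>S ?n)"
  proof (rule nn_integral_cong)
    fix u assume "u \<in> space (S ?n)"
    then have u [measurable]: "u \<in> space (paths {..?n})" by simp
    interpret pair_sigma_finite \<mu>\<^sub>0 \<mu>\<^sub>w
      by (intro pair_sigma_finite.intro init.sigma_finite_measure_axioms noise.sigma_finite_measure_axioms)
    have [measurable]: "(\<lambda>z. u(Suc ?n := A *v u ?n + snd z)) \<in> \<mu>\<^sub>0 \<Otimes>\<^sub>M \<mu>\<^sub>w \<rightarrow>\<^sub>M paths {..Suc ?n}"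
      by (rule measurable_path_update'[OF measurable_const[OF u]]) measurable
    show "(\<integral>\<^sup>+\<xi>. H (u, \<xi>) \<partial>\<mu>\<^sub>0) = (\<integral>\<^sup>+w. \<integral>\<^sup>+\<xi>. h (u(Suc ?n := A *v u ?n + w), \<xi>) \<partial>\<mu>\<^sub>0 \<partial>\<mu>\<^sub>w)"
      unfolding H_def fst_conv snd_conv
      by (rule Fubini'[symmetric]) (unfold case_prod_beta', measurable)
  qed
  also have "\<dots> = (\<integral>\<^sup>+u. \<integral>\<^sup>+\<xi>. h (u, \<xi>) \<partial>\<mu>\<^sub>0 \<partial>S (Suc ?n))"
    by (rule nn_integral_source_Suc[symmetric]) measurable
  finally show ?case by simp
qed

end

section \<open>The information cost of a restart\<close>

lemma norm_add_sq_le: "(norm (v + w))\<^sup>2 \<le> 2 * (norm v)\<^sup>2 + 2 * (norm (w :: 'a::real_normed_vector))\<^sup>2"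
proof -
  have "(norm (v + w))\<^sup>2 \<le> (norm v + norm w)\<^sup>2"
    by (intro power_mono norm_triangle_ineq) simp
  also have "\<dots> \<le> 2 * (norm v)\<^sup>2 + 2 * (norm w)\<^sup>2"
    using sum_squares_bound[of "norm v" "norm w"] by (simp add: power2_sum)
  finally show ?thesis .
qed

lemma norm_diff_sq_le: "(norm (v - w))\<^sup>2 \<le> 2 * (norm v)\<^sup>2 + 2 * (norm (w :: 'a::real_normed_vector))\<^sup>2"
  using norm_add_sq_le[of v "- w"] by simp

text \<open>
  The smoothness of the initial law is needed for the cost of revealing \<open>c\<close>: shifting \<open>\<xi>\<close> by less
  than a grid cell must have bounded relative entropy. The second moments bound the cost of
  revealing the grid point.
\<close>
locale regular_restart = restart_coding M x A \<mu>\<^sub>0 \<mu>\<^sub>w D q emb dec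
  for M :: "'a measure" and x :: "nat \<Rightarrow> 'a \<Rightarrow> real^'n::finite" and A :: "real^'n^'n"
    and \<mu>\<^sub>0 \<mu>\<^sub>w :: "(real^'n) measure" and D q emb dec +
  fixes g :: "real^'n \<Rightarrow> real" and C\<^sub>g vol :: real
  assumes init_density: "\<mu>\<^sub>0 = density lborel (\<lambda>v. ennreal (g v))"
    and g_measurable [measurable]: "g \<in> borel_measurable borel"
    and g_pos: "0 < g v"
    and ln_g: "\<bar>ln (g v)\<bar> \<le> C\<^sub>g * (1 + (norm v)\<^sup>2)"
    and init_moment: "integrable \<mu>\<^sub>0 (\<lambda>v. (norm v)\<^sup>2)"
    and noise_moment: "integrable \<mu>\<^sub>w (\<lambda>v. (norm v)\<^sup>2)"
    and vol_pos: "0 < vol" and vol_le: "ennreal vol \<le> emeasure lborel {z. q z = q e}"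
begin

lemma space_init [simp]: "space \<mu>\<^sub>0 = UNIV"
  using sets_eq_imp_space_eq[OF sets_init] by simp

lemma C_g_nonneg: "0 \<le> C\<^sub>g"
  using ln_g[of 0] by simp

text \<open>
  The reference law of the grid point is that of the rounding of a variable with the initial
  law, so a grid point has this probability.
\<close>
definition cell :: "real^'n \<Rightarrow> real" where
  "cell \<kappa> = measure \<mu>\<^sub>0 {z. q z = \<kappa>}"

lemma cell_sets [measurable]: "{z. q z = \<kappa>} \<in> sets borel"
  by measurable

lemma emeasure_cell: "emeasure \<mu>\<^sub>0 {z. q z = \<kappa>} = ennreal (cell \<kappa>)"
  unfolding cell_def by (rule init.emeasure_eq_measure)

lemma cell_measurable [measurable]: "cell \<in> borel_measurable borel"
proof -
  have "(\<lambda>\<kappa>. enn2real (\<integral>\<^sup>+z. indicator {z. q (snd z) = fst z} (\<kappa>, z) \<partial>\<mu>\<^sub>0)) \<in> borel_measurable borel"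
    by measurable
  also have "(\<lambda>\<kappa>. enn2real (\<integral>\<^sup>+z. indicator {z. q (snd z) = fst z} (\<kappa>, z) \<partial>\<mu>\<^sub>0)) = cell"
  proof
    fix \<kappa>
    have "(\<integral>\<^sup>+z. indicator {z. q (snd z) = fst z} (\<kappa>, z) \<partial>\<mu>\<^sub>0) = (\<integral>\<^sup>+z. indicator {z. q z = \<kappa>} z \<partial>\<mu>\<^sub>0)"
      by (rule nn_integral_cong) (simp split: split_indicator)
    also have "\<dots> = ennreal (cell \<kappa>)"
      by (simp add: emeasure_cell)
    finally show "enn2real (\<integral>\<^sup>+z. indicator {z. q (snd z) = fst z} (\<kappa>, z) \<partial>\<mu>\<^sub>0) = cell \<kappa>"
      by (simp add: cell_def)
  qed
  finally show ?thesis .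
qed

text \<open>
  Every point of a cell is within \<open>2 \<surd>D\<close> of each other point, so on the cell of \<open>e\<close> the density
  is at least the exponential of minus a quadratic in \<open>e\<close>.
\<close>
lemma cell_lower: "vol * exp (- (C\<^sub>g * (1 + 8 * D + 2 * (norm e)\<^sup>2))) \<le> cell (q e)"
proof -
  let ?c = "exp (- (C\<^sub>g * (1 + 8 * D + 2 * (norm e)\<^sup>2)))"
  have low: "?c \<le> g z" if "q z = q e" for z
  proof -
    have "(norm (z - e))\<^sup>2 \<le> 2 * (norm (z - q z))\<^sup>2 + 2 * (norm (e - q e))\<^sup>2"
      using norm_diff_sq_le[of "z - q z" "e - q e"] that by simp
    also have "\<dots> \<le> 4 * D" using grid_close[of z] grid_close[of e] by simp
    finally have "(norm z)\<^sup>2 \<le> 2 * (norm e)\<^sup>2 + 8 * D"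
      using norm_add_sq_le[of e "z - e"] by simp
    then have "C\<^sub>g * (1 + (norm z)\<^sup>2) \<le> C\<^sub>g * (1 + 8 * D + 2 * (norm e)\<^sup>2)"
      by (intro mult_left_mono C_g_nonneg) simp
    then have "- (C\<^sub>g * (1 + 8 * D + 2 * (norm e)\<^sup>2)) \<le> ln (g z)"
      using ln_g[of z] by linarith
    then show ?thesis using g_pos[of z] by (simp add: ln_ge_iff)
  qed
  have "ennreal (vol * ?c) = ennreal ?c * ennreal vol"
    using vol_pos by (simp add: mult.commute flip: ennreal_mult)
  also have "\<dots> \<le> ennreal ?c * emeasure lborel {z. q z = q e}"
    by (intro mult_left_mono vol_le) simp
  also have "\<dots> = (\<integral>\<^sup>+z. ennreal ?c * indicator {z. q z = q e} z \<partial>lborel)"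
    by (subst nn_integral_cmult_indicator) auto
  also have "\<dots> \<le> (\<integral>\<^sup>+z. ennreal (g z) * indicator {z. q z = q e} z \<partial>lborel)"
    by (intro nn_integral_mono) (auto split: split_indicator intro!: ennreal_leI low)
  also have "\<dots> = emeasure \<mu>\<^sub>0 {z. q z = q e}"
    unfolding init_density by (subst emeasure_density) auto
  finally show ?thesis unfolding emeasure_cell by (simp add: cell_def)
qed

lemma cell_pos: "0 < cell (q e)"
  using less_le_trans[OF _ cell_lower] vol_pos by simp

text \<open>Translation invariance of Lebesgue measure, as a change of the initial law.\<close>
lemma nn_integral_init_shift:
  assumes [measurable]: "W \<in> borel_measurable borel"
  shows "(\<integral>\<^sup>+\<xi>. ennreal (g (\<xi> + r) / g \<xi>) * W (\<xi> + r) \<partial>\<mu>\<^sub>0) = (\<integral>\<^sup>+\<xi>. W \<xi> \<partial>\<mu>\<^sub>0)"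
proof -
  have "(\<integral>\<^sup>+\<xi>. ennreal (g (\<xi> + r) / g \<xi>) * W (\<xi> + r) \<partial>\<mu>\<^sub>0) =
      (\<integral>\<^sup>+\<xi>. ennreal (g (r + \<xi>)) * W (r + \<xi>) \<partial>lborel)"
    unfolding init_density using g_pos
    by (subst nn_integral_density)
       (auto intro!: nn_integral_cong simp: less_imp_le[OF g_pos] less_imp_neq[OF g_pos, symmetric] add.commute
          mult.assoc[symmetric] simp flip: ennreal_mult)
  also have "\<dots> = (\<integral>\<^sup>+\<xi>. ennreal (g \<xi>) * W \<xi> \<partial>distr lborel borel ((+) r))"
    by (subst nn_integral_distr) auto
  also have "\<dots> = (\<integral>\<^sup>+\<xi>. W \<xi> \<partial>\<mu>\<^sub>0)"
    unfolding init_density lborel_distr_plus by (subst nn_integral_density) auto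
  finally show ?thesis .
qed

definition decoded_source :: "nat \<Rightarrow> nat \<Rightarrow> (nat \<Rightarrow> real^'n) \<Rightarrow> real^'n \<Rightarrow> nat \<Rightarrow> real^'n" where
  "decoded_source a b u c = (\<lambda>i\<in>{..b}. u (Suc a + i) - drift i c)"

definition decoded_output :: "nat \<Rightarrow> nat \<Rightarrow> (nat \<Rightarrow> real^'n) \<Rightarrow> real^'n \<Rightarrow> real^'n \<Rightarrow> nat \<Rightarrow> real^'n" where
  "decoded_output a b y c v = (\<lambda>i\<in>{..b}. if i = 0 then v else y (Suc a + i) - drift i c)"

text \<open>
  The density of the pair of grid point and revealed vector \<open>c\<close>, given the error \<open>e\<close>, relative to
  the reference law. In truth the grid point is \<open>q e\<close> and \<open>e - c\<close> has density \<open>g\<close>; under the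
  reference law the grid point is \<open>\<kappa>\<close> with probability \<open>cell \<kappa>\<close> and \<open>\<kappa> - c\<close> has density \<open>g\<close>.
\<close>
definition restart_ratio :: "real^'n \<Rightarrow> real^'n \<Rightarrow> real^'n \<Rightarrow> real" where
  "restart_ratio e \<kappa> c = (if \<kappa> = q e then g (e - c) / (cell \<kappa> * g (\<kappa> - c)) else 0)"

definition restart_density ::
    "nat \<Rightarrow> nat \<Rightarrow> ((nat \<Rightarrow> real^'n) \<times> (nat \<Rightarrow> real^'n) \<Rightarrow> real) \<Rightarrow>
      ((nat \<Rightarrow> real^'n) \<times> (nat \<Rightarrow> real^'n) \<Rightarrow> real) \<Rightarrow>
      (nat \<Rightarrow> real^'n) \<times> (nat \<Rightarrow> real^'n) \<Rightarrow> real" where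
  "restart_density a b f\<^sub>1 f\<^sub>2 z =
    (let u = fst z; y = snd z; code = dec (y (Suc a) - A *v y a); c = fst (snd code) in
     f\<^sub>1 (restrict u {..a}, restrict y {..a}) *
     f\<^sub>2 (decoded_source a b u (A *v y a + c), decoded_output a b y (A *v y a + c) (snd (snd code))) *
     restart_ratio (u (Suc a) - A *v y a) (fst code) c)"

text \<open>
  Everything that the output consists of is drawn independently, and without knowledge of the
  source; the Gaussian vector \<open>c\<close> is centred at the grid point, the decoder's best guess of \<open>e\<close>.
\<close>
definition restart_reference ::
    "nat \<Rightarrow> nat \<Rightarrow> (nat \<Rightarrow> real^'n) measure \<Rightarrow> (nat \<Rightarrow> real^'n) measure \<Rightarrow> (nat \<Rightarrow> real^'n) measure" where
  "restart_reference a b Q\<^sub>1 Q\<^sub>2 =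
    distr (Q\<^sub>1 \<Otimes>\<^sub>M (Q\<^sub>2 \<Otimes>\<^sub>M (\<mu>\<^sub>0 \<Otimes>\<^sub>M \<mu>\<^sub>0))) (paths {..Suc (a + b)})
      (\<lambda>(y, y', \<xi>, e). assemble a b y y' (q e) (q e - \<xi>))"

lemma decoded_source_measurable [measurable (raw)]:
  assumes "f \<in> N \<rightarrow>\<^sub>M paths {..Suc (a + b)}" and [measurable]: "c \<in> borel_measurable N"
  shows "(\<lambda>z. decoded_source a b (f z) (c z)) \<in> N \<rightarrow>\<^sub>M paths {..b}"
  unfolding decoded_source_def
  by (intro measurable_restrict borel_measurable_diff component_measurable[OF assms(1)]) auto

lemma decoded_output_measurable [measurable (raw)]:
  assumes "f \<in> N \<rightarrow>\<^sub>M paths {..Suc (a + b)}" and [measurable]: "c \<in> borel_measurable N" "v \<in> borel_measurable N"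
  shows "(\<lambda>z. decoded_output a b (f z) (c z) (v z)) \<in> N \<rightarrow>\<^sub>M paths {..b}"
  unfolding decoded_output_def
proof (rule measurable_restrict)
  fix i assume "i \<in> {..b}"
  then have [measurable]: "(\<lambda>z. f z (Suc a + i)) \<in> borel_measurable N"
    by (intro component_measurable[OF assms(1)]) auto
  show "(\<lambda>z. if i = 0 then v z else f z (Suc a + i) - drift i (c z)) \<in> borel_measurable N"
    by (cases "i = 0") (simp_all del: add_Suc)
qed

lemma restart_ratio_measurable [measurable (raw)]:
  assumes [measurable]: "e \<in> borel_measurable N" "k \<in> borel_measurable N" "c \<in> borel_measurable N"
  shows "(\<lambda>z. restart_ratio (e z) (k z) (c z)) \<in> borel_measurable N"
  unfolding restart_ratio_def by measurable

lemma restart_density_measurable: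
  assumes [measurable]: "f\<^sub>1 \<in> borel_measurable (paths {..a} \<Otimes>\<^sub>M paths {..a})"
    "f\<^sub>2 \<in> borel_measurable (paths {..b} \<Otimes>\<^sub>M paths {..b})"
  shows "restart_density a b f\<^sub>1 f\<^sub>2 \<in> borel_measurable (paths {..Suc (a + b)} \<Otimes>\<^sub>M paths {..Suc (a + b)})"
proof -
  let ?N = "paths {..Suc (a + b)} \<Otimes>\<^sub>M paths {..Suc (a + b)} :: ((nat \<Rightarrow> real^'n) \<times> (nat \<Rightarrow> real^'n)) measure"
  have [measurable]: "(\<lambda>z. fst z (Suc a)) \<in> borel_measurable ?N"
      "(\<lambda>z. snd z (Suc a)) \<in> borel_measurable ?N" "(\<lambda>z. snd z a) \<in> borel_measurable ?N"
    by (simp_all add: fst_component_measurable snd_component_measurable)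
  have [measurable]: "(\<lambda>z. restrict (fst z) {..a}) \<in> ?N \<rightarrow>\<^sub>M paths {..a}"
    "(\<lambda>z. restrict (snd z) {..a}) \<in> ?N \<rightarrow>\<^sub>M paths {..a}"
    by (rule measurable_path_restrict[OF measurable_fst], simp)
       (rule measurable_path_restrict[OF measurable_snd], simp)
  show ?thesis
    unfolding restart_density_def Let_def by measurable
qed

lemma restart_density_nonneg:
  "(\<And>z. 0 \<le> f\<^sub>1 z) \<Longrightarrow> (\<And>z. 0 \<le> f\<^sub>2 z) \<Longrightarrow> 0 \<le> restart_density a b f\<^sub>1 f\<^sub>2 z"
  by (simp add: restart_density_def restart_ratio_def Let_def less_imp_le[OF g_pos] cell_def)

lemma restart_density_assemble:
  assumes "y \<in> space (paths {..a})" "y' \<in> space (paths {..b})"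
  shows "restart_density a b f\<^sub>1 f\<^sub>2 (u, assemble a b y y' (q e) c) =
    f\<^sub>1 (restrict u {..a}, y) * f\<^sub>2 (decoded_source a b u (A *v y a + c), y') *
    restart_ratio (u (Suc a) - A *v y a) (q e) c"
proof -
  let ?y = "assemble a b y y' (q e) c"
  have 1: "?y a = y a" "?y (Suc a) - A *v y a = q e + emb (c, y' 0)"
    by (simp_all add: assemble_def)
  have 2: "restrict ?y {..a} = y"
    using assms(1) by (auto simp: assemble_def space_PiM PiE_def extensional_def fun_eq_iff)
  have 3: "decoded_output a b ?y (A *v y a + c) (y' 0) = y'"
    using assms(2) by (auto simp: decoded_output_def assemble_def space_PiM PiE_def extensional_def fun_eq_iff)
  show ?thesis
    unfolding restart_density_def Let_def fst_conv snd_conv 1 2 dec_code 3 ..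
qed

lemma decoded_source_join:
  assumes "x' \<in> space (paths {..b})"
  shows "decoded_source a b (join_source a b u w x') (A *v u a + w - x' 0) = x'"
  using assms by (auto simp: decoded_source_def join_source_def space_PiM PiE_def extensional_def fun_eq_iff)

text \<open>
  Integrating out the reference grid point leaves the true one, with its probability cancelling
  \<open>cell\<close>; a shift by the rounding error \<open>r\<close> then turns the reference law of \<open>c\<close> into the true one.
\<close>
lemma collapse_restart_ratio:
  assumes y: "y \<in> space (paths {..a})" and y': "y' \<in> space (paths {..b})"
    and u: "u \<in> space (paths {..Suc (a + b)})"
    and f1: "\<And>z. 0 \<le> f\<^sub>1 z" and f2: "\<And>z. 0 \<le> f\<^sub>2 z"
    and [measurable]: "f\<^sub>2 \<in> borel_measurable (paths {..b} \<Otimes>\<^sub>M paths {..b})"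
    and h: "h \<in> borel_measurable (paths {..Suc (a + b)} \<Otimes>\<^sub>M paths {..Suc (a + b)})"
  shows "(\<integral>\<^sup>+\<xi>. \<integral>\<^sup>+e'. ennreal (restart_density a b f\<^sub>1 f\<^sub>2 (u, assemble a b y y' (q e') (q e' - \<xi>))) *
        h (u, assemble a b y y' (q e') (q e' - \<xi>)) \<partial>\<mu>\<^sub>0 \<partial>\<mu>\<^sub>0) =
    (\<integral>\<^sup>+\<xi>. ennreal (f\<^sub>1 (restrict u {..a}, y)) *
        (ennreal (f\<^sub>2 (decoded_source a b u (u (Suc a) - \<xi>), y')) *
         h (u, assemble a b y y' (q (u (Suc a) - A *v y a)) (u (Suc a) - A *v y a - \<xi>))) \<partial>\<mu>\<^sub>0)"
proof -
  define e where "e = u (Suc a) - A *v y a"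
  define r where "r = e - q e"
  define W where "W \<xi> = ennreal (f\<^sub>1 (restrict u {..a}, y)) *
        (ennreal (f\<^sub>2 (decoded_source a b u (u (Suc a) - \<xi>), y')) *
         h (u, assemble a b y y' (q e) (e - \<xi>)))" for \<xi>
  have "(\<lambda>\<xi>. (decoded_source a b u (u (Suc a) - \<xi>), y')) \<in> borel \<rightarrow>\<^sub>M paths {..b} \<Otimes>\<^sub>M paths {..b}"
    using y' by (intro measurable_Pair decoded_source_measurable measurable_const u) auto
  then have m2: "(\<lambda>\<xi>. f\<^sub>2 (decoded_source a b u (u (Suc a) - \<xi>), y')) \<in> borel_measurable borel"
    by (rule measurable_compose) fact
  have "(\<lambda>\<xi>. (u, assemble a b y y' (q e) (e - \<xi>))) \<in> borel \<rightarrow>\<^sub>M paths {..Suc (a + b)} \<Otimes>\<^sub>M paths {..Suc (a + b)}"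
    by (intro measurable_Pair assemble_measurable measurable_const u y y') auto
  from measurable_compose[OF this h] m2 have W [measurable]: "W \<in> borel_measurable borel"
    unfolding W_def by measurable
  have "(\<integral>\<^sup>+e'. ennreal (restart_density a b f\<^sub>1 f\<^sub>2 (u, assemble a b y y' (q e') (q e' - \<xi>))) *
        h (u, assemble a b y y' (q e') (q e' - \<xi>)) \<partial>\<mu>\<^sub>0) = ennreal (g (\<xi> + r) / g \<xi>) * W (\<xi> + r)" for \<xi>
  proof -
    have "A *v y a + (q e - \<xi>) = u (Suc a) - (\<xi> + r)" "q e - \<xi> = e - (\<xi> + r)" "e - (q e - \<xi>) = \<xi> + r"
      by (simp_all add: e_def r_def)
    note eqs = this
    have "(\<integral>\<^sup>+e'. ennreal (restart_density a b f\<^sub>1 f\<^sub>2 (u, assemble a b y y' (q e') (q e' - \<xi>))) *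
        h (u, assemble a b y y' (q e') (q e' - \<xi>)) \<partial>\<mu>\<^sub>0) =
      (\<integral>\<^sup>+e'. (ennreal (g (\<xi> + r) / (cell (q e) * g \<xi>)) * W (\<xi> + r)) * indicator {z. q z = q e} e' \<partial>\<mu>\<^sub>0)"
    proof (rule nn_integral_cong)
      fix e'
      show "ennreal (restart_density a b f\<^sub>1 f\<^sub>2 (u, assemble a b y y' (q e') (q e' - \<xi>))) *
        h (u, assemble a b y y' (q e') (q e' - \<xi>)) =
        (ennreal (g (\<xi> + r) / (cell (q e) * g \<xi>)) * W (\<xi> + r)) * indicator {z. q z = q e} e'"
      proof (cases "q e' = q e")
        case True
        define R where "R = g (\<xi> + r) / (cell (q e) * g \<xi>)"
        have R: "0 \<le> R"
          using cell_pos[of e] less_imp_le[OF g_pos] by (simp add: R_def)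
        have "restart_density a b f\<^sub>1 f\<^sub>2 (u, assemble a b y y' (q e) (q e - \<xi>)) =
          f\<^sub>1 (restrict u {..a}, y) * f\<^sub>2 (decoded_source a b u (u (Suc a) - (\<xi> + r)), y') * R"
          unfolding restart_density_assemble[OF y y'] eqs(1) restart_ratio_def e_def[symmetric] eqs(3) R_def
          by simp
        then have "ennreal (restart_density a b f\<^sub>1 f\<^sub>2 (u, assemble a b y y' (q e) (q e - \<xi>))) =
          ennreal (f\<^sub>1 (restrict u {..a}, y)) *
          ennreal (f\<^sub>2 (decoded_source a b u (u (Suc a) - (\<xi> + r)), y')) * ennreal R"
          using R f1 f2 by (simp add: ennreal_mult)
        then show ?thesis
          unfolding R_def[symmetric] W_def True eqs(2)[symmetric] by (simp add: True mult_ac)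
      next
        case False
        then show ?thesis
          by (simp add: restart_density_assemble[OF y y'] restart_ratio_def e_def)
      qed
    qed
    also have "\<dots> = (ennreal (g (\<xi> + r) / (cell (q e) * g \<xi>)) * W (\<xi> + r)) * ennreal (cell (q e))"
      by (subst nn_integral_cmult_indicator) (auto simp: emeasure_cell)
    also have "\<dots> = (ennreal (g (\<xi> + r) / (cell (q e) * g \<xi>)) * ennreal (cell (q e))) * W (\<xi> + r)"
      by (simp add: mult_ac)
    also have "ennreal (g (\<xi> + r) / (cell (q e) * g \<xi>)) * ennreal (cell (q e)) = ennreal (g (\<xi> + r) / g \<xi>)"
      using cell_pos[of e] less_imp_le[OF g_pos] by (simp flip: ennreal_mult)
    finally show ?thesis .
  qed
  then have "(\<integral>\<^sup>+\<xi>. \<integral>\<^sup>+e'. ennreal (restart_density a b f\<^sub>1 f\<^sub>2 (u, assemble a b y y' (q e') (q e' - \<xi>))) *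
        h (u, assemble a b y y' (q e') (q e' - \<xi>)) \<partial>\<mu>\<^sub>0 \<partial>\<mu>\<^sub>0) =
     (\<integral>\<^sup>+\<xi>. ennreal (g (\<xi> + r) / g \<xi>) * W (\<xi> + r) \<partial>\<mu>\<^sub>0)" by simp
  also have "\<dots> = (\<integral>\<^sup>+\<xi>. W \<xi> \<partial>\<mu>\<^sub>0)" by (rule nn_integral_init_shift[OF W])
  finally show ?thesis unfolding W_def e_def .
qed

text \<open>
  Both sides are brought to the form: first the source path, then the reference outputs of the
  two blocks, then \<open>\<xi>\<close>. For the joint law this uses \<open>nn_integral_source_join\<close>, for the
  density \<open>collapse_restart_ratio\<close>.
\<close>
lemma joint_restart_density:
  assumes K: "\<And>t. t \<le> a \<Longrightarrow> stochastic_kernel K t" and K': "\<And>t. t \<le> b \<Longrightarrow> stochastic_kernel K' t"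
    and Q1: "prob_space Q\<^sub>1" "sets Q\<^sub>1 = sets (paths {..a})"
    and Q2: "prob_space Q\<^sub>2" "sets Q\<^sub>2 = sets (paths {..b})"
    and f1 [measurable]: "f\<^sub>1 \<in> borel_measurable (paths {..a} \<Otimes>\<^sub>M paths {..a})" and f1_nn: "\<And>z. 0 \<le> f\<^sub>1 z"
    and f2 [measurable]: "f\<^sub>2 \<in> borel_measurable (paths {..b} \<Otimes>\<^sub>M paths {..b})" and f2_nn: "\<And>z. 0 \<le> f\<^sub>2 z"
    and J1: "J K a = density (S a \<Otimes>\<^sub>M Q\<^sub>1) (\<lambda>z. ennreal (f\<^sub>1 z))"
    and J2: "J K' b = density (S b \<Otimes>\<^sub>M Q\<^sub>2) (\<lambda>z. ennreal (f\<^sub>2 z))"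
  shows "J (restart_kernel a K K') (Suc (a + b)) =
    density (S (Suc (a + b)) \<Otimes>\<^sub>M restart_reference a b Q\<^sub>1 Q\<^sub>2) (\<lambda>z. ennreal (restart_density a b f\<^sub>1 f\<^sub>2 z))"
    (is "?P = density (?S \<Otimes>\<^sub>M ?Q) ?f")
proof (rule measure_eqI)
  let ?n = "Suc (a + b)"
  let ?PP = "paths {..?n} \<Otimes>\<^sub>M paths {..?n} :: ((nat \<Rightarrow> real^'n) \<times> (nat \<Rightarrow> real^'n)) measure"
  have sP: "sets ?P = sets ?PP"
    by (rule sets_joint, rule stochastic_restart_kernel[where b = b]) (use K K' in auto)
  note [measurable_cong] = Q1(2) Q2(2)
  interpret Q1: prob_space Q\<^sub>1 by fact
  interpret Q2: prob_space Q\<^sub>2 by fact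
  interpret Sa: prob_space "S a" by (rule prob_source)
  interpret Sb: prob_space "S b" by (rule prob_source)
  interpret Sn: prob_space "S ?n" by (rule prob_source)
  have spQ: "space Q\<^sub>1 = space (paths {..a})" "space Q\<^sub>2 = space (paths {..b})"
    using sets_eq_imp_space_eq[OF Q1(2)] sets_eq_imp_space_eq[OF Q2(2)] by auto
  have pQQ: "prob_space (Q\<^sub>1 \<Otimes>\<^sub>M (Q\<^sub>2 \<Otimes>\<^sub>M (\<mu>\<^sub>0 \<Otimes>\<^sub>M \<mu>\<^sub>0)))"
    by (intro prob_space_pair Q1(1) Q2(1) prob_init)
  have asm_m [measurable]: "(\<lambda>(y, y', \<xi>, e). assemble a b y y' (q e) (q e - \<xi>))
      \<in> Q\<^sub>1 \<Otimes>\<^sub>M (Q\<^sub>2 \<Otimes>\<^sub>M (\<mu>\<^sub>0 \<Otimes>\<^sub>M \<mu>\<^sub>0)) \<rightarrow>\<^sub>M paths {..?n}"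
    unfolding case_prod_beta' by measurable
  have pQ: "prob_space ?Q"
    unfolding restart_reference_def by (rule prob_space.prob_space_distr[OF pQQ asm_m])
  interpret Q: prob_space ?Q by (rule pQ)
  have sQ [measurable_cong]: "sets ?Q = sets (paths {..?n})" by (simp add: restart_reference_def)
  have sSQ: "sets (?S \<Otimes>\<^sub>M ?Q) = sets ?PP"
    by (intro sets_pair_measure_cong sQ sets_source)
  show "sets ?P = sets (density (?S \<Otimes>\<^sub>M ?Q) ?f)" using sP sSQ by simp
  have dm [measurable]: "restart_density a b f\<^sub>1 f\<^sub>2 \<in> borel_measurable ?PP"
    by (rule restart_density_measurable[OF f1 f2])
  fix X assume "X \<in> sets ?P"
  then have X [measurable]: "X \<in> sets ?PP" by (simp add: sP)
  define h :: "(nat \<Rightarrow> real^'n) \<times> (nat \<Rightarrow> real^'n) \<Rightarrow> ennreal" where "h = indicator X"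
  have h [measurable]: "h \<in> borel_measurable ?PP" unfolding h_def by measurable
  \<comment> \<open>the common integrand, in the coordinates (past outputs, new outputs, source path, \<open>\<xi>\<close>)\<close>
  define F where "F y y' u \<xi> = ennreal (f\<^sub>1 (restrict u {..a}, y)) *
        (ennreal (f\<^sub>2 (decoded_source a b u (u (Suc a) - \<xi>), y')) *
         h (u, assemble a b y y' (q (u (Suc a) - A *v y a)) (u (Suc a) - A *v y a - \<xi>)))"
    for y y' u \<xi>
  have F [measurable (raw)]: "(\<lambda>z. F (fy z) (fy' z) (fu z) (f\<xi> z)) \<in> borel_measurable N"
    if [measurable]: "fy \<in> N \<rightarrow>\<^sub>M paths {..a}" "fy' \<in> N \<rightarrow>\<^sub>M paths {..b}" "fu \<in> N \<rightarrow>\<^sub>M paths {..?n}"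
      "f\<xi> \<in> borel_measurable N" for fy fy' fu f\<xi> and N :: "'c measure"
  proof -
    note [measurable] = component_measurable[OF that(1), of a, simplified]
      component_measurable[OF that(3), of "Suc a", simplified]
    have [measurable]: "(\<lambda>z. restrict (fu z) {..a}) \<in> N \<rightarrow>\<^sub>M paths {..a}"
      by (rule measurable_path_restrict[OF that(3)]) simp
    show ?thesis unfolding F_def by measurable
  qed
  \<comment> \<open>the same integrand, in the coordinates of the independent inputs\<close>
  define T where "T u y w x' y' = ennreal (f\<^sub>1 (u, y)) * (ennreal (f\<^sub>2 (x', y')) *
      h (join_source a b u w x', join_output a b u y w x' y'))" for u y w x' y'
  have T [measurable (raw)]: "(\<lambda>z. T (fu z) (fy z) (fw z) (fx z) (fy' z)) \<in> borel_measurable N"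
    if [measurable]: "fu \<in> N \<rightarrow>\<^sub>M paths {..a}" "fy \<in> N \<rightarrow>\<^sub>M paths {..a}" "fw \<in> borel_measurable N"
      "fx \<in> N \<rightarrow>\<^sub>M paths {..b}" "fy' \<in> N \<rightarrow>\<^sub>M paths {..b}" for fu fy fw fx fy' and N :: "'c measure"
    unfolding T_def by measurable
  have T_F: "T u y w x' y' = F y y' (join_source a b u w x') (x' 0)"
    if "u \<in> space (paths {..a})" "x' \<in> space (paths {..b})" for u y w x' y'
  proof -
    have 1: "restrict (join_source a b u w x') {..a} = u"
      using that(1) by (auto simp: join_source_def space_PiM PiE_def extensional_def fun_eq_iff)
    have 2: "join_source a b u w x' (Suc a) = A *v u a + w"
      by (simp add: join_source_def)
    show ?thesis
      unfolding T_def F_def 1 2 decoded_source_join[OF that(2)] join_output_def ..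
  qed
  have "emeasure ?P X = (\<integral>\<^sup>+z. h z \<partial>?P)" using X sP by (simp add: h_def)
  also have "\<dots> = (\<integral>\<^sup>+z. \<integral>\<^sup>+w. \<integral>\<^sup>+z'. h (join_source a b (fst z) w (fst z'),
      join_output a b (fst z) (snd z) w (fst z') (snd z')) \<partial>J K' b \<partial>\<mu>\<^sub>w \<partial>J K a)"
    by (rule joint_restart[OF K K' order_refl h])
  also have "\<dots> = (\<integral>\<^sup>+u. \<integral>\<^sup>+y. \<integral>\<^sup>+w. \<integral>\<^sup>+x'. \<integral>\<^sup>+y'. T u y w x' y' \<partial>Q\<^sub>2 \<partial>S b \<partial>\<mu>\<^sub>w \<partial>Q\<^sub>1 \<partial>S a)"
  proof -
    define B where "B u y w = (\<integral>\<^sup>+z'. ennreal (f\<^sub>2 z') * h (join_source a b u w (fst z'),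
        join_output a b u y w (fst z') (snd z')) \<partial>(S b \<Otimes>\<^sub>M Q\<^sub>2))" for u y w
    interpret SQ2: prob_space "S b \<Otimes>\<^sub>M Q\<^sub>2" by (intro prob_space_pair prob_source Q2(1))
    have B [measurable (raw)]: "(\<lambda>z. B (fu z) (fy z) (fw z)) \<in> borel_measurable N"
      if [measurable]: "fu \<in> N \<rightarrow>\<^sub>M paths {..a}" "fy \<in> N \<rightarrow>\<^sub>M paths {..a}" "fw \<in> borel_measurable N"
      for fu fy fw and N :: "'c measure"
      unfolding B_def by measurable
    have "(\<integral>\<^sup>+z. \<integral>\<^sup>+w. \<integral>\<^sup>+z'. h (join_source a b (fst z) w (fst z'),
        join_output a b (fst z) (snd z) w (fst z') (snd z')) \<partial>J K' b \<partial>\<mu>\<^sub>w \<partial>J K a) =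
      (\<integral>\<^sup>+z. \<integral>\<^sup>+w. B (fst z) (snd z) w \<partial>\<mu>\<^sub>w \<partial>J K a)"
    proof (rule nn_integral_cong)+
      fix z w assume "z \<in> space (J K a)"
      then have z: "fst z \<in> space (paths {..a})" "snd z \<in> space (paths {..a})"
        using sets_eq_imp_space_eq[OF sets_joint[OF K]] by (auto simp: space_pair_measure)
      have "(\<lambda>z'. (join_source a b (fst z) w (fst z'), join_output a b (fst z) (snd z) w (fst z') (snd z')))
        \<in> S b \<Otimes>\<^sub>M Q\<^sub>2 \<rightarrow>\<^sub>M ?PP"
        by (intro measurable_Pair join_source_measurable join_output_measurable measurable_const z) measurable
      from measurable_compose[OF this h]
      show "(\<integral>\<^sup>+z'. h (join_source a b (fst z) w (fst z'),
        join_output a b (fst z) (snd z) w (fst z') (snd z')) \<partial>J K' b) = B (fst z) (snd z) w"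
        unfolding J2 B_def by (subst nn_integral_density) simp_all
    qed
    also have "\<dots> = (\<integral>\<^sup>+z. ennreal (f\<^sub>1 z) * (\<integral>\<^sup>+w. B (fst z) (snd z) w \<partial>\<mu>\<^sub>w) \<partial>(S a \<Otimes>\<^sub>M Q\<^sub>1))"
      unfolding J1 by (subst nn_integral_density) measurable
    also have "\<dots> = (\<integral>\<^sup>+u. \<integral>\<^sup>+y. ennreal (f\<^sub>1 (u, y)) * (\<integral>\<^sup>+w. B u y w \<partial>\<mu>\<^sub>w) \<partial>Q\<^sub>1 \<partial>S a)"
    proof -
      have "(\<lambda>z. \<integral>\<^sup>+w. B (fst z) (snd z) w \<partial>\<mu>\<^sub>w) \<in> borel_measurable (S a \<Otimes>\<^sub>M Q\<^sub>1)"
        by (rule noise.borel_measurable_nn_integral) (unfold case_prod_beta', measurable)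
      then have "(\<lambda>z. ennreal (f\<^sub>1 z) * (\<integral>\<^sup>+w. B (fst z) (snd z) w \<partial>\<mu>\<^sub>w)) \<in> borel_measurable (S a \<Otimes>\<^sub>M Q\<^sub>1)"
        by measurable
      from Q1.nn_integral_fst[OF this] show ?thesis by simp
    qed
    also have "\<dots> = (\<integral>\<^sup>+u. \<integral>\<^sup>+y. \<integral>\<^sup>+w. \<integral>\<^sup>+x'. \<integral>\<^sup>+y'. T u y w x' y' \<partial>Q\<^sub>2 \<partial>S b \<partial>\<mu>\<^sub>w \<partial>Q\<^sub>1 \<partial>S a)"
    proof (rule nn_integral_cong)+
      fix u y assume "u \<in> space (S a)" "y \<in> space Q\<^sub>1"
      then have u [measurable]: "u \<in> space (paths {..a})" and y [measurable]: "y \<in> space (paths {..a})" by (simp_all add: spQ)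
      have "ennreal (f\<^sub>1 (u, y)) * (\<integral>\<^sup>+w. B u y w \<partial>\<mu>\<^sub>w) = (\<integral>\<^sup>+w. ennreal (f\<^sub>1 (u, y)) * B u y w \<partial>\<mu>\<^sub>w)"
        by (rule nn_integral_cmult[symmetric]) (intro B measurable_const u y, measurable)
      also have "\<dots> = (\<integral>\<^sup>+w. \<integral>\<^sup>+x'. \<integral>\<^sup>+y'. T u y w x' y' \<partial>Q\<^sub>2 \<partial>S b \<partial>\<mu>\<^sub>w)"
      proof (rule nn_integral_cong)
        fix w
        have "(\<lambda>z'. (join_source a b u w (fst z'), join_output a b u y w (fst z') (snd z')))
          \<in> S b \<Otimes>\<^sub>M Q\<^sub>2 \<rightarrow>\<^sub>M ?PP"
          by (intro measurable_Pair join_source_measurable join_output_measurable measurable_const u y) measurable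
        from measurable_compose[OF this h]
        have [measurable]: "(\<lambda>z'. h (join_source a b u w (fst z'), join_output a b u y w (fst z') (snd z')))
          \<in> borel_measurable (S b \<Otimes>\<^sub>M Q\<^sub>2)" .
        have "ennreal (f\<^sub>1 (u, y)) * B u y w =
          (\<integral>\<^sup>+z'. T u y w (fst z') (snd z') \<partial>(S b \<Otimes>\<^sub>M Q\<^sub>2))"
          unfolding B_def T_def prod.collapse by (rule nn_integral_cmult[symmetric]) measurable
        also have "\<dots> = (\<integral>\<^sup>+x'. \<integral>\<^sup>+y'. T u y w x' y' \<partial>Q\<^sub>2 \<partial>S b)"
        proof -
          have "(\<lambda>z'. T u y w (fst z') (snd z')) \<in> borel_measurable (S b \<Otimes>\<^sub>M Q\<^sub>2)"
            by (rule T[OF measurable_const[OF u] measurable_const[OF y]]) measurable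
          from Q2.nn_integral_fst[OF this] show ?thesis by simp
        qed
        finally show "ennreal (f\<^sub>1 (u, y)) * B u y w = (\<integral>\<^sup>+x'. \<integral>\<^sup>+y'. T u y w x' y' \<partial>Q\<^sub>2 \<partial>S b)" .
      qed
      finally show "ennreal (f\<^sub>1 (u, y)) * (\<integral>\<^sup>+w. B u y w \<partial>\<mu>\<^sub>w) =
        (\<integral>\<^sup>+w. \<integral>\<^sup>+x'. \<integral>\<^sup>+y'. T u y w x' y' \<partial>Q\<^sub>2 \<partial>S b \<partial>\<mu>\<^sub>w)" .
    qed
    finally show ?thesis .
  qed
  also have "\<dots> = (\<integral>\<^sup>+y. \<integral>\<^sup>+u. \<integral>\<^sup>+w. \<integral>\<^sup>+x'. \<integral>\<^sup>+y'. T u y w x' y' \<partial>Q\<^sub>2 \<partial>S b \<partial>\<mu>\<^sub>w \<partial>S a \<partial>Q\<^sub>1)"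
    by (rule nn_integral_swap[OF prob_source Q1(1)]) measurable
  also have "\<dots> = (\<integral>\<^sup>+y. \<integral>\<^sup>+y'. \<integral>\<^sup>+u. \<integral>\<^sup>+\<xi>. F y y' u \<xi> \<partial>\<mu>\<^sub>0 \<partial>S ?n \<partial>Q\<^sub>2 \<partial>Q\<^sub>1)"
  proof (rule nn_integral_cong)
    fix y assume "y \<in> space Q\<^sub>1"
    then have y: "y \<in> space (paths {..a})" by (simp add: spQ)
    have "(\<integral>\<^sup>+u. \<integral>\<^sup>+w. \<integral>\<^sup>+x'. \<integral>\<^sup>+y'. T u y w x' y' \<partial>Q\<^sub>2 \<partial>S b \<partial>\<mu>\<^sub>w \<partial>S a) =
      (\<integral>\<^sup>+u. \<integral>\<^sup>+w. \<integral>\<^sup>+y'. \<integral>\<^sup>+x'. T u y w x' y' \<partial>S b \<partial>Q\<^sub>2 \<partial>\<mu>\<^sub>w \<partial>S a)"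
    proof (rule nn_integral_cong)+
      fix u w assume "u \<in> space (S a)"
      then have u: "u \<in> space (paths {..a})" by simp
      show "(\<integral>\<^sup>+x'. \<integral>\<^sup>+y'. T u y w x' y' \<partial>Q\<^sub>2 \<partial>S b) = (\<integral>\<^sup>+y'. \<integral>\<^sup>+x'. T u y w x' y' \<partial>S b \<partial>Q\<^sub>2)"
        by (rule nn_integral_swap[OF prob_source Q2(1)]) (intro T measurable_const u y, measurable)
    qed
    also have "\<dots> = (\<integral>\<^sup>+u. \<integral>\<^sup>+y'. \<integral>\<^sup>+w. \<integral>\<^sup>+x'. T u y w x' y' \<partial>S b \<partial>\<mu>\<^sub>w \<partial>Q\<^sub>2 \<partial>S a)"
    proof (rule nn_integral_cong)
      fix u assume "u \<in> space (S a)"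
      then have u: "u \<in> space (paths {..a})" by simp
      show "(\<integral>\<^sup>+w. \<integral>\<^sup>+y'. \<integral>\<^sup>+x'. T u y w x' y' \<partial>S b \<partial>Q\<^sub>2 \<partial>\<mu>\<^sub>w) = (\<integral>\<^sup>+y'. \<integral>\<^sup>+w. \<integral>\<^sup>+x'. T u y w x' y' \<partial>S b \<partial>\<mu>\<^sub>w \<partial>Q\<^sub>2)"
        by (rule nn_integral_swap[OF prob_noise Q2(1)], rule Sb.borel_measurable_nn_integral,
            unfold case_prod_beta', intro T measurable_const u y) measurable
    qed
    also have "\<dots> = (\<integral>\<^sup>+y'. \<integral>\<^sup>+u. \<integral>\<^sup>+w. \<integral>\<^sup>+x'. T u y w x' y' \<partial>S b \<partial>\<mu>\<^sub>w \<partial>S a \<partial>Q\<^sub>2)"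
      by (rule nn_integral_swap[OF prob_source Q2(1)], rule noise.borel_measurable_nn_integral,
          unfold case_prod_beta', rule Sb.borel_measurable_nn_integral,
          unfold case_prod_beta', intro T measurable_const y) measurable
    also have "\<dots> = (\<integral>\<^sup>+y'. \<integral>\<^sup>+u. \<integral>\<^sup>+\<xi>. F y y' u \<xi> \<partial>\<mu>\<^sub>0 \<partial>S ?n \<partial>Q\<^sub>2)"
    proof (rule nn_integral_cong)
      fix y' assume "y' \<in> space Q\<^sub>2"
      then have y': "y' \<in> space (paths {..b})" by (simp add: spQ)
      have "(\<integral>\<^sup>+u. \<integral>\<^sup>+w. \<integral>\<^sup>+x'. T u y w x' y' \<partial>S b \<partial>\<mu>\<^sub>w \<partial>S a) =
        (\<integral>\<^sup>+u. \<integral>\<^sup>+w. \<integral>\<^sup>+x'. F y y' (join_source a b u w x') (x' 0) \<partial>S b \<partial>\<mu>\<^sub>w \<partial>S a)"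
        by (intro nn_integral_cong T_F) simp_all
      also have "\<dots> = (\<integral>\<^sup>+u. \<integral>\<^sup>+\<xi>. F y y' u \<xi> \<partial>\<mu>\<^sub>0 \<partial>S ?n)"
        using nn_integral_source_join[of "\<lambda>z. F y y' (fst z) (snd z)" a b]
          F[OF measurable_const[OF y] measurable_const[OF y'] measurable_fst measurable_snd]
        by simp
      finally show "(\<integral>\<^sup>+u. \<integral>\<^sup>+w. \<integral>\<^sup>+x'. T u y w x' y' \<partial>S b \<partial>\<mu>\<^sub>w \<partial>S a) = (\<integral>\<^sup>+u. \<integral>\<^sup>+\<xi>. F y y' u \<xi> \<partial>\<mu>\<^sub>0 \<partial>S ?n)" .
    qed
    finally show "(\<integral>\<^sup>+u. \<integral>\<^sup>+w. \<integral>\<^sup>+x'. \<integral>\<^sup>+y'. T u y w x' y' \<partial>Q\<^sub>2 \<partial>S b \<partial>\<mu>\<^sub>w \<partial>S a) =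
      (\<integral>\<^sup>+y'. \<integral>\<^sup>+u. \<integral>\<^sup>+\<xi>. F y y' u \<xi> \<partial>\<mu>\<^sub>0 \<partial>S ?n \<partial>Q\<^sub>2)" .
  qed
  also have "\<dots> = (\<integral>\<^sup>+y. \<integral>\<^sup>+u. \<integral>\<^sup>+y'. \<integral>\<^sup>+\<xi>. F y y' u \<xi> \<partial>\<mu>\<^sub>0 \<partial>Q\<^sub>2 \<partial>S ?n \<partial>Q\<^sub>1)"
  proof (rule nn_integral_cong)
    fix y assume "y \<in> space Q\<^sub>1"
    then have y: "y \<in> space (paths {..a})" by (simp add: spQ)
    show "(\<integral>\<^sup>+y'. \<integral>\<^sup>+u. \<integral>\<^sup>+\<xi>. F y y' u \<xi> \<partial>\<mu>\<^sub>0 \<partial>S ?n \<partial>Q\<^sub>2) = (\<integral>\<^sup>+u. \<integral>\<^sup>+y'. \<integral>\<^sup>+\<xi>. F y y' u \<xi> \<partial>\<mu>\<^sub>0 \<partial>Q\<^sub>2 \<partial>S ?n)"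
      by (rule nn_integral_swap[OF Q2(1) prob_source], rule init.borel_measurable_nn_integral,
          unfold case_prod_beta', intro F measurable_const y) measurable
  qed
  also have "\<dots> = (\<integral>\<^sup>+u. \<integral>\<^sup>+y. \<integral>\<^sup>+y'. \<integral>\<^sup>+\<xi>. F y y' u \<xi> \<partial>\<mu>\<^sub>0 \<partial>Q\<^sub>2 \<partial>Q\<^sub>1 \<partial>S ?n)"
    by (rule nn_integral_swap[OF Q1(1) prob_source]) measurable
  also have "\<dots> = (\<integral>\<^sup>+u. \<integral>\<^sup>+y. ennreal (restart_density a b f\<^sub>1 f\<^sub>2 (u, y)) * h (u, y) \<partial>?Q \<partial>S ?n)"
  proof (rule nn_integral_cong)
    fix u assume "u \<in> space (S ?n)"
    then have u: "u \<in> space (paths {..?n})" by simp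
    have m: "(\<lambda>y. ennreal (restart_density a b f\<^sub>1 f\<^sub>2 (u, y)) * h (u, y)) \<in> borel_measurable (paths {..?n})"
      using measurable_compose[OF measurable_Pair1'[OF u] dm] measurable_compose[OF measurable_Pair1'[OF u] h]
      by measurable
    let ?G = "\<lambda>y y' \<xi> e. ennreal (restart_density a b f\<^sub>1 f\<^sub>2 (u, assemble a b y y' (q e) (q e - \<xi>))) *
          h (u, assemble a b y y' (q e) (q e - \<xi>))"
    have G: "(\<lambda>z. ?G (fy z) (fy' z) (f\<xi> z) (fe z)) \<in> borel_measurable N"
      if [measurable]: "fy \<in> N \<rightarrow>\<^sub>M paths {..a}" "fy' \<in> N \<rightarrow>\<^sub>M paths {..b}" "fe \<in> borel_measurable N"
        "f\<xi> \<in> borel_measurable N" for fy fy' fe f\<xi> and N :: "'c measure"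
      by (rule measurable_compose[OF _ m]) measurable
    interpret p1: prob_space "\<mu>\<^sub>0 \<Otimes>\<^sub>M \<mu>\<^sub>0" by (intro prob_space_pair prob_init)
    interpret p2: prob_space "Q\<^sub>2 \<Otimes>\<^sub>M (\<mu>\<^sub>0 \<Otimes>\<^sub>M \<mu>\<^sub>0)" by (intro prob_space_pair prob_init Q2(1))
    have "(\<integral>\<^sup>+y. ennreal (restart_density a b f\<^sub>1 f\<^sub>2 (u, y)) * h (u, y) \<partial>?Q) =
      (\<integral>\<^sup>+z. ?G (fst z) (fst (snd z)) (fst (snd (snd z))) (snd (snd (snd z))) \<partial>(Q\<^sub>1 \<Otimes>\<^sub>M (Q\<^sub>2 \<Otimes>\<^sub>M (\<mu>\<^sub>0 \<Otimes>\<^sub>M \<mu>\<^sub>0))))"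
    proof -
      have "(\<lambda>y. ennreal (restart_density a b f\<^sub>1 f\<^sub>2 (u, y)) * h (u, y)) \<in>
        borel_measurable (distr (Q\<^sub>1 \<Otimes>\<^sub>M (Q\<^sub>2 \<Otimes>\<^sub>M (\<mu>\<^sub>0 \<Otimes>\<^sub>M \<mu>\<^sub>0))) (paths {..?n})
          (\<lambda>(y, y', \<xi>, e). assemble a b y y' (q e) (q e - \<xi>)))"
        using m by simp
      from nn_integral_distr[OF asm_m this] show ?thesis
        by (simp add: restart_reference_def case_prod_beta')
    qed
    also have "\<dots> = (\<integral>\<^sup>+y. \<integral>\<^sup>+z. ?G y (fst z) (fst (snd z)) (snd (snd z)) \<partial>(Q\<^sub>2 \<Otimes>\<^sub>M (\<mu>\<^sub>0 \<Otimes>\<^sub>M \<mu>\<^sub>0)) \<partial>Q\<^sub>1)"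
    proof -
      have "(\<lambda>z. ?G (fst z) (fst (snd z)) (fst (snd (snd z))) (snd (snd (snd z))))
          \<in> borel_measurable (Q\<^sub>1 \<Otimes>\<^sub>M (Q\<^sub>2 \<Otimes>\<^sub>M (\<mu>\<^sub>0 \<Otimes>\<^sub>M \<mu>\<^sub>0)))"
        by (rule G) measurable
      from p2.nn_integral_fst[OF this] show ?thesis by simp
    qed
    also have "\<dots> = (\<integral>\<^sup>+y. \<integral>\<^sup>+y'. \<integral>\<^sup>+\<xi>. F y y' u \<xi> \<partial>\<mu>\<^sub>0 \<partial>Q\<^sub>2 \<partial>Q\<^sub>1)"
    proof (rule nn_integral_cong)
      fix y assume "y \<in> space Q\<^sub>1"
      then have y: "y \<in> space (paths {..a})" by (simp add: spQ)
      have "(\<integral>\<^sup>+z. ?G y (fst z) (fst (snd z)) (snd (snd z)) \<partial>(Q\<^sub>2 \<Otimes>\<^sub>M (\<mu>\<^sub>0 \<Otimes>\<^sub>M \<mu>\<^sub>0))) =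
        (\<integral>\<^sup>+y'. \<integral>\<^sup>+z. ?G y y' (fst z) (snd z) \<partial>(\<mu>\<^sub>0 \<Otimes>\<^sub>M \<mu>\<^sub>0) \<partial>Q\<^sub>2)"
      proof -
        have "(\<lambda>z. ?G y (fst z) (fst (snd z)) (snd (snd z))) \<in> borel_measurable (Q\<^sub>2 \<Otimes>\<^sub>M (\<mu>\<^sub>0 \<Otimes>\<^sub>M \<mu>\<^sub>0))"
          by (rule G[OF measurable_const[OF y]]) measurable
        from p1.nn_integral_fst[OF this] show ?thesis by simp
      qed
      also have "\<dots> = (\<integral>\<^sup>+y'. \<integral>\<^sup>+\<xi>. F y y' u \<xi> \<partial>\<mu>\<^sub>0 \<partial>Q\<^sub>2)"
      proof (rule nn_integral_cong)
        fix y' assume "y' \<in> space Q\<^sub>2"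
        then have y': "y' \<in> space (paths {..b})" by (simp add: spQ)
        have "(\<integral>\<^sup>+z. ?G y y' (fst z) (snd z) \<partial>(\<mu>\<^sub>0 \<Otimes>\<^sub>M \<mu>\<^sub>0)) = (\<integral>\<^sup>+\<xi>. \<integral>\<^sup>+e. ?G y y' \<xi> e \<partial>\<mu>\<^sub>0 \<partial>\<mu>\<^sub>0)"
        proof -
          have "(\<lambda>z. ?G y y' (fst z) (snd z)) \<in> borel_measurable (\<mu>\<^sub>0 \<Otimes>\<^sub>M \<mu>\<^sub>0)"
            by (rule G[OF measurable_const[OF y] measurable_const[OF y']]) measurable
          from init.nn_integral_fst[OF this] show ?thesis by simp
        qed
        also have "\<dots> = (\<integral>\<^sup>+\<xi>. F y y' u \<xi> \<partial>\<mu>\<^sub>0)"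
          unfolding F_def by (rule collapse_restart_ratio[OF y y' u f1_nn f2_nn f2 h])
        finally show "(\<integral>\<^sup>+z. ?G y y' (fst z) (snd z) \<partial>(\<mu>\<^sub>0 \<Otimes>\<^sub>M \<mu>\<^sub>0)) = (\<integral>\<^sup>+\<xi>. F y y' u \<xi> \<partial>\<mu>\<^sub>0)" .
      qed
      finally show "(\<integral>\<^sup>+z. ?G y (fst z) (fst (snd z)) (snd (snd z)) \<partial>(Q\<^sub>2 \<Otimes>\<^sub>M (\<mu>\<^sub>0 \<Otimes>\<^sub>M \<mu>\<^sub>0))) =
        (\<integral>\<^sup>+y'. \<integral>\<^sup>+\<xi>. F y y' u \<xi> \<partial>\<mu>\<^sub>0 \<partial>Q\<^sub>2)" .
    qed
    finally show "(\<integral>\<^sup>+y. \<integral>\<^sup>+y'. \<integral>\<^sup>+\<xi>. F y y' u \<xi> \<partial>\<mu>\<^sub>0 \<partial>Q\<^sub>2 \<partial>Q\<^sub>1) =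
      (\<integral>\<^sup>+y. ennreal (restart_density a b f\<^sub>1 f\<^sub>2 (u, y)) * h (u, y) \<partial>?Q)" ..
  qed
  also have "\<dots> = (\<integral>\<^sup>+z. ennreal (restart_density a b f\<^sub>1 f\<^sub>2 z) * h z \<partial>(?S \<Otimes>\<^sub>M ?Q))"
  proof -
    have "(\<lambda>z. ennreal (restart_density a b f\<^sub>1 f\<^sub>2 z) * h z) \<in> borel_measurable (?S \<Otimes>\<^sub>M ?Q)"
      using dm h sSQ by (simp cong: measurable_cong_sets)
    from Q.nn_integral_fst[OF this] show ?thesis by simp
  qed
  also have "\<dots> = emeasure (density (?S \<Otimes>\<^sub>M ?Q) ?f) X"
    unfolding h_def using X sSQ by (subst emeasure_density) auto
  finally show "emeasure ?P X = emeasure (density (?S \<Otimes>\<^sub>M ?Q) ?f) X" .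
qed

abbreviation information :: "'n kernels \<Rightarrow> nat \<Rightarrow> ereal" where
  "information K n \<equiv> extended_mutual_information (J K n) (paths {..n}) (paths {..n})"

lemma D_nonneg: "0 \<le> D"
  using grid_close[of 0] by (meson order_trans zero_le_power2)

definition gain :: real where "gain = (onorm ((*v) A))\<^sup>2"

lemma norm_mult_sq_le: "(norm (A *v v))\<^sup>2 \<le> gain * (norm v)\<^sup>2"
proof -
  have "norm (A *v v) \<le> onorm ((*v) A) * norm v"
    by (rule onorm[OF matrix_vector_mul_bounded_linear])
  then have "(norm (A *v v))\<^sup>2 \<le> (onorm ((*v) A) * norm v)\<^sup>2" by (rule power_mono) simp
  then show ?thesis by (simp add: gain_def power_mult_distrib)
qed

text \<open>
  An upper bound for the expectation of the logarithm of \<open>restart_ratio\<close>, obtained by inserting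
  the second moments of reconstruction error, noise and initial state in the bound of
  \<open>ln_restart_ratio_le\<close>. What matters is that it does not depend on the kernels or horizons.
\<close>
definition overhead :: real where
  "overhead = \<bar>ln vol\<bar> + C\<^sub>g * (3 + 10 * D) + 4 * C\<^sub>g * gain * D
     + 4 * C\<^sub>g * (\<integral>w. (norm w)\<^sup>2 \<partial>\<mu>\<^sub>w) + 3 * C\<^sub>g * (\<integral>\<xi>. (norm \<xi>)\<^sup>2 \<partial>\<mu>\<^sub>0)"

lemma overhead_nonneg: "0 \<le> overhead"
  unfolding overhead_def using C_g_nonneg D_nonneg by (simp add: gain_def)

lemma ln_restart_ratio_le:
  fixes v w \<xi> :: "real^'n"
  defines "e \<equiv> A *v v + w"
  shows "\<bar>ln (restart_ratio e (q e) (e - \<xi>))\<bar> \<le>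
    (\<bar>ln vol\<bar> + C\<^sub>g * (3 + 10 * D)) + (4 * C\<^sub>g * gain) * (norm v)\<^sup>2 + (4 * C\<^sub>g) * (norm w)\<^sup>2 + (3 * C\<^sub>g) * (norm \<xi>)\<^sup>2"
proof -
  let ?r = "e - q e"
  have ratio: "restart_ratio e (q e) (e - \<xi>) = g \<xi> / (cell (q e) * g (\<xi> - ?r))"
    by (simp add: restart_ratio_def algebra_simps)
  have ln: "ln (restart_ratio e (q e) (e - \<xi>)) = ln (g \<xi>) - ln (cell (q e)) - ln (g (\<xi> - ?r))"
    unfolding ratio using g_pos cell_pos
    by (simp add: ln_div ln_mult less_imp_neq[OF g_pos, symmetric] less_imp_neq[OF cell_pos, symmetric])
  have "cell (q e) \<le> 1" unfolding cell_def by (rule init.prob_le_1)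
  then have c1: "ln (cell (q e)) \<le> 0" using cell_pos[of e] by simp
  have "ln (vol * exp (- (C\<^sub>g * (1 + 8 * D + 2 * (norm e)\<^sup>2)))) \<le> ln (cell (q e))"
    using cell_lower[of e] vol_pos cell_pos[of e] by (subst ln_le_cancel_iff) auto
  then have c2: "- ln (cell (q e)) \<le> \<bar>ln vol\<bar> + C\<^sub>g * (1 + 8 * D + 2 * (norm e)\<^sup>2)"
    using vol_pos by (simp add: ln_mult)
  have "(norm e)\<^sup>2 \<le> 2 * (norm (A *v v))\<^sup>2 + 2 * (norm w)\<^sup>2"
    unfolding e_def by (rule norm_add_sq_le)
  then have "(norm e)\<^sup>2 \<le> 2 * (gain * (norm v)\<^sup>2) + 2 * (norm w)\<^sup>2"
    using norm_mult_sq_le[of v] by simp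
  then have "C\<^sub>g * (1 + 8 * D + 2 * (norm e)\<^sup>2) \<le> C\<^sub>g * (1 + 8 * D + 2 * (2 * (gain * (norm v)\<^sup>2) + 2 * (norm w)\<^sup>2))"
    by (intro mult_left_mono C_g_nonneg) simp
  then have c3: "C\<^sub>g * (1 + 8 * D + 2 * (norm e)\<^sup>2) \<le>
      C\<^sub>g * (1 + 8 * D) + (4 * C\<^sub>g * gain) * (norm v)\<^sup>2 + (4 * C\<^sub>g) * (norm w)\<^sup>2"
    by (simp add: algebra_simps)
  have "(norm (\<xi> - ?r))\<^sup>2 \<le> 2 * (norm \<xi>)\<^sup>2 + 2 * D"
    using norm_diff_sq_le[of \<xi> ?r] grid_close[of e] by simp
  then have "C\<^sub>g * (1 + (norm (\<xi> - ?r))\<^sup>2) \<le> C\<^sub>g * (1 + (2 * (norm \<xi>)\<^sup>2 + 2 * D))"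
    by (intro mult_left_mono C_g_nonneg) simp
  then have c4: "\<bar>ln (g (\<xi> - ?r))\<bar> \<le> C\<^sub>g * (1 + 2 * D) + 2 * (C\<^sub>g * (norm \<xi>)\<^sup>2)"
    using ln_g[of "\<xi> - ?r"] by (simp add: algebra_simps)
  have c5: "\<bar>ln (g \<xi>)\<bar> \<le> C\<^sub>g + C\<^sub>g * (norm \<xi>)\<^sup>2"
    using ln_g[of \<xi>] by (simp add: algebra_simps)
  have "\<bar>ln (restart_ratio e (q e) (e - \<xi>))\<bar> \<le> \<bar>ln (g \<xi>)\<bar> + (- ln (cell (q e))) + \<bar>ln (g (\<xi> - ?r))\<bar>"
    unfolding ln using c1 by linarith
  also have "\<dots> \<le> (C\<^sub>g + C\<^sub>g * (norm \<xi>)\<^sup>2) +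
      (\<bar>ln vol\<bar> + (C\<^sub>g * (1 + 8 * D) + (4 * C\<^sub>g * gain) * (norm v)\<^sup>2 + (4 * C\<^sub>g) * (norm w)\<^sup>2)) +
      (C\<^sub>g * (1 + 2 * D) + 2 * (C\<^sub>g * (norm \<xi>)\<^sup>2))"
    using c2 c3 c4 c5 by linarith
  also have "\<dots> = (\<bar>ln vol\<bar> + C\<^sub>g * (3 + 10 * D)) + (4 * C\<^sub>g * gain) * (norm v)\<^sup>2 + (4 * C\<^sub>g) * (norm w)\<^sup>2 + (3 * C\<^sub>g) * (norm \<xi>)\<^sup>2"
    by (simp add: algebra_simps)
  finally show ?thesis .
qed

lemma nn_integral_source_initial:
  assumes [measurable]: "h \<in> borel_measurable borel"
  shows "(\<integral>\<^sup>+u. h (u 0) \<partial>S n) = (\<integral>\<^sup>+\<xi>. h \<xi> \<partial>\<mu>\<^sub>0)"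
proof (induction n)
  case 0
  have [measurable]: "(\<lambda>u. u 0) \<in> borel_measurable (paths {..0})" by measurable
  show ?case by (subst nn_integral_source_0) auto
next
  case (Suc n)
  have [measurable]: "(\<lambda>u. u 0) \<in> borel_measurable (paths {..Suc n})" by measurable
  show ?case
    using Suc by (subst nn_integral_source_Suc) (auto simp: noise.emeasure_space_1)
qed

text \<open>Finite information is witnessed by a density with respect to the product of the marginals.\<close>

lemma information_finiteE:
  assumes K: "\<And>t. t \<le> n \<Longrightarrow> stochastic_kernel K t" and "information K n < \<infinity>"
  obtains f :: "(nat \<Rightarrow> real^'n) \<times> (nat \<Rightarrow> real^'n) \<Rightarrow> real" and Q
  where "prob_space Q" "sets Q = sets (paths {..n})"
    "f \<in> borel_measurable (paths {..n} \<Otimes>\<^sub>M paths {..n})" "\<And>z. 0 \<le> f z"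
    "J K n = density (S n \<Otimes>\<^sub>M Q) (\<lambda>z. ennreal (f z))"
    "integrable (J K n) (\<lambda>z. ln (f z))" "information K n = ereal (\<integral>z. ln (f z) \<partial>J K n)"
proof -
  let ?Q = "distr (J K n) (paths {..n}) snd"
  interpret JK: prob_space "J K n" by (rule prob_joint[OF K])
  have sJ [measurable_cong]: "sets (J K n) = sets (paths {..n} \<Otimes>\<^sub>M paths {..n})" by (rule sets_joint[OF K])
  have pQ: "prob_space ?Q" by (rule JK.prob_space_distr) measurable
  have sQ: "sets ?Q = sets (paths {..n})" by simp
  have sR: "sets (S n \<Otimes>\<^sub>M ?Q) = sets (paths {..n} \<Otimes>\<^sub>M paths {..n})"
    by (intro sets_pair_measure_cong) simp_all
  have I: "information K n = extended_KL_divergence (S n \<Otimes>\<^sub>M ?Q) (J K n)"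
    by (simp add: extended_mutual_information_def joint_source_marginal[OF K])
  obtain f where f: "f \<in> borel_measurable (S n \<Otimes>\<^sub>M ?Q)" "\<And>z. 0 \<le> f z"
      "J K n = density (S n \<Otimes>\<^sub>M ?Q) (\<lambda>z. ennreal (f z))"
      "integrable (J K n) (\<lambda>z. ln (f z))"
      "extended_KL_divergence (S n \<Otimes>\<^sub>M ?Q) (J K n) = ereal (\<integral>z. ln (f z) \<partial>J K n)"
    by (rule extended_KL_divergence_finiteE[of "S n \<Otimes>\<^sub>M ?Q" "J K n"])
       (use assms(2) I in \<open>auto intro!: prob_space_pair prob_source pQ simp: sJ sR JK.prob_space_axioms\<close>)
  show thesis
  proof (rule that[OF pQ sQ _ f(2,3,4)])
    show "f \<in> borel_measurable (paths {..n} \<Otimes>\<^sub>M paths {..n})"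
      using f(1) measurable_cong_sets[OF sR refl] by blast
    show "information K n = ereal (\<integral>z. ln (f z) \<partial>J K n)" unfolding I by (rule f(5))
  qed
qed

text \<open>
  The same as \<open>joint_restart\<close>, stated for measures: expectations of logarithms, which take both
  signs, can then be transferred to the independent inputs.
\<close>

lemma joint_restart_distr:
  assumes K: "\<And>t. t \<le> a \<Longrightarrow> stochastic_kernel K t" and K': "\<And>t. t \<le> b \<Longrightarrow> stochastic_kernel K' t"
  defines "\<Theta> \<equiv> \<lambda>z. (join_source a b (fst (fst z)) (fst (snd z)) (fst (snd (snd z))),
      join_output a b (fst (fst z)) (snd (fst z)) (fst (snd z)) (fst (snd (snd z))) (snd (snd (snd z))))"
  shows "\<Theta> \<in> J K a \<Otimes>\<^sub>M (\<mu>\<^sub>w \<Otimes>\<^sub>M J K' b) \<rightarrow>\<^sub>M paths {..Suc (a + b)} \<Otimes>\<^sub>M paths {..Suc (a + b)}"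
    and "J (restart_kernel a K K') (Suc (a + b)) =
      distr (J K a \<Otimes>\<^sub>M (\<mu>\<^sub>w \<Otimes>\<^sub>M J K' b)) (paths {..Suc (a + b)} \<Otimes>\<^sub>M paths {..Suc (a + b)}) \<Theta>"
proof -
  let ?B = "J K a \<Otimes>\<^sub>M (\<mu>\<^sub>w \<Otimes>\<^sub>M J K' b)"
  let ?n = "Suc (a + b)"
  let ?PP = "paths {..?n} \<Otimes>\<^sub>M paths {..?n} :: ((nat \<Rightarrow> real^'n) \<times> (nat \<Rightarrow> real^'n)) measure"
  have [measurable_cong]: "sets (J K a) = sets (paths {..a} \<Otimes>\<^sub>M paths {..a})"
    "sets (J K' b) = sets (paths {..b} \<Otimes>\<^sub>M paths {..b})"
    using sets_joint K K' by auto
  show T [measurable]: "\<Theta> \<in> ?B \<rightarrow>\<^sub>M ?PP" unfolding \<Theta>_def by measurable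
  have sP: "sets (J (restart_kernel a K K') ?n) = sets ?PP"
    by (rule sets_joint, rule stochastic_restart_kernel[where b = b]) (use K K' in auto)
  interpret J': prob_space "J K' b" by (rule prob_joint[OF K'])
  interpret wJ': prob_space "\<mu>\<^sub>w \<Otimes>\<^sub>M J K' b" by (intro prob_space_pair prob_noise prob_joint K')
  show "J (restart_kernel a K K') ?n = distr ?B ?PP \<Theta>"
  proof (rule measure_eqI)
    show "sets (J (restart_kernel a K K') ?n) = sets (distr ?B ?PP \<Theta>)" by (simp add: sP)
    fix X assume "X \<in> sets (J (restart_kernel a K K') ?n)"
    then have X [measurable]: "X \<in> sets ?PP" by (simp add: sP)
    have m: "(indicator X :: _ \<Rightarrow> ennreal) \<in> borel_measurable ?PP" by measurable
    have m': "(\<lambda>z. indicator X (\<Theta> z) :: ennreal) \<in> borel_measurable ?B" by measurable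
    have "emeasure (distr ?B ?PP \<Theta>) X = (\<integral>\<^sup>+z. indicator X z \<partial>distr ?B ?PP \<Theta>)" by simp
    also have "\<dots> = (\<integral>\<^sup>+z. indicator X (\<Theta> z) \<partial>?B)" by (rule nn_integral_distr) simp_all
    also have "\<dots> = (\<integral>\<^sup>+z. \<integral>\<^sup>+z'. indicator X (\<Theta> (z, z')) \<partial>(\<mu>\<^sub>w \<Otimes>\<^sub>M J K' b) \<partial>J K a)"
      by (rule wJ'.nn_integral_fst[symmetric, OF m'])
    also have "\<dots> = (\<integral>\<^sup>+z. \<integral>\<^sup>+w. \<integral>\<^sup>+z'. indicator X (\<Theta> (z, w, z')) \<partial>J K' b \<partial>\<mu>\<^sub>w \<partial>J K a)"
    proof (rule nn_integral_cong)
      fix z assume z: "z \<in> space (J K a)"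
      have "(\<lambda>z'. indicator X (\<Theta> (z, z')) :: ennreal) \<in> borel_measurable (\<mu>\<^sub>w \<Otimes>\<^sub>M J K' b)"
        by (rule measurable_compose[OF measurable_Pair1'[OF z] m'])
      from J'.nn_integral_fst[OF this]
      show "(\<integral>\<^sup>+z'. indicator X (\<Theta> (z, z')) \<partial>(\<mu>\<^sub>w \<Otimes>\<^sub>M J K' b)) =
        (\<integral>\<^sup>+w. \<integral>\<^sup>+z'. indicator X (\<Theta> (z, w, z')) \<partial>J K' b \<partial>\<mu>\<^sub>w)" by simp
    qed
    also have "\<dots> = (\<integral>\<^sup>+z. indicator X z \<partial>J (restart_kernel a K K') ?n)"
      unfolding \<Theta>_def fst_conv snd_conv by (rule joint_restart[symmetric, OF K K' order_refl m])
    also have "\<dots> = emeasure (J (restart_kernel a K K') ?n) X" using X sP by simp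
    finally show "emeasure (J (restart_kernel a K K') ?n) X = emeasure (distr ?B ?PP \<Theta>) X" ..
  qed
qed

text \<open>
  The logarithm of the density splits into the log-densities of the two parts and that of
  \<open>restart_ratio\<close>. By independence of the inputs, the first two have the informations of the
  parts as expectations.
\<close>
theorem information_restart:
  assumes K: "\<And>t. t \<le> a \<Longrightarrow> stochastic_kernel K t" and K': "\<And>t. t \<le> b \<Longrightarrow> stochastic_kernel K' t"
    and D: "meets_distortion M x K a D"
    and fin: "information K a < \<infinity>" "information K' b < \<infinity>"
  shows "information (restart_kernel a K K') (Suc (a + b)) \<le> information K a + information K' b + ereal overhead"
proof -
  let ?n = "Suc (a + b)"
  let ?PP = "paths {..?n} \<Otimes>\<^sub>M paths {..?n} :: ((nat \<Rightarrow> real^'n) \<times> (nat \<Rightarrow> real^'n)) measure"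
  let ?P = "J (restart_kernel a K K') ?n"
  obtain f\<^sub>1 Q\<^sub>1 where f1: "prob_space Q\<^sub>1" "sets Q\<^sub>1 = sets (paths {..a})"
    "f\<^sub>1 \<in> borel_measurable (paths {..a} \<Otimes>\<^sub>M paths {..a})" "\<And>z. 0 \<le> f\<^sub>1 z"
    "J K a = density (S a \<Otimes>\<^sub>M Q\<^sub>1) (\<lambda>z. ennreal (f\<^sub>1 z))"
    "integrable (J K a) (\<lambda>z. ln (f\<^sub>1 z))" "information K a = ereal (\<integral>z. ln (f\<^sub>1 z) \<partial>J K a)"
    by (rule information_finiteE[OF _ fin(1)], erule K) (rule that)
  obtain f\<^sub>2 Q\<^sub>2 where f2: "prob_space Q\<^sub>2" "sets Q\<^sub>2 = sets (paths {..b})"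
    "f\<^sub>2 \<in> borel_measurable (paths {..b} \<Otimes>\<^sub>M paths {..b})" "\<And>z. 0 \<le> f\<^sub>2 z"
    "J K' b = density (S b \<Otimes>\<^sub>M Q\<^sub>2) (\<lambda>z. ennreal (f\<^sub>2 z))"
    "integrable (J K' b) (\<lambda>z. ln (f\<^sub>2 z))" "information K' b = ereal (\<integral>z. ln (f\<^sub>2 z) \<partial>J K' b)"
    by (rule information_finiteE[OF _ fin(2)], erule K') (rule that)
  define B where "B = J K a \<Otimes>\<^sub>M (\<mu>\<^sub>w \<Otimes>\<^sub>M J K' b)"
  define \<Theta> where "\<Theta> = (\<lambda>z. (join_source a b (fst (fst z)) (fst (snd z)) (fst (snd (snd z))),
      join_output a b (fst (fst z)) (snd (fst z)) (fst (snd z)) (fst (snd (snd z))) (snd (snd (snd z)))))"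
  have T [measurable]: "\<Theta> \<in> B \<rightarrow>\<^sub>M ?PP"
    unfolding B_def \<Theta>_def by (rule joint_restart_distr(1)[OF K K'])
  have PT: "?P = distr B ?PP \<Theta>"
    unfolding B_def \<Theta>_def by (rule joint_restart_distr(2)[OF K K'])
  let ?f = "restart_density a b f\<^sub>1 f\<^sub>2"
  have P: "?P = density (S ?n \<Otimes>\<^sub>M restart_reference a b Q\<^sub>1 Q\<^sub>2) (\<lambda>z. ennreal (?f z))"
    by (rule joint_restart_density[OF K K' f1(1,2) f2(1,2) f1(3,4) f2(3,4) f1(5) f2(5)])
  have fm [measurable]: "?f \<in> borel_measurable ?PP" by (rule restart_density_measurable[OF f1(3) f2(3)])
  have sJ: "sets (J K a) = sets (paths {..a} \<Otimes>\<^sub>M paths {..a})"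
    "sets (J K' b) = sets (paths {..b} \<Otimes>\<^sub>M paths {..b})"
    using sets_joint K K' by auto
  note [measurable_cong] = sJ
  have pa: "prob_space (J K a)" and pb: "prob_space (J K' b)"
    using prob_joint K K' by auto
  have pwb: "prob_space (\<mu>\<^sub>w \<Otimes>\<^sub>M J K' b)" by (intro prob_space_pair prob_noise pb)
  interpret B: prob_space B unfolding B_def by (intro prob_space_pair pa pwb)
  \<comment> \<open>\<open>v\<close> is the last reconstruction error before the restart, \<open>e\<close> the prediction error, \<open>\<xi>\<close> the start
    of the copy\<close>
  define v where "v z = fst (fst z) a - snd (fst z) a" for z :: "((nat \<Rightarrow> real^'n) \<times> (nat \<Rightarrow> real^'n)) \<times> (real^'n) \<times> (nat \<Rightarrow> real^'n) \<times> (nat \<Rightarrow> real^'n)"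
  define e where "e z = A *v v z + fst (snd z)" for z :: "((nat \<Rightarrow> real^'n) \<times> (nat \<Rightarrow> real^'n)) \<times> (real^'n) \<times> (nat \<Rightarrow> real^'n) \<times> (nat \<Rightarrow> real^'n)"
  define \<xi> where "\<xi> z = fst (snd (snd z)) 0" for z :: "((nat \<Rightarrow> real^'n) \<times> (nat \<Rightarrow> real^'n)) \<times> (real^'n) \<times> (nat \<Rightarrow> real^'n) \<times> (nat \<Rightarrow> real^'n)"
  define G where "G z = ln (restart_ratio (e z) (q (e z)) (e z - \<xi> z))" for z
  have comp: "(\<lambda>z. fst z a) \<in> borel_measurable (J K a)" "(\<lambda>z. snd z a) \<in> borel_measurable (J K a)"
    "(\<lambda>z. fst z 0) \<in> borel_measurable (J K' b)"
    using fst_component_measurable[of a "{..a}" "paths {..a}"] snd_component_measurable[of a "{..a}" "paths {..a}"]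
      fst_component_measurable[of 0 "{..b}" "paths {..b}"]
    by (simp_all add: measurable_cong_sets[OF sJ(1) refl] measurable_cong_sets[OF sJ(2) refl])
  have vm: "(\<lambda>z. fst z a - snd z a) \<in> borel_measurable (J K a)" using comp by measurable
  have [measurable]: "v \<in> borel_measurable B" "\<xi> \<in> borel_measurable B"
    unfolding v_def \<xi>_def B_def
    using measurable_compose[OF measurable_fst vm] measurable_compose[OF measurable_snd measurable_compose[OF measurable_snd comp(3)]]
    by simp_all
  have [measurable]: "(\<lambda>z. fst (snd z)) \<in> borel_measurable B" unfolding B_def by measurable
  have [measurable]: "e \<in> borel_measurable B" unfolding e_def by measurable
  have [measurable]: "G \<in> borel_measurable B" unfolding G_def by measurable
  have f\<Theta>: "?f (\<Theta> z) = f\<^sub>1 (fst z) * f\<^sub>2 (snd (snd z)) * restart_ratio (e z) (q (e z)) (e z - \<xi> z)"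
    if "z \<in> space B" for z
  proof -
    obtain u y w x' y' where z: "z = ((u, y), w, (x', y'))" by (metis prod.collapse)
    have "u \<in> space (paths {..a})" and y: "y \<in> space (paths {..a})" and x': "x' \<in> space (paths {..b})"
      and y': "y' \<in> space (paths {..b})"
      using that sets_eq_imp_space_eq[OF sJ(1)] sets_eq_imp_space_eq[OF sJ(2)]
      by (auto simp: B_def space_pair_measure z)
    then have r: "restrict (join_source a b u w x') {..a} = u" and m: "join_source a b u w x' (Suc a) = A *v u a + w"
      by (auto simp: join_source_def space_PiM PiE_def extensional_def fun_eq_iff)
    have e_eq: "e z = A *v u a + w - A *v y a"
      by (simp add: e_def v_def z matrix_vector_mult_diff_distrib)
    have s: "A *v y a + (A *v u a + w - A *v y a - x' 0) = A *v u a + w - x' 0" by simp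
    have "?f (\<Theta> z) = ?f (join_source a b u w x', assemble a b y y' (q (e z)) (e z - x' 0))"
      unfolding \<Theta>_def z by (simp add: join_output_def e_eq[unfolded z])
    also have "\<dots> = f\<^sub>1 (u, y) * f\<^sub>2 (x', y') * restart_ratio (e z) (q (e z)) (e z - x' 0)"
      unfolding restart_density_assemble[OF y y'] r m e_eq s decoded_source_join[OF x'] ..
    finally show ?thesis by (simp add: z \<xi>_def)
  qed
  have "AE z in J K a. 0 < f\<^sub>1 z"
    unfolding f1(5) using f1(3)
    by (subst AE_density) (auto simp: measurable_cong_sets[OF sets_pair_measure_cong[OF sets_source f1(2)] refl])
  then have ae1: "AE z in B. 0 < f\<^sub>1 (fst z)" unfolding B_def by (rule AE_pair_fst[OF pwb])
  have "AE z in J K' b. 0 < f\<^sub>2 z"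
    unfolding f2(5) using f2(3)
    by (subst AE_density) (auto simp: measurable_cong_sets[OF sets_pair_measure_cong[OF sets_source f2(2)] refl])
  then have ae2: "AE z in B. 0 < f\<^sub>2 (snd (snd z))" unfolding B_def
    by (intro AE_pair_snd[OF pa pwb AE_pair_snd[OF prob_noise pb]])
  have pos: "0 < restart_ratio (e z) (q (e z)) (e z - \<xi> z)" for z
    using g_pos cell_pos by (simp add: restart_ratio_def)
  have ae: "AE z in B. ln (?f (\<Theta> z)) = ln (f\<^sub>1 (fst z)) + ln (f\<^sub>2 (snd (snd z))) + G z"
    using ae1 ae2 AE_space
  proof eventually_elim
    case (elim z)
    then show ?case using pos[of z] by (simp add: f\<Theta> G_def ln_mult)
  qed
  have i1: "integrable B (\<lambda>z. ln (f\<^sub>1 (fst z)))" "(\<integral>z. ln (f\<^sub>1 (fst z)) \<partial>B) = (\<integral>z. ln (f\<^sub>1 z) \<partial>J K a)"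
    unfolding B_def by (rule integral_pair_fst[OF pa pwb f1(6)])+
  note i2' = integral_pair_snd[OF prob_noise pb f2(6)]
  have i2: "integrable B (\<lambda>z. ln (f\<^sub>2 (snd (snd z))))" "(\<integral>z. ln (f\<^sub>2 (snd (snd z))) \<partial>B) = (\<integral>z. ln (f\<^sub>2 z) \<partial>J K' b)"
    unfolding B_def using integral_pair_snd[OF pa pwb i2'(1)] i2'(2) by auto
  have "(\<integral>\<^sup>+z. ennreal ((norm (fst z a - snd z a))\<^sup>2) \<partial>J K a) \<le> ennreal D"
    using D by (simp add: meets_distortion_iff distortion_def)
  then have dv: "integrable (J K a) (\<lambda>z. (norm (fst z a - snd z a))\<^sup>2)"
    "(\<integral>z. (norm (fst z a - snd z a))\<^sup>2 \<partial>J K a) \<le> D"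
    using integral_le_of_nn_integral_le[of "\<lambda>z. (norm (fst z a - snd z a))\<^sup>2" "J K a" D] vm D_nonneg by auto
  have i3: "integrable B (\<lambda>z. (norm (v z))\<^sup>2)" "(\<integral>z. (norm (v z))\<^sup>2 \<partial>B) \<le> D"
    unfolding B_def v_def using integral_pair_fst[OF pa pwb dv(1)] dv(2) by auto
  note i4' = integral_pair_fst[OF prob_noise pb noise_moment]
  have i4: "integrable B (\<lambda>z. (norm (fst (snd z)))\<^sup>2)" "(\<integral>z. (norm (fst (snd z)))\<^sup>2 \<partial>B) = (\<integral>w. (norm w)\<^sup>2 \<partial>\<mu>\<^sub>w)"
    unfolding B_def using integral_pair_snd[OF pa pwb i4'(1)] i4'(2) by auto
  have d0: "distr (J K' b) borel (\<lambda>z. fst z 0) = \<mu>\<^sub>0"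
  proof (rule measure_eqI)
    fix X :: "(real^'n) set" assume "X \<in> sets (distr (J K' b) borel (\<lambda>z. fst z 0))"
    then have X [measurable]: "X \<in> sets borel" by simp
    have [measurable]: "(\<lambda>u. u 0) \<in> borel_measurable (paths {..b})" by measurable
    have "emeasure (distr (J K' b) borel (\<lambda>z. fst z 0)) X = (\<integral>\<^sup>+z. indicator X (fst z 0) \<partial>J K' b)"
      using comp(3) by (simp flip: nn_integral_indicator add: nn_integral_distr)
    also have "\<dots> = (\<integral>\<^sup>+u. indicator X (u 0) \<partial>distr (J K' b) (paths {..b}) fst)"
      by (rule nn_integral_distr[symmetric]) simp_all
    also have "distr (J K' b) (paths {..b}) fst = S b" by (rule joint_source_marginal[OF K'])
    also have "(\<integral>\<^sup>+u. indicator X (u 0) \<partial>S b) = (\<integral>\<^sup>+\<xi>. indicator X \<xi> \<partial>\<mu>\<^sub>0)"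
      by (rule nn_integral_source_initial[of "indicator X"]) simp
    also have "\<dots> = emeasure \<mu>\<^sub>0 X" using X sets_init by simp
    finally show "emeasure (distr (J K' b) borel (\<lambda>z. fst z 0)) X = emeasure \<mu>\<^sub>0 X" .
  qed (simp add: sets_init)
  have d1: "integrable (J K' b) (\<lambda>z. (norm (fst z 0))\<^sup>2)" "(\<integral>z. (norm (fst z 0))\<^sup>2 \<partial>J K' b) = (\<integral>\<xi>. (norm \<xi>)\<^sup>2 \<partial>\<mu>\<^sub>0)"
    using init_moment comp(3) by (simp_all flip: d0 add: integrable_distr_eq integral_distr)
  note i5' = integral_pair_snd[OF prob_noise pb d1(1)]
  have i5: "integrable B (\<lambda>z. (norm (\<xi> z))\<^sup>2)" "(\<integral>z. (norm (\<xi> z))\<^sup>2 \<partial>B) = (\<integral>\<xi>. (norm \<xi>)\<^sup>2 \<partial>\<mu>\<^sub>0)"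
    unfolding B_def \<xi>_def using integral_pair_snd[OF pa pwb i5'(1)] i5'(2) d1(2) by auto
  let ?\<beta> = "\<lambda>z. (\<bar>ln vol\<bar> + C\<^sub>g * (3 + 10 * D)) + (4 * C\<^sub>g * gain) * (norm (v z))\<^sup>2
      + (4 * C\<^sub>g) * (norm (fst (snd z)))\<^sup>2 + (3 * C\<^sub>g) * (norm (\<xi> z))\<^sup>2"
  have i\<beta>: "integrable B ?\<beta>" using i3(1) i4(1) i5(1) by auto
  have G\<beta>: "\<bar>G z\<bar> \<le> ?\<beta> z" for z
    unfolding G_def e_def by (rule ln_restart_ratio_le)
  have iG: "integrable B G"
  proof (rule Bochner_Integration.integrable_bound[OF i\<beta>])
    show "AE z in B. norm (G z) \<le> norm (?\<beta> z)"
      unfolding real_norm_def by (rule AE_I2, rule order_trans[OF G\<beta> abs_ge_self])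
  qed measurable
  have "(\<integral>z. G z \<partial>B) \<le> (\<integral>z. ?\<beta> z \<partial>B)"
    by (rule integral_mono[OF iG i\<beta>]) (rule order_trans[OF abs_ge_self G\<beta>])
  also have "\<dots> = (\<bar>ln vol\<bar> + C\<^sub>g * (3 + 10 * D)) + (4 * C\<^sub>g * gain) * (\<integral>z. (norm (v z))\<^sup>2 \<partial>B)
      + (4 * C\<^sub>g) * (\<integral>w. (norm w)\<^sup>2 \<partial>\<mu>\<^sub>w) + (3 * C\<^sub>g) * (\<integral>\<xi>. (norm \<xi>)\<^sup>2 \<partial>\<mu>\<^sub>0)"
    using i3(1) i4 i5 by (simp add: B.prob_space)
  also have "\<dots> \<le> overhead"
    unfolding overhead_def using i3(2) C_g_nonneg
    by (simp add: mult_left_mono gain_def)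
  finally have G_le: "(\<integral>z. G z \<partial>B) \<le> overhead" .
  have m1: "(\<lambda>z. ln (?f (\<Theta> z))) \<in> borel_measurable B" by measurable
  have m2: "(\<lambda>z. ln (f\<^sub>1 (fst z)) + ln (f\<^sub>2 (snd (snd z))) + G z) \<in> borel_measurable B"
    using i1(1) i2(1) by (intro borel_measurable_add) auto
  have "integrable B (\<lambda>z. ln (?f (\<Theta> z)))"
    using integrable_cong_AE[OF m1 m2 ae] i1(1) i2(1) iG by simp
  then have int: "integrable ?P (\<lambda>z. ln (?f z))"
    unfolding PT by (subst integrable_distr_eq) auto
  have "(\<integral>z. ln (?f z) \<partial>?P) = (\<integral>z. ln (?f (\<Theta> z)) \<partial>B)"
    unfolding PT by (subst integral_distr) auto
  also have "\<dots> = (\<integral>z. ln (f\<^sub>1 z) \<partial>J K a) + (\<integral>z. ln (f\<^sub>2 z) \<partial>J K' b) + (\<integral>z. G z \<partial>B)"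
    unfolding integral_cong_AE[OF m1 m2 ae] using i1 i2 iG by simp
  also have "\<dots> \<le> (\<integral>z. ln (f\<^sub>1 z) \<partial>J K a) + (\<integral>z. ln (f\<^sub>2 z) \<partial>J K' b) + overhead"
    using G_le by simp
  finally have le: "(\<integral>z. ln (?f z) \<partial>?P) \<le> (\<integral>z. ln (f\<^sub>1 z) \<partial>J K a) + (\<integral>z. ln (f\<^sub>2 z) \<partial>J K' b) + overhead" .
  have SK: "stochastic_kernel (restart_kernel a K K') t" if "t \<le> ?n" for t
    by (rule stochastic_restart_kernel[where b = b]) (use K K' that in auto)
  have pQ: "prob_space (restart_reference a b Q\<^sub>1 Q\<^sub>2)"
  proof -
    note [measurable_cong] = f1(2) f2(2)
    show ?thesis
      unfolding restart_reference_def
      by (rule prob_space.prob_space_distr, intro prob_space_pair f1(1) f2(1) prob_init)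
         (unfold case_prod_beta', measurable)
  qed
  have "information (restart_kernel a K K') ?n \<le> ereal (\<integral>z. ln (?f z) \<partial>?P)"
    by (rule extended_mutual_information_le[OF prob_joint[OF SK] pQ prob_source sets_source _ fm
          restart_density_nonneg[OF f1(4) f2(4)] P int joint_source_marginal[OF SK]])
       (simp_all add: restart_reference_def)
  also have "\<dots> \<le> information K a + information K' b + ereal overhead"
    using le by (simp add: f1(7) f2(7))
  finally show ?thesis .
qed

end

section \<open>Concatenating infinitely many reconstructions\<close>

context regular_restart
begin

lemma information_nonneg:
  assumes K: "\<And>t. t \<le> n \<Longrightarrow> stochastic_kernel K t"
  shows "0 \<le> information K n"
proof (cases "information K n < \<infinity>")
  case True
  obtain f Q where f: "prob_space Q" "sets Q = sets (paths {..n})"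
    "f \<in> borel_measurable (paths {..n} \<Otimes>\<^sub>M paths {..n})" "\<And>z. 0 \<le> f z"
    "J K n = density (S n \<Otimes>\<^sub>M Q) (\<lambda>z. ennreal (f z))"
    "integrable (J K n) (\<lambda>z. ln (f z))" "information K n = ereal (\<integral>z. ln (f z) \<partial>J K n)"
    by (rule information_finiteE[OF _ True], erule K) (rule that)
  have m: "f \<in> borel_measurable (S n \<Otimes>\<^sub>M Q)"
    using f(3) measurable_cong_sets[OF sets_pair_measure_cong[OF sets_source f(2)] refl] by blast
  have pR: "prob_space (S n \<Otimes>\<^sub>M Q)" by (intro prob_space_pair prob_source f(1))
  have "0 \<le> (\<integral>z. ln (f z) \<partial>J K n)"
    by (rule relative_entropy_pushforward[OF prob_joint[OF K] pR m f(4,5,6) measurable_fst]) auto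
  then show ?thesis by (simp add: f(7))
qed simp

lemma source_restrict:
  fixes K :: "'n kernels"
  assumes "n \<le> n'" and K: "\<And>t. t \<le> n' \<Longrightarrow> stochastic_kernel K t"
  shows "S n = distr (S n') (paths {..n}) (\<lambda>u. restrict u {..n})"
proof -
  have [measurable_cong]: "sets (J K n') = sets (paths {..n'} \<Otimes>\<^sub>M paths {..n'})"
    by (rule sets_joint[OF K])
  have r: "(\<lambda>u. restrict u {..n}) \<in> paths {..n'} \<rightarrow>\<^sub>M paths {..n}"
    by (rule measurable_restrict_subset) (use assms in auto)
  have r2: "(\<lambda>z. (restrict (fst z) {..n}, restrict (snd z) {..n})) \<in> J K n' \<rightarrow>\<^sub>M paths {..n} \<Otimes>\<^sub>M paths {..n}"
    by (intro measurable_Pair measurable_compose[OF _ r]) measurable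
  have "S n = distr (J K n) (paths {..n}) fst"
    by (rule joint_source_marginal[symmetric]) (use assms in auto)
  also have "\<dots> = distr (J K n') (paths {..n}) (\<lambda>z. restrict (fst z) {..n})"
  proof -
    have J: "J K n = distr (J K n') (paths {..n} \<Otimes>\<^sub>M paths {..n})
        (\<lambda>z. (restrict (fst z) {..n}, restrict (snd z) {..n}))"
      by (rule joint_restrict[OF assms])
    show ?thesis unfolding J by (subst distr_distr[OF _ r2]) (auto simp: comp_def)
  qed
  also have "\<dots> = distr (distr (J K n') (paths {..n'}) fst) (paths {..n}) (\<lambda>u. restrict u {..n})"
    by (subst distr_distr[OF r]) (auto simp: comp_def)
  also have "distr (J K n') (paths {..n'}) fst = S n'"
    by (rule joint_source_marginal[OF K])
  finally show ?thesis .
qed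

text \<open>Restriction to an earlier horizon is a pushforward of both laws, so information decreases.\<close>
lemma information_mono:
  assumes "n \<le> n'" and K: "\<And>t. t \<le> n' \<Longrightarrow> stochastic_kernel K t"
  shows "information K n \<le> information K n'"
proof (cases "information K n' < \<infinity>")
  case True
  obtain f Q where f: "prob_space Q" "sets Q = sets (paths {..n'})"
    "f \<in> borel_measurable (paths {..n'} \<Otimes>\<^sub>M paths {..n'})" "\<And>z. 0 \<le> f z"
    "J K n' = density (S n' \<Otimes>\<^sub>M Q) (\<lambda>z. ennreal (f z))"
    "integrable (J K n') (\<lambda>z. ln (f z))" "information K n' = ereal (\<integral>z. ln (f z) \<partial>J K n')"
    by (rule information_finiteE[OF _ True], erule K) (rule that)
  have m: "f \<in> borel_measurable (S n' \<Otimes>\<^sub>M Q)"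
    using f(3) measurable_cong_sets[OF sets_pair_measure_cong[OF sets_source f(2)] refl] by blast
  have pR: "prob_space (S n' \<Otimes>\<^sub>M Q)" by (intro prob_space_pair prob_source f(1))
  let ?N = "paths {..n} \<Otimes>\<^sub>M paths {..n} :: ((nat \<Rightarrow> real^'n) \<times> (nat \<Rightarrow> real^'n)) measure"
  let ?r = "\<lambda>z :: (nat \<Rightarrow> real^'n) \<times> (nat \<Rightarrow> real^'n). (restrict (fst z) {..n}, restrict (snd z) {..n})"
  have r1: "(\<lambda>u. restrict u {..n}) \<in> paths {..n'} \<rightarrow>\<^sub>M (paths {..n} :: (nat \<Rightarrow> real^'n) measure)"
    by (rule measurable_restrict_subset) (use assms(1) in auto)
  have rS: "(\<lambda>u. restrict u {..n}) \<in> S n' \<rightarrow>\<^sub>M paths {..n}" and rQ: "(\<lambda>u. restrict u {..n}) \<in> Q \<rightarrow>\<^sub>M paths {..n}"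
    using r1 measurable_cong_sets[OF sets_source refl] measurable_cong_sets[OF f(2) refl] by blast+
  have r: "?r \<in> S n' \<Otimes>\<^sub>M Q \<rightarrow>\<^sub>M ?N"
    by (intro measurable_Pair measurable_compose[OF measurable_fst rS] measurable_compose[OF measurable_snd rQ])
  have sJ: "sets (J K n') = sets (S n' \<Otimes>\<^sub>M Q)" by (simp add: f(5))
  have rJ: "?r \<in> J K n' \<rightarrow>\<^sub>M ?N" using r measurable_cong_sets[OF sJ refl] by blast
  define Q' where "Q' = distr Q (paths {..n}) (\<lambda>u. restrict u {..n})"
  have pQ': "prob_space Q'" unfolding Q'_def by (rule prob_space.prob_space_distr[OF f(1) rQ])
  have dR: "distr (S n' \<Otimes>\<^sub>M Q) ?N ?r = S n \<Otimes>\<^sub>M Q'"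
  proof -
    have Sn: "S n = distr (S n') (paths {..n}) (\<lambda>u. restrict u {..n})"
      by (rule source_restrict[OF assms])
    show ?thesis
      unfolding Sn Q'_def
      using pair_measure_distr[OF rS rQ] pQ'[unfolded Q'_def]
      by (simp add: prob_space_imp_sigma_finite case_prod_beta')
  qed
  obtain h where h: "h \<in> borel_measurable ?N" "\<And>z. 0 \<le> h z"
    "distr (J K n') ?N ?r = density (distr (S n' \<Otimes>\<^sub>M Q) ?N ?r) (\<lambda>z. ennreal (h z))"
    "integrable (J K n') (\<lambda>z. ln (h (?r z)))"
    "(\<integral>z. ln (h (?r z)) \<partial>J K n') \<le> (\<integral>z. ln (f z) \<partial>J K n')"
    by (rule relative_entropy_pushforward[OF prob_joint[OF K] pR m f(4,5,6) r]) (auto intro: that)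
  have J: "J K n = distr (J K n') ?N ?r" by (rule joint_restrict[OF assms])
  have lnh: "(\<lambda>z. ln (h z)) \<in> borel_measurable ?N" using h(1) by measurable
  have Kn: "\<And>t. t \<le> n \<Longrightarrow> stochastic_kernel K t" using assms by auto
  have dens: "J K n = density (S n \<Otimes>\<^sub>M Q') (\<lambda>z. ennreal (h z))"
    unfolding J h(3) dR ..
  have int: "integrable (J K n) (\<lambda>z. ln (h z))"
    unfolding J using h(4) by (simp add: integrable_distr_eq[OF rJ lnh])
  have "information K n \<le> ereal (\<integral>z. ln (h z) \<partial>J K n)"
    by (rule extended_mutual_information_le[OF prob_joint[OF Kn] pQ' prob_source sets_source _ h(1,2) dens int
          joint_source_marginal[OF Kn]]) (simp_all add: Q'_def)
  also have "(\<integral>z. ln (h z) \<partial>J K n) = (\<integral>z. ln (h (?r z)) \<partial>J K n')"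
    unfolding J by (rule integral_distr[OF rJ lnh])
  also have "ereal \<dots> \<le> information K n'" using h(5) by (simp add: f(7))
  finally show ?thesis .
qed (simp add: not_less)

lemma meets_distortion_cong:
  assumes "\<And>t. t \<le> n \<Longrightarrow> K t = K' t"
  shows "meets_distortion M x K n d \<longleftrightarrow> meets_distortion M x K' n d"
  by (simp add: meets_distortion_def joint_cong[of n K K', OF assms])

lemma information_cong:
  assumes "\<And>t. t \<le> n \<Longrightarrow> K t = K' t"
  shows "information K n = information K' n"
  by (simp add: joint_cong[of n K K', OF assms])

text \<open>
  The kernels after \<open>b\<close> restarts, together with their last valid time. Each stage extends the
  previous one, so the stages have a limit.
\<close>
primrec stage :: "(nat \<Rightarrow> 'n kernels) \<Rightarrow> (nat \<Rightarrow> nat) \<Rightarrow> nat \<Rightarrow> 'n kernels \<times> nat" where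
  "stage Ks N 0 = (Ks 0, N 0)"
| "stage Ks N (Suc b) = (restart_kernel (snd (stage Ks N b)) (fst (stage Ks N b)) (Ks (Suc b)),
     Suc (snd (stage Ks N b) + N (Suc b)))"

text \<open>Stage \<open>t\<close> is long enough to determine the kernel at time \<open>t\<close>, as every block has positive length.\<close>
definition concatenation :: "(nat \<Rightarrow> 'n kernels) \<Rightarrow> (nat \<Rightarrow> nat) \<Rightarrow> 'n kernels" where
  "concatenation Ks N t = fst (stage Ks N t) t"

lemma stage_length: "Suc (snd (stage Ks N b)) = (\<Sum>i\<le>b. Suc (N i))"
  by (induction b) (auto simp: atMost_0)

lemma le_stage_length: "b \<le> snd (stage Ks N b)"
  by (induction b) auto

lemma stage_mono: "b \<le> b' \<Longrightarrow> snd (stage Ks N b) \<le> snd (stage Ks N b')"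
  by (rule lift_Suc_mono_le) auto

lemma stage_agree:
  assumes "b \<le> b'" "t \<le> snd (stage Ks N b)"
  shows "fst (stage Ks N b') t = fst (stage Ks N b) t"
  using assms(1)
proof (induction rule: dec_induct)
  case (step k)
  have "t \<le> snd (stage Ks N k)" using stage_mono[OF step(1), of Ks N] assms(2) by simp
  then have "fst (stage Ks N (Suc k)) t = fst (stage Ks N k) t"
    by (simp add: restart_kernel_def fun_eq_iff)
  then show ?case using step.IH by simp
qed simp

lemma concatenation_eq_stage:
  assumes "t \<le> snd (stage Ks N b)"
  shows "concatenation Ks N t = fst (stage Ks N b) t"
proof -
  have "fst (stage Ks N (max t b)) t = fst (stage Ks N t) t"
    by (rule stage_agree) (auto simp: le_stage_length)
  moreover have "fst (stage Ks N (max t b)) t = fst (stage Ks N b) t"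
    by (rule stage_agree) (use assms in auto)
  ultimately show ?thesis by (simp add: concatenation_def)
qed

context
  fixes Ks :: "nat \<Rightarrow> 'n kernels" and N :: "nat \<Rightarrow> nat"
  assumes Ks: "\<And>j t. t \<le> N j \<Longrightarrow> stochastic_kernel (Ks j) t"
    and Ds: "\<And>j. meets_distortion M x (Ks j) (N j) D"
    and Is: "\<And>j. information (Ks j) (N j) < \<infinity>"
begin

lemma stage_feasible:
  "(\<forall>t\<le>snd (stage Ks N b). stochastic_kernel (fst (stage Ks N b)) t) \<and>
   meets_distortion M x (fst (stage Ks N b)) (snd (stage Ks N b)) D \<and>
   information (fst (stage Ks N b)) (snd (stage Ks N b)) \<le> (\<Sum>i\<le>b. information (Ks i) (N i) + ereal overhead)"
proof (induction b)
  case 0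
  have "information (Ks 0) (N 0) + 0 \<le> information (Ks 0) (N 0) + ereal overhead"
    by (intro add_left_mono) (simp add: overhead_nonneg)
  then show ?case using Ks Ds by (simp add: atMost_0)
next
  case (Suc b)
  let ?a = "snd (stage Ks N b)" and ?K = "fst (stage Ks N b)"
  from Suc have K: "\<And>t. t \<le> ?a \<Longrightarrow> stochastic_kernel ?K t" and D: "meets_distortion M x ?K ?a D"
    and I: "information ?K ?a \<le> (\<Sum>i\<le>b. information (Ks i) (N i) + ereal overhead)" by auto
  have "(\<Sum>i\<le>b. information (Ks i) (N i) + ereal overhead) < \<infinity>"
    using Is by (simp add: sum_Pinfty less_top[symmetric])
  with I have fin: "information ?K ?a < \<infinity>" by (rule le_less_trans)
  have "information (restart_kernel ?a ?K (Ks (Suc b))) (Suc (?a + N (Suc b))) \<le>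
    information ?K ?a + information (Ks (Suc b)) (N (Suc b)) + ereal overhead"
    by (rule information_restart[OF K Ks D fin Is])
  also have "\<dots> \<le> (\<Sum>i\<le>b. information (Ks i) (N i) + ereal overhead) + (information (Ks (Suc b)) (N (Suc b)) + ereal overhead)"
    using I by (simp add: add.assoc add_right_mono)
  finally show ?case
    using stochastic_restart_kernel[OF K Ks] distortion_restart[OF K Ks D Ds] by auto
qed

lemma stochastic_concatenation: "stochastic_kernel (concatenation Ks N) t"
proof -
  have "stochastic_kernel (fst (stage Ks N t)) t"
    using stage_feasible[of t] le_stage_length[of t Ks N] by blast
  then show ?thesis by (simp add: stochastic_kernel_def concatenation_def)
qed

lemma meets_distortion_concatenation: "meets_distortion M x (concatenation Ks N) n D"
proof (rule meets_distortion_mono)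
  show "n \<le> snd (stage Ks N n)" by (rule le_stage_length)
  show "meets_distortion M x (concatenation Ks N) (snd (stage Ks N n)) D"
  proof (subst meets_distortion_cong)
    show "meets_distortion M x (fst (stage Ks N n)) (snd (stage Ks N n)) D"
      using stage_feasible[of n] by (elim conjE)
  qed (rule concatenation_eq_stage)
qed (rule stochastic_concatenation)

lemma information_concatenation:
  assumes "n \<le> snd (stage Ks N b)"
  shows "information (concatenation Ks N) n \<le> (\<Sum>i\<le>b. information (Ks i) (N i) + ereal overhead)"
proof -
  have "information (concatenation Ks N) n \<le> information (concatenation Ks N) (snd (stage Ks N b))"
    by (rule information_mono[OF assms stochastic_concatenation])
  also have "\<dots> = information (fst (stage Ks N b)) (snd (stage Ks N b))"
    by (rule information_cong[of "snd (stage Ks N b)" "concatenation Ks N", OF concatenation_eq_stage])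
  also have "\<dots> \<le> (\<Sum>i\<le>b. information (Ks i) (N i) + ereal overhead)"
    using stage_feasible[of b] by blast
  finally show ?thesis .
qed

end

end

section \<open>The limit and the infimum can be interchanged\<close>

text \<open>
  A schedule that runs through blocks of unbounded index, but moves on to a block only when its
  cost has become negligible compared with the number of blocks already used.
\<close>
lemma slow_schedule:
  fixes cost :: "nat \<Rightarrow> real"
  obtains \<sigma> :: "nat \<Rightarrow> nat"
  where "\<And>m. eventually (\<lambda>b. m \<le> \<sigma> b) sequentially"
    and "\<And>\<epsilon>. 0 < \<epsilon> \<Longrightarrow> eventually (\<lambda>b. cost (\<sigma> b) \<le> \<epsilon> * real b) sequentially"
proof -
  \<comment> \<open>the blocks that are affordable at stage \<open>b\<close>; block 0 always counts as affordable\<close>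
  define E where "E b = {j. j \<le> b \<and> (j = 0 \<or> cost j * (real j + 1) \<le> real b)}" for b
  define \<sigma> where "\<sigma> b = Max (E b)" for b
  have fin: "finite (E b)" and ne: "E b \<noteq> {}" for b
    unfolding E_def by (auto intro: finite_subset[of _ "{..b}"])
  have \<sigma>_in: "\<sigma> b \<in> E b" for b unfolding \<sigma>_def using fin ne by (rule Max_in)
  have grow: "eventually (\<lambda>b. m \<le> \<sigma> b) sequentially" for m
    using eventually_ge_at_top[of m] eventually_ge_at_top[of "nat \<lceil>cost m * (real m + 1)\<rceil>"]
  proof eventually_elim
    case (elim b)
    then have "cost m * (real m + 1) \<le> real b" by linarith
    then have "m \<in> E b" using elim by (simp add: E_def)
    then show ?case unfolding \<sigma>_def using fin by (intro Max_ge)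
  qed
  have small: "eventually (\<lambda>b. cost (\<sigma> b) \<le> \<epsilon> * real b) sequentially" if "0 < \<epsilon>" for \<epsilon>
    using grow[of "Suc (nat \<lceil>1 / \<epsilon>\<rceil>)"]
  proof eventually_elim
    case (elim b)
    then have big: "1 / \<epsilon> \<le> real (\<sigma> b) + 1" and "\<sigma> b \<noteq> 0" by linarith+
    then have c: "cost (\<sigma> b) * (real (\<sigma> b) + 1) \<le> real b" using \<sigma>_in[of b] by (auto simp: E_def)
    have "real b / (real (\<sigma> b) + 1) \<le> \<epsilon> * real b"
    proof -
      have "1 \<le> \<epsilon> * (real (\<sigma> b) + 1)" using big \<open>0 < \<epsilon>\<close> by (simp add: field_simps)
      then have "real b * 1 \<le> real b * (\<epsilon> * (real (\<sigma> b) + 1))" by (rule mult_left_mono) simp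
      then show ?thesis by (simp add: field_simps)
    qed
    moreover have "cost (\<sigma> b) \<le> real b / (real (\<sigma> b) + 1)"
      using c by (simp add: field_simps)
    ultimately show ?case by linarith
  qed
  show thesis by (rule that[OF grow small])
qed

lemma tendsto_of_limsup_le_liminf:
  fixes X :: "nat \<Rightarrow> ereal"
  assumes "limsup X \<le> L" "L \<le> liminf X"
  shows "X \<longlonglongrightarrow> L"
proof -
  have "liminf X \<le> limsup X" by (rule Liminf_le_Limsup) simp
  with assms have "liminf X = L" "limsup X = L" by auto
  then show ?thesis by (simp add: tendsto_iff_Liminf_eq_Limsup)
qed

context regular_restart
begin

lemma srd_finite_le_information_rate:
  assumes "\<And>t. t \<le> n \<Longrightarrow> stochastic_kernel K t" "meets_distortion M x K n D"
  shows "srd_finite M x n D \<le> information_rate M x K n"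
  unfolding srd_finite_def by (rule INF_lower) (use assms in simp)

lemma information_rate_le_iff:
  "information_rate M x K n \<le> ereal r \<longleftrightarrow> information K n \<le> ereal (r * (real n + 1))"
proof (cases "information K n")
  case (real i)
  then show ?thesis by (simp add: information_rate_def field_simps)
qed (simp_all add: information_rate_def)

lemma srd_finite_nonneg: "0 \<le> srd_finite M x n D"
  unfolding srd_finite_def
proof (rule INF_greatest)
  fix K assume "K \<in> {K. (\<forall>t\<le>n. stochastic_kernel K t) \<and> meets_distortion M x K n D}"
  then have "0 \<le> information K n" by (intro information_nonneg) auto
  then show "0 \<le> information_rate M x K n"
    unfolding information_rate_def by simp
qed

lemma near_optimal_horizon:
  assumes "liminf (\<lambda>n. srd_finite M x n D) < ereal r"
  obtains n and K :: "'n kernels" where "m \<le> n" "\<And>t. t \<le> n \<Longrightarrow> stochastic_kernel K t"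
    "meets_distortion M x K n D" "information K n \<le> ereal (r * (real n + 1))"
proof -
  have "\<exists>n\<ge>m. srd_finite M x n D < ereal r"
  proof (rule ccontr)
    assume "\<not> ?thesis"
    then have "eventually (\<lambda>n. ereal r \<le> srd_finite M x n D) sequentially"
      by (auto simp: eventually_sequentially not_less)
    then have "ereal r \<le> liminf (\<lambda>n. srd_finite M x n D)" by (rule Liminf_bounded)
    with assms show False by simp
  qed
  then obtain n where n: "m \<le> n" "srd_finite M x n D < ereal r" by auto
  then obtain K where K: "K \<in> {K. (\<forall>t\<le>n. stochastic_kernel K t) \<and> meets_distortion M x K n D}"
      "information_rate M x K n < ereal r"
    unfolding srd_finite_def by (auto simp: INF_less_iff)
  from K(2) have "information K n \<le> ereal (r * (real n + 1))"
    unfolding information_rate_le_iff[symmetric] by simp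
  with n(1) K(1) show thesis by (intro that) auto
qed

text \<open>
  The \<open>j\<close>-th kind of block is so long that restarting adds at most \<open>1/(j+1)\<close> to its rate. The
  total cost of the first blocks exceeds \<open>(l + \<delta>)\<close> times the elapsed time by at most a constant,
  and the schedule makes the cost of the current, unfinished block at most \<open>\<delta>\<close> times the elapsed
  time.
\<close>
lemma limit_achieving_kernels:
  assumes l: "liminf (\<lambda>n. srd_finite M x n D) = ereal l"
  obtains K :: "'n kernels" where "\<And>t. stochastic_kernel K t" "\<And>n. meets_distortion M x K n D"
    "\<And>\<epsilon>. 0 < \<epsilon> \<Longrightarrow> eventually (\<lambda>n. information_rate M x K n \<le> ereal (l + \<epsilon>)) sequentially"
proof -
  have "0 \<le> liminf (\<lambda>n. srd_finite M x n D)"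
    by (rule Liminf_bounded) (simp add: srd_finite_nonneg)
  then have l_nonneg: "0 \<le> l" using l by simp
  have "\<exists>N (K :: 'n kernels). nat \<lceil>overhead * (real j + 1)\<rceil> \<le> N \<and> (\<forall>t\<le>N. stochastic_kernel K t) \<and>
      meets_distortion M x K N D \<and> information K N \<le> ereal ((l + 1 / (real j + 1)) * (real N + 1))" for j
  proof -
    have "liminf (\<lambda>n. srd_finite M x n D) < ereal (l + 1 / (real j + 1))" using l by simp
    from near_optimal_horizon[OF this, of "nat \<lceil>overhead * (real j + 1)\<rceil>"] show ?thesis by metis
  qed
  then obtain N0 and K0 :: "nat \<Rightarrow> 'n kernels" where
    N0: "\<And>j. nat \<lceil>overhead * (real j + 1)\<rceil> \<le> N0 j" and
    K0: "\<And>j t. t \<le> N0 j \<Longrightarrow> stochastic_kernel (K0 j) t" "\<And>j. meets_distortion M x (K0 j) (N0 j) D"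
      "\<And>j. information (K0 j) (N0 j) \<le> ereal ((l + 1 / (real j + 1)) * (real (N0 j) + 1))"
    by metis
  define cost where "cost j = (l + 2 / (real j + 1)) * (real (N0 j) + 1)" for j
  have cost_nonneg: "0 \<le> cost j" for j using l_nonneg by (simp add: cost_def)
  have cost: "information (K0 j) (N0 j) + ereal overhead \<le> ereal (cost j)" for j
  proof -
    have "overhead * (real j + 1) \<le> real (N0 j) + 1" using N0[of j] by linarith
    then have "overhead \<le> 1 / (real j + 1) * (real (N0 j) + 1)" by (simp add: field_simps)
    moreover have "cost j = (l + 1 / (real j + 1)) * (real (N0 j) + 1) + 1 / (real j + 1) * (real (N0 j) + 1)"
    proof -
      define d where "d = 1 / (real j + 1)"
      have "cost j = (l + 2 * d) * (real (N0 j) + 1)" by (simp add: cost_def d_def)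
      then show ?thesis unfolding d_def[symmetric] by (simp add: algebra_simps)
    qed
    ultimately have "(l + 1 / (real j + 1)) * (real (N0 j) + 1) + overhead \<le> cost j"
      by linarith
    have "information (K0 j) (N0 j) + ereal overhead \<le>
        ereal ((l + 1 / (real j + 1)) * (real (N0 j) + 1)) + ereal overhead"
      by (intro add_right_mono K0(3))
    also have "\<dots> \<le> ereal (cost j)"
      using \<open>(l + 1 / (real j + 1)) * (real (N0 j) + 1) + overhead \<le> cost j\<close> by simp
    finally show ?thesis .
  qed
  obtain \<sigma> :: "nat \<Rightarrow> nat" where \<sigma>: "\<And>m. eventually (\<lambda>b. m \<le> \<sigma> b) sequentially"
    "\<And>\<epsilon>. 0 < \<epsilon> \<Longrightarrow> eventually (\<lambda>b. cost (\<sigma> b) \<le> \<epsilon> * real b) sequentially"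
    using slow_schedule by metis
  have K0_finite: "information (K0 j) (N0 j) < \<infinity>" for j
    by (rule le_less_trans[OF K0(3)]) simp
  define Ks where "Ks i = K0 (\<sigma> i)" for i
  define N where "N i = N0 (\<sigma> i)" for i
  have Ks: "\<And>i t. t \<le> N i \<Longrightarrow> stochastic_kernel (Ks i) t" "\<And>i. meets_distortion M x (Ks i) (N i) D"
    "\<And>i. information (Ks i) (N i) < \<infinity>"
    using K0(1,2) K0_finite by (simp_all add: Ks_def N_def)
  let ?K = "concatenation Ks N"
  define a where "a b = snd (stage Ks N b)" for b
  have a_mono: "b \<le> b' \<Longrightarrow> a b \<le> a b'" for b b' unfolding a_def by (rule stage_mono)
  have a_ge: "b \<le> a b" for b unfolding a_def by (rule le_stage_length)
  have a_sum: "real (a b) + 1 = (\<Sum>i\<le>b. real (N i) + 1)" for b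
    using arg_cong[OF stage_length[of Ks N b], of real] by (simp add: a_def add.commute sum.distrib)
  have info: "information ?K n \<le> ereal (\<Sum>i\<le>b. cost (\<sigma> i))" if "n \<le> a b" for n b
  proof -
    have "information ?K n \<le> (\<Sum>i\<le>b. information (Ks i) (N i) + ereal overhead)"
      by (rule information_concatenation[OF Ks]) (use that in \<open>auto simp: a_def\<close>)
    also have "\<dots> \<le> (\<Sum>i\<le>b. ereal (cost (\<sigma> i)))"
      by (intro sum_mono) (simp add: Ks_def N_def cost)
    finally show ?thesis by simp
  qed
  have "eventually (\<lambda>n. information_rate M x ?K n \<le> ereal (l + \<epsilon>)) sequentially" if "0 < \<epsilon>" for \<epsilon>
  proof -
    \<comment> \<open>one third for the first blocks, one for the excess rate of the later ones, and one for the
      block in progress\<close>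
    define \<delta> where "\<delta> = \<epsilon> / 3"
    have \<delta>: "0 < \<delta>" using that by (simp add: \<delta>_def)
    obtain i\<^sub>0 where i0: "\<And>i. i\<^sub>0 \<le> i \<Longrightarrow> nat \<lceil>2 / \<delta>\<rceil> \<le> \<sigma> i"
      using \<sigma>(1)[of "nat \<lceil>2 / \<delta>\<rceil>"] by (auto simp: eventually_sequentially)
    obtain b\<^sub>0 where b0: "\<And>b. b\<^sub>0 \<le> b \<Longrightarrow> cost (\<sigma> b) \<le> \<delta> * real b"
      using \<sigma>(2)[OF \<delta>] by (auto simp: eventually_sequentially)
    define C where "C = (\<Sum>i<i\<^sub>0. cost (\<sigma> i))"
    have late: "cost (\<sigma> i) \<le> (l + \<delta>) * (real (N i) + 1)" if "i\<^sub>0 \<le> i" for i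
    proof -
      have "2 / \<delta> \<le> real (\<sigma> i) + 1" using i0[OF that] by linarith
      then have "2 / (real (\<sigma> i) + 1) \<le> \<delta>" using \<delta> by (simp add: field_simps)
      then show ?thesis unfolding cost_def N_def by (intro mult_right_mono) auto
    qed
    have total: "(\<Sum>i\<le>b. cost (\<sigma> i)) \<le> C + (l + \<delta>) * (real (a b) + 1)" for b
    proof -
      have "(\<Sum>i\<le>b. cost (\<sigma> i)) \<le> (\<Sum>i\<le>b. (if i < i\<^sub>0 then cost (\<sigma> i) else 0) + (l + \<delta>) * (real (N i) + 1))"
        using late l_nonneg \<delta> by (intro sum_mono) (auto simp: not_less)
      also have "\<dots> = (\<Sum>i\<le>b. if i < i\<^sub>0 then cost (\<sigma> i) else 0) + (l + \<delta>) * (real (a b) + 1)"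
        by (subst sum.distrib) (simp only: a_sum sum_distrib_left)
      also have "(\<Sum>i\<le>b. if i < i\<^sub>0 then cost (\<sigma> i) else 0) = (\<Sum>i\<in>{..b} \<inter> {..<i\<^sub>0}. cost (\<sigma> i))"
        by (subst sum.inter_restrict) (auto intro!: sum.cong)
      also have "\<dots> \<le> C" unfolding C_def by (rule sum_mono2) (auto simp: cost_nonneg)
      finally show ?thesis by simp
    qed
    show ?thesis
      using eventually_gt_at_top[of "max (a 0) (a b\<^sub>0)"] eventually_ge_at_top[of "nat \<lceil>C / \<delta>\<rceil>"]
    proof eventually_elim
      case (elim n)
      \<comment> \<open>time \<open>n\<close> lies in block \<open>c\<close>, and all blocks before it are complete\<close>
      define c where "c = (LEAST c. n \<le> a c)"
      have nc: "n \<le> a c" unfolding c_def by (rule LeastI[of _ n]) (rule a_ge)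
      with elim have "c \<noteq> 0" by (cases c) auto
      then obtain b where b: "c = Suc b" by (cases c) auto
      have ab: "a b < n"
      proof (rule ccontr)
        assume "\<not> a b < n"
        then have "c \<le> b" unfolding c_def by (intro Least_le) simp
        with b show False by simp
      qed
      have "b\<^sub>0 \<le> Suc b"
      proof (rule ccontr)
        assume "\<not> b\<^sub>0 \<le> Suc b"
        then have "a (Suc b) \<le> a b\<^sub>0" by (intro a_mono) simp
        with nc b elim show False by simp
      qed
      have T: "real (a b) + 1 \<le> real n + 1" "real (Suc b) \<le> real n + 1"
        using ab a_ge[of b] by auto
      have "C / \<delta> \<le> real n + 1" using elim by linarith
      then have C: "C \<le> \<delta> * (real n + 1)" using \<delta> by (simp add: field_simps)
      have "(\<Sum>i\<le>c. cost (\<sigma> i)) = (\<Sum>i\<le>b. cost (\<sigma> i)) + cost (\<sigma> (Suc b))" by (simp add: b)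
      also have "\<dots> \<le> (C + (l + \<delta>) * (real (a b) + 1)) + \<delta> * real (Suc b)"
        by (intro add_mono total b0) fact
      also have "\<dots> \<le> \<delta> * (real n + 1) + (l + \<delta>) * (real n + 1) + \<delta> * (real n + 1)"
        using C T l_nonneg \<delta> by (intro add_mono mult_left_mono) auto
      also have "\<dots> = (l + \<epsilon>) * (real n + 1)" by (simp add: \<delta>_def field_simps)
      finally have "ereal (\<Sum>i\<le>c. cost (\<sigma> i)) \<le> ereal ((l + \<epsilon>) * (real n + 1))" by simp
      then show ?case
        unfolding information_rate_le_iff using info[OF nc] by (rule order_trans[rotated])
    qed
  qed
  then show thesis
    by (intro that[of ?K] stochastic_concatenation[OF Ks] meets_distortion_concatenation[OF Ks])
qed

text \<open>This is the trivial half: kernels for all times are admissible at each horizon.\<close>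
lemma srd_interchanged_ge_liminf:
  "liminf (\<lambda>n. srd_finite M x n D) \<le> srd_interchanged M x D"
  unfolding srd_interchanged_def
proof (rule INF_greatest)
  fix K assume K: "K \<in> {K. (\<forall>t. stochastic_kernel K t) \<and> (\<forall>n. meets_distortion M x K n D) \<and>
    convergent (information_rate M x K)}"
  then have "information_rate M x K \<longlonglongrightarrow> lim (information_rate M x K)"
    by (simp add: convergent_LIMSEQ_iff)
  then have "liminf (information_rate M x K) = lim (information_rate M x K)"
    by (rule lim_imp_Liminf[rotated]) simp
  moreover have "liminf (\<lambda>n. srd_finite M x n D) \<le> liminf (information_rate M x K)"
    using K by (intro Liminf_mono always_eventually allI srd_finite_le_information_rate) auto
  ultimately show "liminf (\<lambda>n. srd_finite M x n D) \<le> lim (information_rate M x K)" by simp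
qed

theorem srd_eq_srd_interchanged:
  "convergent (\<lambda>n. srd_finite M x n D) \<and> srd M x D = srd_interchanged M x D"
proof -
  let ?R = "\<lambda>n. srd_finite M x n D"
  have "0 \<le> liminf ?R" by (rule Liminf_bounded) (simp add: srd_finite_nonneg)
  then consider "liminf ?R = \<infinity>" | l where "liminf ?R = ereal l" by (cases "liminf ?R") auto
  then show ?thesis
  proof cases
    case 1
    then have lim: "?R \<longlonglongrightarrow> \<infinity>" by (intro tendsto_of_limsup_le_liminf) auto
    then have "srd M x D = \<infinity>" unfolding srd_def by (rule limI)
    moreover have "srd_interchanged M x D = \<infinity>"
      using srd_interchanged_ge_liminf 1 by simp
    ultimately show ?thesis using lim by (auto simp: convergent_def)
  next
    case (2 l)
    obtain K :: "'n kernels" where K: "\<And>t. stochastic_kernel K t" "\<And>n. meets_distortion M x K n D"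
      "\<And>\<epsilon>. 0 < \<epsilon> \<Longrightarrow> eventually (\<lambda>n. information_rate M x K n \<le> ereal (l + \<epsilon>)) sequentially"
      using limit_achieving_kernels[OF 2] by metis
    have up: "limsup (information_rate M x K) \<le> ereal l"
    proof (rule ereal_le_epsilon2)
      fix \<epsilon> :: real assume "0 < \<epsilon>"
      from Limsup_bounded[OF K(3)[OF this]]
      show "limsup (information_rate M x K) \<le> ereal l + ereal \<epsilon>" by simp
    qed
    have le: "?R n \<le> information_rate M x K n" for n
      by (rule srd_finite_le_information_rate) (rule K)+
    have "ereal l \<le> liminf (information_rate M x K)"
      unfolding 2[symmetric] by (intro Liminf_mono always_eventually allI le)
    with up have K_lim: "information_rate M x K \<longlonglongrightarrow> ereal l" by (rule tendsto_of_limsup_le_liminf)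
    have "limsup ?R \<le> limsup (information_rate M x K)"
      by (intro Limsup_mono always_eventually allI le)
    also note up
    finally have lim: "?R \<longlonglongrightarrow> ereal l" by (rule tendsto_of_limsup_le_liminf) (simp add: 2)
    then have "srd M x D = ereal l" unfolding srd_def by (rule limI)
    moreover have "srd_interchanged M x D = ereal l"
    proof (rule antisym)
      have "srd_interchanged M x D \<le> lim (information_rate M x K)"
        unfolding srd_interchanged_def
        by (rule INF_lower) (use K K_lim in \<open>auto simp: convergent_def\<close>)
      then show "srd_interchanged M x D \<le> ereal l" using limI[OF K_lim] by simp
      show "ereal l \<le> srd_interchanged M x D" using srd_interchanged_ge_liminf 2 by simp
    qed
    ultimately show ?thesis using lim by (auto simp: convergent_def)
  qed
qed

end

section \<open>The law of a linear process with independent noise\<close>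

text \<open>
  The state as a function of the initial value and the noises, all collected in one sequence \<open>v\<close>
  with the initial value at index 0. The independence hypothesis concerns such sequences.
\<close>
primrec state_of_noise :: "real^'n^'n \<Rightarrow> nat \<Rightarrow> (nat \<Rightarrow> real^'n) \<Rightarrow> real^'n" where
  "state_of_noise A 0 v = v 0"
| "state_of_noise A (Suc t) v = A *v state_of_noise A t v + v (Suc t)"

lemma state_of_noise_measurable:
  "t \<le> n \<Longrightarrow> state_of_noise A t \<in> borel_measurable (paths {..n} :: (nat \<Rightarrow> real^'n::finite) measure)"
proof (induction t)
  case 0
  have "(\<lambda>v. v 0) \<in> borel_measurable (paths {..n} :: (nat \<Rightarrow> real^'n) measure)" by measurable
  then show ?case by (simp add: fun_eq_iff cong: measurable_cong)
next
  case (Suc t)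
  have "(\<lambda>v. v (Suc t)) \<in> borel_measurable (paths {..n} :: (nat \<Rightarrow> real^'n) measure)"
    by (rule measurable_component_singleton) (use Suc.prems in simp)
  moreover have "(\<lambda>v. A *v state_of_noise A t v) \<in> borel_measurable (paths {..n})"
    by (rule borel_measurable_continuous_on[OF matrix_vector_mult_linear_continuous_on])
       (use Suc in simp)
  ultimately have "(\<lambda>v. A *v state_of_noise A t v + v (Suc t)) \<in> borel_measurable (paths {..n})"
    by (rule borel_measurable_add[rotated])
  then show ?case by (simp cong: measurable_cong)
qed

text \<open>
  The states up to time \<open>n\<close> depend on the entries of \<open>v\<close> up to \<open>n\<close>, and the noise that produces the next
  state is entry \<open>Suc n\<close>, hence independent of them.
\<close>

lemma linear_source_of_process:
  fixes M :: "'a measure" and A :: "real^'n^'n::finite" and x w :: "nat \<Rightarrow> 'a \<Rightarrow> real^'n"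
  assumes M: "prob_space M"
    and x0: "distributed M lborel (x 0) g\<^sub>0" and w: "\<And>t. distributed M lborel (w t) g\<^sub>w"
    and indep: "prob_space.indep_vars M (\<lambda>_. borel) (case_nat (x 0) w) UNIV"
    and rec: "\<And>t \<omega>. \<omega> \<in> space M \<Longrightarrow> x (Suc t) \<omega> = A *v x t \<omega> + w t \<omega>"
  shows "linear_source M x A (density lborel g\<^sub>0) (density lborel g\<^sub>w)"
proof -
  interpret prob_space M by (rule M)
  have x0_m [measurable]: "x 0 \<in> borel_measurable M" and w_m [measurable]: "w t \<in> borel_measurable M" for t
    using distributed_measurable[OF x0] distributed_measurable[OF w] by simp_all
  have d0: "distr M borel (x 0) = density lborel g\<^sub>0"
    using distributed_distr_eq_density[OF x0] by (simp add: distr_cong[of M M borel lborel])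
  have dw: "distr M borel (w t) = density lborel g\<^sub>w" for t
    using distributed_distr_eq_density[OF w] by (simp add: distr_cong[of M M borel lborel])
  have x_m [measurable]: "x t \<in> borel_measurable M" for t
  proof (induction t)
    case (Suc t)
    have "(\<lambda>\<omega>. A *v x t \<omega> + w t \<omega>) \<in> borel_measurable M"
      by (intro borel_measurable_add w_m
          borel_measurable_continuous_on[OF matrix_vector_mult_linear_continuous_on] Suc)
    then show ?case by (simp add: rec cong: measurable_cong)
  qed (rule x0_m)
  have path_m: "(\<lambda>\<omega>. \<lambda>t\<in>{..n}. x t \<omega>) \<in> M \<rightarrow>\<^sub>M paths {..n}" for n by measurable
  have step_m: "(\<lambda>(u, v). u(Suc n := A *v u n + v)) \<in> paths {..n} \<Otimes>\<^sub>M borel \<rightarrow>\<^sub>M paths {..Suc n}" for n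
  proof -
    have [measurable]: "(\<lambda>z. fst z n) \<in> borel_measurable (paths {..n} \<Otimes>\<^sub>M (borel :: (real^'n) measure))"
      by (rule measurable_compose[OF measurable_fst measurable_component_singleton]) simp
    have [measurable]: "(\<lambda>z. A *v fst z n) \<in> borel_measurable (paths {..n} \<Otimes>\<^sub>M (borel :: (real^'n) measure))"
      by (rule borel_measurable_continuous_on[OF matrix_vector_mult_linear_continuous_on]) measurable
    show ?thesis unfolding case_prod_beta' by (rule measurable_path_update') measurable
  qed
  have x_state: "x t \<omega> = state_of_noise A t (restrict (\<lambda>i. case_nat (x 0) w i \<omega>) {..n})"
    if "\<omega> \<in> space M" "t \<le> n" for t n \<omega>
    using that(2)
  proof (induction t)
    case (Suc t)
    then show ?case using that(1) by (simp add: rec)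
  qed simp
  show ?thesis
  proof (rule linear_source.intro)
    show "prob_space (density lborel g\<^sub>0)" unfolding d0[symmetric] by (rule prob_space_distr) simp
    show "prob_space (density lborel g\<^sub>w)" unfolding dw[of 0, symmetric] by (rule prob_space_distr) simp
    show "sets (density lborel g\<^sub>0) = sets borel" "sets (density lborel g\<^sub>w) = sets borel" by simp_all
    show "source_law M x 0 = distr (density lborel g\<^sub>0) (paths {..0}) (\<lambda>\<xi>. \<lambda>_\<in>{..0}. \<xi>)"
    proof -
      have m: "(\<lambda>\<xi>. \<lambda>_\<in>{..0}. \<xi>) \<in> borel \<rightarrow>\<^sub>M (paths {..0} :: (nat \<Rightarrow> real^'n) measure)" by measurable
      show ?thesis
        unfolding source_law_def d0[symmetric] distr_distr[OF m x0_m]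
        by (rule distr_cong) (auto simp: fun_eq_iff)
    qed
    fix n
    let ?X = "\<lambda>\<omega>. restrict (\<lambda>i. case_nat (x 0) w i \<omega>)"
    let ?path = "\<lambda>\<omega>. \<lambda>t\<in>{..n}. x t \<omega>"
    have "indep_var (paths {..n}) (\<lambda>\<omega>. ?X \<omega> {..n}) (paths {Suc n}) (\<lambda>\<omega>. ?X \<omega> {Suc n})"
      by (rule indep_var_restrict[OF indep]) auto
    then have "indep_var (paths {..n}) ((\<lambda>v. \<lambda>t\<in>{..n}. state_of_noise A t v) \<circ> (\<lambda>\<omega>. ?X \<omega> {..n}))
      (paths {Suc n}) ((\<lambda>v. v) \<circ> (\<lambda>\<omega>. ?X \<omega> {Suc n}))"
      by (rule indep_var_compose) (auto intro!: measurable_restrict state_of_noise_measurable measurable_ident_sets)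
    then have pair: "distr M (paths {..n}) (\<lambda>\<omega>. \<lambda>t\<in>{..n}. state_of_noise A t (?X \<omega> {..n})) \<Otimes>\<^sub>M
        distr M (paths {Suc n}) (\<lambda>\<omega>. ?X \<omega> {Suc n}) =
      distr M (paths {..n} \<Otimes>\<^sub>M paths {Suc n})
        (\<lambda>\<omega>. (\<lambda>t\<in>{..n}. state_of_noise A t (?X \<omega> {..n}), ?X \<omega> {Suc n}))"
      and rv: "(\<lambda>\<omega>. \<lambda>t\<in>{..n}. state_of_noise A t (?X \<omega> {..n})) \<in> M \<rightarrow>\<^sub>M paths {..n}"
        "(\<lambda>\<omega>. ?X \<omega> {Suc n}) \<in> M \<rightarrow>\<^sub>M paths {Suc n}"
      by (simp_all add: indep_var_distribution_eq comp_def)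
    have ev: "(\<lambda>v. v (Suc n)) \<in> paths {Suc n} \<rightarrow>\<^sub>M (borel :: (real^'n) measure)"
      by (rule measurable_component_singleton) simp
    have w_eq: "distr M borel (w n) = distr (distr M (paths {Suc n}) (\<lambda>\<omega>. ?X \<omega> {Suc n})) borel (\<lambda>v. v (Suc n))"
      by (subst distr_distr[OF ev rv(2)]) (auto intro!: distr_cong)
    let ?P = "distr M (paths {..n}) (\<lambda>\<omega>. \<lambda>t\<in>{..n}. state_of_noise A t (?X \<omega> {..n}))"
    have "?P \<Otimes>\<^sub>M distr M borel (w n) =
      distr ?P (paths {..n}) (\<lambda>u. u) \<Otimes>\<^sub>M
      distr (distr M (paths {Suc n}) (\<lambda>\<omega>. ?X \<omega> {Suc n})) borel (\<lambda>v. v (Suc n))"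
      unfolding w_eq by (simp add: distr_id2)
    also have "\<dots> = distr (?P \<Otimes>\<^sub>M distr M (paths {Suc n}) (\<lambda>\<omega>. ?X \<omega> {Suc n})) (paths {..n} \<Otimes>\<^sub>M borel)
        (\<lambda>(u, v). (u, v (Suc n)))"
    proof (rule pair_measure_distr)
      show "sigma_finite_measure (distr (distr M (paths {Suc n}) (\<lambda>\<omega>. ?X \<omega> {Suc n})) borel (\<lambda>v. v (Suc n)))"
        unfolding w_eq[symmetric] by (intro prob_space_imp_sigma_finite prob_space_distr w_m)
    qed (use ev in simp_all)
    also have "\<dots> = distr M (paths {..n} \<Otimes>\<^sub>M borel) (\<lambda>\<omega>. (\<lambda>t\<in>{..n}. state_of_noise A t (?X \<omega> {..n}), w n \<omega>))"
    proof -
      have "(\<lambda>(u, v). (u, v (Suc n))) \<in> paths {..n} \<Otimes>\<^sub>M paths {Suc n} \<rightarrow>\<^sub>M paths {..n} \<Otimes>\<^sub>M (borel :: (real^'n) measure)"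
        unfolding case_prod_beta' by (intro measurable_Pair measurable_fst measurable_compose[OF measurable_snd ev])
      from distr_distr[OF this measurable_Pair[OF rv]] show ?thesis
        unfolding pair by (simp add: comp_def)
    qed
    also have "distr M (paths {..n}) (\<lambda>\<omega>. \<lambda>t\<in>{..n}. state_of_noise A t (?X \<omega> {..n})) = source_law M x n"
      unfolding source_law_def by (rule distr_cong) (auto simp: x_state fun_eq_iff restrict_def)
    also have "distr M (paths {..n} \<Otimes>\<^sub>M borel) (\<lambda>\<omega>. (\<lambda>t\<in>{..n}. state_of_noise A t (?X \<omega> {..n}), w n \<omega>)) =
      distr M (paths {..n} \<Otimes>\<^sub>M borel) (\<lambda>\<omega>. (?path \<omega>, w n \<omega>))"
      by (rule distr_cong) (auto simp: x_state fun_eq_iff restrict_def)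
    finally have prod: "source_law M x n \<Otimes>\<^sub>M density lborel g\<^sub>w = distr M (paths {..n} \<Otimes>\<^sub>M borel) (\<lambda>\<omega>. (?path \<omega>, w n \<omega>))"
      unfolding dw .
    show "source_law M x (Suc n) = distr (source_law M x n \<Otimes>\<^sub>M density lborel g\<^sub>w) (paths {..Suc n})
      (\<lambda>(u, w). u(Suc n := A *v u n + w))"
      unfolding prod
    proof (subst distr_distr[OF step_m])
      show "(\<lambda>\<omega>. (?path \<omega>, w n \<omega>)) \<in> M \<rightarrow>\<^sub>M paths {..n} \<Otimes>\<^sub>M borel"
        by (intro measurable_Pair path_m w_m)
      show "source_law M x (Suc n) = distr M (paths {..Suc n}) ((\<lambda>(u, v). u(Suc n := A *v u n + v)) \<circ> (\<lambda>\<omega>. (?path \<omega>, w n \<omega>)))"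
        unfolding source_law_def by (rule distr_cong) (auto simp: rec fun_eq_iff le_Suc_eq)
    qed
  qed
qed

theorem theorem1:
  fixes M :: "'a measure"
    and A \<Sigma>\<^sub>w \<Sigma>\<^sub>0 :: "real^'n^'n::finite"
    and x w :: "nat \<Rightarrow> 'a \<Rightarrow> real^'n"
    and D :: real
  assumes "prob_space M"
    and "positive_definite \<Sigma>\<^sub>w"
    and "positive_definite \<Sigma>\<^sub>0"
    and "distributed M lborel (x 0) (\<lambda>v. ennreal (gaussian_density \<Sigma>\<^sub>0 v))"
    and "\<And>t. distributed M lborel (w t) (\<lambda>v. ennreal (gaussian_density \<Sigma>\<^sub>w v))"
    and "prob_space.indep_vars M (\<lambda>_. borel) (case_nat (x 0) w) UNIV"
    and "\<And>t \<omega>. \<omega> \<in> space M \<Longrightarrow> x (Suc t) \<omega> = A *v x t \<omega> + w t \<omega>"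
    and "D > 0"
  shows "convergent (\<lambda>n. srd_finite M x n D) \<and> srd M x D = srd_interchanged M x D"
proof -
  let ?\<mu>\<^sub>0 = "density lborel (\<lambda>v. ennreal (gaussian_density \<Sigma>\<^sub>0 v))"
  let ?\<mu>\<^sub>w = "density lborel (\<lambda>v. ennreal (gaussian_density \<Sigma>\<^sub>w v))"
  interpret linear_source M x A ?\<mu>\<^sub>0 ?\<mu>\<^sub>w
    by (rule linear_source_of_process[OF assms(1,4,5,6,7)])
  obtain q :: "real^'n \<Rightarrow> real^'n" and emb :: "(real^'n) \<times> (real^'n) \<Rightarrow> real^'n"
    and dec :: "real^'n \<Rightarrow> (real^'n) \<times> (real^'n) \<times> (real^'n)" and vol :: real where code:
    "q \<in> borel_measurable borel" "emb \<in> borel \<Otimes>\<^sub>M borel \<rightarrow>\<^sub>M borel"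
    "dec \<in> borel \<rightarrow>\<^sub>M borel \<Otimes>\<^sub>M borel \<Otimes>\<^sub>M borel" "\<And>e p. dec (q e + emb p) = (q e, p)"
    "\<And>e p. (norm (e - (q e + emb p)))\<^sup>2 \<le> D" "\<And>e. (norm (e - q e))\<^sup>2 \<le> D"
    "0 < vol" "\<And>e. ennreal vol \<le> emeasure lborel {z. q z = q e}"
    by (rule grid_code[OF assms(8)]) (rule that)
  obtain C where g0: "\<And>v. 0 < gaussian_density \<Sigma>\<^sub>0 v"
    "\<And>v. \<bar>ln (gaussian_density \<Sigma>\<^sub>0 v)\<bar> \<le> C * (1 + (norm v)\<^sup>2)" "integrable ?\<mu>\<^sub>0 (\<lambda>v. (norm v)\<^sup>2)"
    by (rule gaussian_density_facts[OF assms(3) prob_init]) (rule that)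
  have gw: "integrable ?\<mu>\<^sub>w (\<lambda>v. (norm v)\<^sup>2)"
    by (rule gaussian_density_facts[OF assms(2) prob_noise])
  interpret regular_restart M x A ?\<mu>\<^sub>0 ?\<mu>\<^sub>w D q emb dec "gaussian_density \<Sigma>\<^sub>0" C vol
    by unfold_locales (use code g0 gw in \<open>simp_all\<close>)
  show ?thesis by (rule srd_eq_srd_interchanged)
qed

end
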